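(* There is a randomized polynomial-time $8k$-approximation algorithm for $k$-CS-PIP: on every instance it outputs a feasible solution $x\in\{0,1\}^n$ with expected weight at least $\mathrm{OPT}/(8k)$.
   Context: $k$-CS-PIP: given $w\in\mathbb{R}^n_+$, $c\in\mathbb{R}^m_+$ and $S=(s_{ij})\in\mathbb{R}^{m\times n}_+$ with at most $k$ nonzero entries in each column, maximize $w^Tx$ subject to $Sx\le c$, $x\in\{0,1\}^n$; $\mathrm{OPT}$ is the optimum value.
   Formalization: Instances are restricted to rational w, c and S, since input length, and hence polynomial time, is undefined for arbitrary real data; and k is at least 1, since OPT/(8k) is undefined for k = 0. *)

theory Defs
  imports
    "HOL-Probability.Probability"
    "HOL-Computational_Algebra.Polynomial"
    "HOL-Library.Log_Nat"
begin

text \<open>Column-sparse packing integer programs. Indices are 0-based: items are \<open>j < items I\<close>, rows are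
  \<open>i < rows I\<close>; values of the data outside these ranges are irrelevant.\<close>

record pip =
  items :: nat
  rows :: nat
  weight :: "nat \<Rightarrow> real"
  capacity :: "nat \<Rightarrow> real"
  demand :: "nat \<Rightarrow> nat \<Rightarrow> real"

definition k_CS_PIP :: "nat \<Rightarrow> pip \<Rightarrow> bool" where
  "k_CS_PIP k I \<longleftrightarrow>
     (\<forall>j<items I. 0 \<le> weight I j) \<and>
     (\<forall>i<rows I. 0 \<le> capacity I i) \<and>
     (\<forall>i<rows I. \<forall>j<items I. 0 \<le> demand I i j) \<and>
     (\<forall>j<items I. card {i. i < rows I \<and> demand I i j \<noteq> 0} \<le> k)"

definition feasible :: "pip \<Rightarrow> (nat \<Rightarrow> nat) \<Rightarrow> bool" where
  "feasible I x \<longleftrightarrow>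
     (\<forall>j<items I. x j \<in> {0, 1}) \<and>
     (\<forall>i<rows I. (\<Sum>j<items I. demand I i j * real (x j)) \<le> capacity I i)"

definition total_weight :: "pip \<Rightarrow> (nat \<Rightarrow> nat) \<Rightarrow> real" where
  "total_weight I x = (\<Sum>j<items I. weight I j * real (x j))"

definition OPT :: "pip \<Rightarrow> real" where
  "OPT I = Max {total_weight I x | x. feasible I x}"

text \<open>Running time is measured in the bit model, so the numbers of an input instance are rationals,
  written as numerator and denominator in lowest terms.\<close>

definition rational_data :: "pip \<Rightarrow> bool" where
  "rational_data I \<longleftrightarrow>
     (\<forall>j<items I. weight I j \<in> \<rat>) \<and>
     (\<forall>i<rows I. capacity I i \<in> \<rat>) \<and>
     (\<forall>i<rows I. \<forall>j<items I. demand I i j \<in> \<rat>)"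

definition encode_number :: "real \<Rightarrow> nat list" where
  "encode_number r = (case quotient_of (inv real_of_rat r) of (a, b) \<Rightarrow> [nat a, nat b])"

definition encode :: "pip \<Rightarrow> nat list" where
  "encode I = [items I, rows I] @
     concat (map encode_number
       (map (weight I) [0..<items I] @
        map (capacity I) [0..<rows I] @
        concat (map (\<lambda>i. map (demand I i) [0..<items I]) [0..<rows I])))"

definition bit_length :: "nat \<Rightarrow> nat" where
  "bit_length n = max 1 (floorlog 2 n)"

definition input_size :: "nat list \<Rightarrow> nat" where
  "input_size xs = sum_list (map bit_length xs)"

text \<open>The machine model is a random access machine with logarithmic cost and fair coin flips,
  presented as a structured language. The memory consists of named arrays of natural numbers; a
  scalar variable is cell 0 of its array. Every operation is charged the bit lengths of all its
  operands (array indices included) and of its result, which makes polynomial time coincide with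
  that of probabilistic Turing machines.\<close>

type_synonym state = "string \<Rightarrow> nat \<Rightarrow> nat"

datatype aexp =
    Const nat
  | Cell string aexp
  | Add aexp aexp
  | Sub aexp aexp
  | Mul aexp aexp
  | Div aexp aexp

datatype bexp =
    Less aexp aexp
  | Not bexp
  | And bexp bexp

datatype com =
    Skip
  | Assign string aexp aexp
  | Flip string
  | Seq com com
  | Cond bexp com com
  | While bexp com

fun aval :: "aexp \<Rightarrow> state \<Rightarrow> nat" where
  "aval (Const n) s = n"
| "aval (Cell x a) s = s x (aval a s)"
| "aval (Add a b) s = aval a s + aval b s"
| "aval (Sub a b) s = aval a s - aval b s"
| "aval (Mul a b) s = aval a s * aval b s"
| "aval (Div a b) s = aval a s div aval b s"

fun acost :: "aexp \<Rightarrow> state \<Rightarrow> nat" where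
  "acost (Const n) s = bit_length n"
| "acost (Cell x a) s = acost a s + bit_length (aval (Cell x a) s)"
| "acost (Add a b) s = acost a s + acost b s + bit_length (aval (Add a b) s)"
| "acost (Sub a b) s = acost a s + acost b s + bit_length (aval (Sub a b) s)"
| "acost (Mul a b) s = acost a s + acost b s + bit_length (aval (Mul a b) s)"
| "acost (Div a b) s = acost a s + acost b s + bit_length (aval (Div a b) s)"

fun bval :: "bexp \<Rightarrow> state \<Rightarrow> bool" where
  "bval (Less a b) s \<longleftrightarrow> aval a s < aval b s"
| "bval (Not b) s \<longleftrightarrow> \<not> bval b s"
| "bval (And b c) s \<longleftrightarrow> bval b s \<and> bval c s"

fun bcost :: "bexp \<Rightarrow> state \<Rightarrow> nat" where
  "bcost (Less a b) s = acost a s + acost b s + 1"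
| "bcost (Not b) s = bcost b s + 1"
| "bcost (And b c) s = bcost b s + bcost c s + 1"

definition store :: "string \<Rightarrow> nat \<Rightarrow> nat \<Rightarrow> state \<Rightarrow> state" where
  "store x i v s = s(x := (s x)(i := v))"

definition delay :: "nat \<Rightarrow> (state \<times> nat) pmf \<Rightarrow> (state \<times> nat) pmf" where
  "delay t D = map_pmf (\<lambda>(s, t'). (s, t + t')) D"

text \<open>\<open>runs c s D\<close>: started in \<open>s\<close>, the program \<open>c\<close> halts for every outcome of its coin flips, and
  \<open>D\<close> is the joint distribution of its final state and its running time. If some outcome leads to
  divergence, no such \<open>D\<close> exists.\<close>

inductive runs :: "com \<Rightarrow> state \<Rightarrow> (state \<times> nat) pmf \<Rightarrow> bool" where
  Skip: "runs Skip s (return_pmf (s, 1))"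
| Assign: "runs (Assign x a e) s
     (return_pmf (store x (aval a s) (aval e s) s, acost a s + acost e s + 1))"
| Flip: "runs (Flip x) s
     (map_pmf (\<lambda>h. (store x 0 (of_bool h) s, 1)) (bernoulli_pmf (1 / 2)))"
| Seq: "\<lbrakk>runs c s D; \<And>s' t. (s', t) \<in> set_pmf D \<Longrightarrow> runs d s' (E s')\<rbrakk> \<Longrightarrow>
     runs (Seq c d) s (bind_pmf D (\<lambda>(s', t). delay t (E s')))"
| CondTrue: "\<lbrakk>bval b s; runs c s D\<rbrakk> \<Longrightarrow> runs (Cond b c d) s (delay (bcost b s) D)"
| CondFalse: "\<lbrakk>\<not> bval b s; runs d s D\<rbrakk> \<Longrightarrow> runs (Cond b c d) s (delay (bcost b s) D)"
| WhileFalse: "\<not> bval b s \<Longrightarrow> runs (While b c) s (return_pmf (s, bcost b s))"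
| WhileTrue: "\<lbrakk>bval b s; runs (Seq c (While b c)) s D\<rbrakk> \<Longrightarrow>
     runs (While b c) s (delay (bcost b s) D)"

inductive_cases runs_SeqE: "runs (Seq c d) s D"

inductive_cases runs_CondE: "runs (Cond b c d) s D"
inductive_cases runs_WhileE: "runs (While b c) s D"

lemma runs_deterministic: "runs c s D \<Longrightarrow> runs c s D' \<Longrightarrow> D = D'"
proof (induction arbitrary: D' rule: runs.induct)
  case (Seq c s D d E)
  from Seq.prems obtain D2 E2 where *: "runs c s D2"
    "\<And>s' t. (s', t) \<in> set_pmf D2 \<Longrightarrow> runs d s' (E2 s')"
    "D' = bind_pmf D2 (\<lambda>(s', t). delay t (E2 s'))"
    by (elim runs_SeqE) blast
  have "D = D2" using Seq.IH(1) *(1) by blast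
  moreover from this have "E s' = E2 s'" if "(s', t) \<in> set_pmf D2" for s' t
    using that Seq.IH(2) *(2) by blast
  ultimately show ?case
    unfolding *(3) by (intro bind_pmf_cong) auto
next
  case (CondTrue b s c D d)
  then show ?case by (metis runs_CondE)
next
  case (CondFalse b s d D c)
  then show ?case by (metis runs_CondE)
next
  case (WhileFalse b s c)
  then show ?case by (metis runs_WhileE)
next
  case (WhileTrue b s c D)
  then show ?case by (metis runs_WhileE)
qed (erule runs.cases; simp; fail)+

definition input_state :: "nat list \<Rightarrow> state" where
  "input_state xs = (\<lambda>x i. if x = ''in'' \<and> i < length xs then xs ! i else 0)"

definition solution :: "state \<Rightarrow> nat \<Rightarrow> nat" where
  "solution s = s ''out''"

text \<open>A bound on the running time has to hold for every outcome of the coin flips.\<close>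

definition randomized_poly_time_on :: "com \<Rightarrow> nat list set \<Rightarrow> bool" where
  "randomized_poly_time_on A X \<longleftrightarrow>
     (\<exists>p :: nat poly. \<forall>xs\<in>X. \<exists>D. runs A (input_state xs) D \<and>
        (\<forall>(s, t)\<in>set_pmf D. t \<le> poly p (input_size xs)))"

end

theory Submission imports Defs begin

text \<open>
  The algorithm is deterministic and avoids linear programming solvers. Scale the data to natural
  numbers, drop items that do not fit alone, and put \<open>\<phi>\<^sub>i\<^sub>j = min 1 (2 d\<^sub>i\<^sub>j / c\<^sub>i)\<close>. Every
  feasible set \<open>T\<close> satisfies \<open>\<Sum>\<^sub>j\<^sub>\<in>\<^sub>T \<phi>\<^sub>i\<^sub>j \<le> 2\<close>. For the packing linear program with these rows and
  with \<open>x\<^sub>j \<le> 1\<close>, multiplicative weights (prices that grow by a factor of at most 2 per round) yield,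
  after polynomially many rounds, a fractional \<open>x\<close> with \<open>w x \<ge> 5/8 OPT\<close>.

  The fractional point is rounded by the local ratio technique. The kernel of items \<open>j\<close> and \<open>l\<close> adds, over
  the rows they share, 1 if \<open>j\<close> is large (\<open>\<phi>\<^sub>i\<^sub>j = 1\<close>) and \<open>\<phi>\<^sub>i\<^sub>l\<close> otherwise. An item that no
  longer fits sees kernel mass at least 1 in the items already chosen. On the other hand, a large
  item may meet arbitrarily many small ones, so that no fixed order of the items works, but by double
  counting with weights \<open>x\<close> some remaining item always sees \<open>x\<close>-weighted kernel mass at most \<open>4k\<close>. Processing the
  items in this order loses a factor \<open>4k + 1\<close>, and \<open>(4k + 1) \<cdot> 8/5 \<le> 8k\<close>.
\<close>

section \<open>A program logic for deterministic programs with polynomial running time\<close>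

text \<open>The doubling in \<open>phi\<close> is what makes blocking visible: if an item with 2 d <
  c does not fit, the chosen items fill more than half of the row, so their doubled fractions sum to
  at least 1. The price is the right-hand side 2 instead of 1. The constant 4k is then the product
  of k rows per item, the right-hand side 2, and two ways to charge a kernel entry; the additional 1
  is the item's own coordinate. Since 4k + 1 \<le> 5k, a fractional point worth 5/8 of the optimum
  is enough, and this slack allows a number of rounds that depends on n and m only. That matters
  because all arithmetic is exact: prices and residual weights are integers that carry powers of 2P
  and P as common denominators, so their bit length grows linearly with the number of steps, and the
  analysis needs no rounding errors.\<close>

fun asize :: "aexp \<Rightarrow> nat" where
  "asize (Const n) = bit_length n"
| "asize (Cell x a) = asize a + 1"
| "asize (Add a b) = asize a + asize b + 1"
| "asize (Sub a b) = asize a + asize b + 1"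
| "asize (Mul a b) = asize a + asize b + 1"
| "asize (Div a b) = asize a + asize b + 1"

fun bsize :: "bexp \<Rightarrow> nat" where
  "bsize (Less a b) = (asize a)\<^sup>2 + (asize b)\<^sup>2 + 1"
| "bsize (Not b) = bsize b + 1"
| "bsize (And b c) = bsize b + bsize c + 1"

text \<open>\<open>K\<close> stands for the maximal number of iterations of every single loop.\<close>

fun csize :: "nat \<Rightarrow> com \<Rightarrow> nat" where
  "csize K Skip = 1"
| "csize K (Assign x a e) = (asize a)\<^sup>2 + (asize e)\<^sup>2 + 1"
| "csize K (Flip x) = 1"
| "csize K (Seq c d) = csize K c + csize K d"
| "csize K (Cond b c d) = bsize b + csize K c + csize K d"
| "csize K (While b c) = (K + 1) * bsize b + K * csize K c"

definition bounded_state :: "nat \<Rightarrow> state \<Rightarrow> bool" where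
  "bounded_state B s \<longleftrightarrow> (\<forall>x i. s x i < 2 ^ B)"

lemma bit_length_le: "n < 2 ^ k \<Longrightarrow> 0 < k \<Longrightarrow> bit_length n \<le> k"
  unfolding bit_length_def by (auto simp: floorlog_le_iff)

lemma less_power_bit_length: "n < 2 ^ bit_length n"
proof -
  have "n < 2 ^ floorlog 2 n"
    using floorlog_bounds[of n 2] by (cases "n = 0") auto
  also have "\<dots> \<le> 2 ^ bit_length n"
    unfolding bit_length_def by (intro power_increasing) auto
  finally show ?thesis .
qed

text \<open>Bit lengths add under multiplication and grow by at most one under addition, so each
  node of the expression costs at most B further bits, a constant its own length.\<close>

lemma aval_less:
  assumes "bounded_state B s" "0 < B"
  shows "aval e s < 2 ^ (asize e * B)"
proof (induction e)
  case (Const n)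
  have "n < 2 ^ bit_length n" by (rule less_power_bit_length)
  also have "\<dots> \<le> 2 ^ (bit_length n * B)"
    using assms(2) by (intro power_increasing) auto
  finally show ?case by simp
next
  case (Cell x e)
  have "s x (aval e s) < 2 ^ B" using assms(1) by (auto simp: bounded_state_def)
  also have "\<dots> \<le> 2 ^ (asize (Cell x e) * B)" by (intro power_increasing) auto
  finally show ?case by simp
next
  case (Add a b)
  let ?x = "asize a * B" and ?y = "asize b * B"
  have "aval a s + aval b s < 2 ^ ?x + 2 ^ ?y" using Add by simp
  also have "\<dots> \<le> 2 ^ (?x + ?y) + 2 ^ (?x + ?y)"
    by (intro add_mono power_increasing) auto
  also have "\<dots> = 2 ^ (?x + ?y + 1)" by simp
  also have "\<dots> \<le> 2 ^ (asize (Add a b) * B)"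
    using assms(2) by (intro power_increasing) (auto simp: algebra_simps)
  finally show ?case by simp
next
  case (Sub a b)
  have "aval a s - aval b s < 2 ^ (asize a * B)" using Sub by simp
  also have "\<dots> \<le> 2 ^ (asize (Sub a b) * B)"
    by (intro power_increasing) (auto simp: algebra_simps)
  finally show ?case by simp
next
  case (Mul a b)
  have "aval a s * aval b s < 2 ^ (asize a * B) * 2 ^ (asize b * B)"
    using Mul by (intro mult_strict_mono) auto
  also have "\<dots> = 2 ^ (asize a * B + asize b * B)" by (simp add: power_add)
  also have "\<dots> \<le> 2 ^ (asize (Mul a b) * B)"
    by (intro power_increasing) (auto simp: algebra_simps)
  finally show ?case by simp
next
  case (Div a b)
  have "aval a s div aval b s \<le> aval a s" by (rule div_le_dividend)
  also have "\<dots> < 2 ^ (asize a * B)" using Div by simp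
  also have "\<dots> \<le> 2 ^ (asize (Div a b) * B)"
    by (intro power_increasing) (auto simp: algebra_simps)
  finally show ?case by simp
qed

text \<open>Every node is charged the bit length of its value, at most \<open>asize\<close> times B,
  and there are at most \<open>asize\<close> nodes; hence the square.\<close>

lemma acost_le:
  assumes "bounded_state B s" "0 < B"
  shows "acost e s \<le> (asize e)\<^sup>2 * B"
proof (induction e)
  case (Const n)
  have "bit_length n * 1 \<le> bit_length n * (bit_length n * B)"
    using assms(2) by (intro mult_left_mono) (auto simp: bit_length_def)
  then show ?case by (simp add: power2_eq_square mult.assoc)
next
  case (Cell x a)
  have "bit_length (aval (Cell x a) s) \<le> B"
    using assms by (intro bit_length_le) (auto simp: bounded_state_def)
  then have "acost (Cell x a) s \<le> (asize a)\<^sup>2 * B + B"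
    using Cell by (simp del: aval.simps)
  then show ?case by (simp add: power2_eq_square algebra_simps)
next
  case (Add a b)
  have "bit_length (aval (Add a b) s) \<le> (asize a + asize b + 1) * B"
    using aval_less[OF assms, of "Add a b"] assms(2) by (intro bit_length_le) auto
  then show ?case using Add by (simp add: power2_eq_square algebra_simps)
next
  case (Sub a b)
  have "bit_length (aval (Sub a b) s) \<le> (asize a + asize b + 1) * B"
    using aval_less[OF assms, of "Sub a b"] assms(2) by (intro bit_length_le) auto
  then show ?case using Sub by (simp add: power2_eq_square algebra_simps)
next
  case (Mul a b)
  have "bit_length (aval (Mul a b) s) \<le> (asize a + asize b + 1) * B"
    using aval_less[OF assms, of "Mul a b"] assms(2) by (intro bit_length_le) auto
  then show ?case using Mul by (simp add: power2_eq_square algebra_simps)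
next
  case (Div a b)
  have "bit_length (aval (Div a b) s) \<le> (asize a + asize b + 1) * B"
    using aval_less[OF assms, of "Div a b"] assms(2) by (intro bit_length_le) auto
  then show ?case using Div by (simp add: power2_eq_square algebra_simps)
qed

lemma bcost_le:
  assumes "bounded_state B s" "0 < B"
  shows "bcost b s \<le> bsize b * B"
proof (induction b)
  case (Less a b)
  show ?case using acost_le[OF assms, of a] acost_le[OF assms, of b] assms(2)
    by (simp add: algebra_simps)
qed (use assms(2) in \<open>auto simp: algebra_simps\<close>)

text \<open>Total correctness including resources: all cells stay below \<open>2 ^ B\<close> and every loop makes at most
  \<open>K\<close> iterations, so that the running time follows from the syntax of the program alone.\<close>

definition wp :: "nat \<Rightarrow> nat \<Rightarrow> com \<Rightarrow> state \<Rightarrow> (state \<Rightarrow> bool) \<Rightarrow> bool" where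
  "wp B K c s Q \<longleftrightarrow> (bounded_state B s \<and> 0 < B \<longrightarrow>
     (\<exists>s' t. runs c s (return_pmf (s', t)) \<and> t \<le> csize K c * B \<and> bounded_state B s' \<and> Q s'))"

text \<open>Since \<open>wp\<close> promises something only for bounded starting states, boundedness
  may be assumed wherever it helps, for instance to see that copying a cell cannot overflow.\<close>

lemma wp_boundedI: "(bounded_state B s \<Longrightarrow> 0 < B \<Longrightarrow> wp B K c s Q) \<Longrightarrow> wp B K c s Q"
  unfolding wp_def by blast

lemma wp_mono: "wp B K c s Q \<Longrightarrow> (\<And>s'. Q s' \<Longrightarrow> Q' s') \<Longrightarrow> wp B K c s Q'"
  unfolding wp_def by blast

section \<open>Proof rules for the program constructs\<close>

lemma delay_return: "delay t (return_pmf (s, t')) = return_pmf (s, t + t')"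
  by (simp add: delay_def)

lemma wp_Skip: "Q s \<Longrightarrow> wp B K Skip s Q"
  unfolding wp_def by (auto intro!: exI runs.Skip)

text \<open>Assignment is where cells grow, so this rule carries the overflow obligation.
  \<open>Flip\<close> gets no rule, because \<open>wp\<close> demands a point mass as
  outcome.\<close>

lemma wp_Assign:
  assumes "aval e s < 2 ^ B" "Q (store x (aval a s) (aval e s) s)"
  shows "wp B K (Assign x a e) s Q"
  unfolding wp_def
proof (intro impI exI conjI)
  assume *: "bounded_state B s \<and> 0 < B"
  show "runs (Assign x a e) s
    (return_pmf (store x (aval a s) (aval e s) s, acost a s + acost e s + 1))"
    by (rule runs.Assign)
  show "acost a s + acost e s + 1 \<le> csize K (Assign x a e) * B"
    using acost_le[of B s a] acost_le[of B s e] * by (simp add: algebra_simps)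
  show "bounded_state B (store x (aval a s) (aval e s) s)"
    using * assms(1) by (auto simp: bounded_state_def store_def)
qed (use assms in simp)

lemma wp_Seq:
  assumes "wp B K c s (\<lambda>s'. wp B K d s' Q)"
  shows "wp B K (Seq c d) s Q"
  unfolding wp_def
proof (intro impI)
  assume *: "bounded_state B s \<and> 0 < B"
  obtain s1 t1 where 1: "runs c s (return_pmf (s1, t1))" "t1 \<le> csize K c * B"
    "bounded_state B s1" "wp B K d s1 Q" using assms * unfolding wp_def[of B K c] by blast
  obtain s2 t2 where 2: "runs d s1 (return_pmf (s2, t2))" "t2 \<le> csize K d * B"
    "bounded_state B s2" "Q s2" using 1 * unfolding wp_def[of B K d] by blast
  have "runs (Seq c d) s (bind_pmf (return_pmf (s1, t1)) (\<lambda>(s', t). delay t (return_pmf (s2, t2))))"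
    using 1(1) 2(1) by (intro runs.Seq) auto
  then have "runs (Seq c d) s (return_pmf (s2, t1 + t2))"
    by (simp add: bind_return_pmf delay_return)
  then show "\<exists>s' t. runs (Seq c d) s (return_pmf (s', t)) \<and> t \<le> csize K (Seq c d) * B \<and>
      bounded_state B s' \<and> Q s'"
    using 1(2) 2(2-4) by (intro exI[of _ s2] exI[of _ "t1 + t2"]) (auto simp: algebra_simps)
qed

lemma wp_Cond:
  assumes "bval b s \<Longrightarrow> wp B K c s Q" "\<not> bval b s \<Longrightarrow> wp B K d s Q"
  shows "wp B K (Cond b c d) s Q"
  unfolding wp_def
proof (intro impI)
  assume *: "bounded_state B s \<and> 0 < B"
  then have b: "bcost b s \<le> bsize b * B" using bcost_le by blast
  show "\<exists>s' t. runs (Cond b c d) s (return_pmf (s', t)) \<and> t \<le> csize K (Cond b c d) * B \<and>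
      bounded_state B s' \<and> Q s'"
  proof (cases "bval b s")
    case True
    then obtain s1 t1 where 1: "runs c s (return_pmf (s1, t1))" "t1 \<le> csize K c * B"
      "bounded_state B s1" "Q s1" using assms(1) * unfolding wp_def by blast
    show ?thesis using runs.CondTrue[OF True 1(1), of d] 1(2-4) b unfolding delay_return
      by (intro exI[of _ s1] exI[of _ "bcost b s + t1"]) (auto simp: algebra_simps)
  next
    case False
    then obtain s1 t1 where 1: "runs d s (return_pmf (s1, t1))" "t1 \<le> csize K d * B"
      "bounded_state B s1" "Q s1" using assms(2) * unfolding wp_def by blast
    show ?thesis using runs.CondFalse[OF False 1(1), of c] 1(2-4) b unfolding delay_return
      by (intro exI[of _ s1] exI[of _ "bcost b s + t1"]) (auto simp: algebra_simps)
  qed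
qed

text \<open>The index of \<open>J\<close> counts iterations. \<open>step\<close> and
  \<open>stop\<close> together force exactly n of them, so termination and time come out of one
  induction on the iterations left; the guard is evaluated once more often than the body.\<close>

lemma runs_While_counted:
  assumes step: "\<And>i s. J i s \<Longrightarrow> bounded_state B s \<Longrightarrow> i < n \<Longrightarrow> bval b s \<and> wp B K c s (J (Suc i))"
    and stop: "\<And>s. J n s \<Longrightarrow> \<not> bval b s"
    and "0 < B" "J i s" "bounded_state B s" "i \<le> n"
  shows "\<exists>s' t. runs (While b c) s (return_pmf (s', t)) \<and>
     t \<le> ((n - i + 1) * bsize b + (n - i) * csize K c) * B \<and> bounded_state B s' \<and> J n s'"
  using assms(4-6)
proof (induction "n - i" arbitrary: i s)
  case 0
  then have "i = n" by simp
  then have "runs (While b c) s (return_pmf (s, bcost b s))"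
    using stop 0 by (intro runs.WhileFalse) auto
  then show ?case using 0 \<open>i = n\<close> bcost_le[of B s b] \<open>0 < B\<close> by auto
next
  case (Suc d)
  then have "i < n" by simp
  then have bv: "bval b s" and w: "wp B K c s (J (Suc i))" using step Suc by auto
  obtain s1 t1 where 1: "runs c s (return_pmf (s1, t1))" "t1 \<le> csize K c * B"
      "bounded_state B s1" "J (Suc i) s1" using w Suc.prems \<open>0 < B\<close> unfolding wp_def by blast
  have "d = n - Suc i" using Suc.hyps(2) by simp
  from Suc.hyps(1)[OF this 1(4,3)] \<open>i < n\<close> obtain s2 t2 where
    2: "runs (While b c) s1 (return_pmf (s2, t2))"
     "t2 \<le> ((n - Suc i + 1) * bsize b + (n - Suc i) * csize K c) * B" "bounded_state B s2" "J n s2"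
    by auto
  have "runs (Seq c (While b c)) s
      (bind_pmf (return_pmf (s1, t1)) (\<lambda>(s', t). delay t (return_pmf (s2, t2))))"
    using 1(1) 2(1) by (intro runs.Seq) auto
  then have "runs (Seq c (While b c)) s (return_pmf (s2, t1 + t2))"
    by (simp add: bind_return_pmf delay_return)
  from runs.WhileTrue[OF bv this] have r: "runs (While b c) s (return_pmf (s2, bcost b s + (t1 + t2)))"
    by (simp add: delay_return)
  obtain e where e: "n - i = Suc e" "n - Suc i = e" using Suc.hyps(2) \<open>d = n - Suc i\<close> by metis
  have "bcost b s + (t1 + t2) \<le> ((n - i + 1) * bsize b + (n - i) * csize K c) * B"
    using bcost_le[of B s b] Suc.prems \<open>0 < B\<close> 1(2) 2(2) unfolding e by (simp add: algebra_simps)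
  with r 2 show ?case by blast
qed

fun writes :: "com \<Rightarrow> string set" where
  "writes Skip = {}"
| "writes (Assign x a e) = {x}"
| "writes (Flip x) = {x}"
| "writes (Seq c d) = writes c \<union> writes d"
| "writes (Cond b c d) = writes c \<union> writes d"
| "writes (While b c) = writes c"

lemma runs_unchanged:
  "runs c s D \<Longrightarrow> (s', t) \<in> set_pmf D \<Longrightarrow> x \<notin> writes c \<Longrightarrow> s' x = s x"
proof (induction arbitrary: s' t rule: runs.induct)
  case (Seq c s D d E)
  then show ?case by (fastforce simp: delay_def)
qed (auto simp: store_def delay_def)

text \<open>Arrays that the program text never assigns keep their contents, so invariants need to
  mention only what a loop changes.\<close>

lemma wp_frame:
  assumes "wp B K c s (\<lambda>s'. (\<forall>x. x \<notin> writes c \<longrightarrow> s' x = s x) \<longrightarrow> Q s')"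
  shows "wp B K c s Q"
  unfolding wp_def
proof (intro impI)
  assume "bounded_state B s \<and> 0 < B"
  with assms obtain s' t where *: "runs c s (return_pmf (s', t))" "t \<le> csize K c * B"
    "bounded_state B s'" "(\<forall>x. x \<notin> writes c \<longrightarrow> s' x = s x) \<longrightarrow> Q s'" unfolding wp_def by blast
  with runs_unchanged[OF *(1)] show "\<exists>s' t. runs c s (return_pmf (s', t)) \<and>
      t \<le> csize K c * B \<and> bounded_state B s' \<and> Q s'" by auto
qed

abbreviation Var :: "string \<Rightarrow> aexp" where
  "Var x \<equiv> Cell x (Const 0)"

definition For :: "string \<Rightarrow> string \<Rightarrow> com \<Rightarrow> com" where
  "For v h c = Seq (Assign v (Const 0) (Const 0))
     (While (Less (Var v) (Var h)) (Seq c (Assign v (Const 0) (Add (Var v) (Const 1)))))"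

lemma writes_For [simp]: "writes (For v h c) = insert v (writes c)"
  by (auto simp: For_def)

lemma store_apply: "store x i a s y j = (if y = x \<and> j = i then a else s y j)"
  by (auto simp: store_def)

lemma store_other: "y \<noteq> x \<Longrightarrow> store x i a s y = s y"
  by (auto simp: store_def)

text \<open>The limit is read anew in every iteration, hence the body must not assign
  \<open>h\<close>. \<open>I i\<close> holds before the body of iteration i; \<open>counter\<close>
  says that it does not depend on the counter cell, and so survives its reset and its increments.
  The frame facts refer back to the state before the loop.\<close>

lemma wp_For:
  assumes n: "s h 0 = n" "n \<le> K"
    and vh: "v \<noteq> h" "v \<notin> writes c" "h \<notin> writes c"
    and init: "I 0 s"
    and counter: "\<And>i a s'. I i s' \<Longrightarrow> I i (store v 0 a s')"
    and step: "\<And>i s'. i < n \<Longrightarrow> (\<And>x. x \<noteq> v \<Longrightarrow> x \<notin> writes c \<Longrightarrow> s' x = s x) \<Longrightarrow> s' v 0 = i \<Longrightarrow>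
       bounded_state B s' \<Longrightarrow> I i s' \<Longrightarrow> wp B K c s' (I (Suc i))"
    and final: "\<And>s'. (\<And>x. x \<noteq> v \<Longrightarrow> x \<notin> writes c \<Longrightarrow> s' x = s x) \<Longrightarrow> I n s' \<Longrightarrow> Q s'"
  shows "wp B K (For v h c) s Q"
proof (rule wp_boundedI)
  assume B: "bounded_state B s" "0 < B"
  define J where "J i s' \<longleftrightarrow> (\<forall>x. x \<noteq> v \<longrightarrow> x \<notin> writes c \<longrightarrow> s' x = s x) \<and> s' v 0 = i \<and> I i s'"
    for i s'
  let ?b = "Less (Var v) (Var h)"
  let ?c = "Seq c (Assign v (Const 0) (Add (Var v) (Const 1)))"
  \<comment> \<open>The counter never exceeds the limit, and the limit already sits in a cell, so
    the increment cannot overflow.\<close>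
  have n2: "n < 2 ^ B" using B n by (auto simp: bounded_state_def)
  have "wp B K (While ?b ?c) (store v 0 0 s) (J n)"
    unfolding wp_def
  proof (intro impI)
    assume B': "bounded_state B (store v 0 0 s) \<and> 0 < B"
    have "\<exists>s' t. runs (While ?b ?c) (store v 0 0 s) (return_pmf (s', t)) \<and>
       t \<le> ((n - 0 + 1) * bsize ?b + (n - 0) * csize K ?c) * B \<and> bounded_state B s' \<and> J n s'"
    proof (rule runs_While_counted)
      fix i s' assume *: "J i s'" "bounded_state B s'" "i < n"
      have hs: "s' h 0 = n" using * vh n by (auto simp: J_def)
      have "wp B K c s' (\<lambda>s''. (\<forall>x. x \<notin> writes c \<longrightarrow> s'' x = s' x) \<longrightarrow>
          wp B K (Assign v (Const 0) (Add (Var v) (Const 1))) s'' (J (Suc i)))"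
      proof (rule wp_mono)
        show "wp B K c s' (I (Suc i))" using * by (intro step) (auto simp: J_def)
        fix s'' assume I: "I (Suc i) s''"
        show "(\<forall>x. x \<notin> writes c \<longrightarrow> s'' x = s' x) \<longrightarrow>
          wp B K (Assign v (Const 0) (Add (Var v) (Const 1))) s'' (J (Suc i))"
        proof (intro impI wp_Assign)
          assume fr: "\<forall>x. x \<notin> writes c \<longrightarrow> s'' x = s' x"
          then have v: "s'' v 0 = i" using * vh by (auto simp: J_def)
          show "aval (Add (Var v) (Const 1)) s'' < 2 ^ B" using v *(3) n2 by simp
          show "J (Suc i) (store v (aval (Const 0) s'') (aval (Add (Var v) (Const 1)) s'') s'')"
            using fr * v counter[OF I] unfolding J_def by (auto simp: store_apply store_other)
        qed
      qed
      then have "wp B K c s' (\<lambda>s''. wp B K (Assign v (Const 0) (Add (Var v) (Const 1))) s'' (J (Suc i)))"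
        by (rule wp_frame)
      then show "bval ?b s' \<and> wp B K ?c s' (J (Suc i))"
        using hs * by (auto simp: J_def intro: wp_Seq)
    next
      fix s' assume "J n s'"
      then show "\<not> bval ?b s'" using vh n by (auto simp: J_def)
    next
      show "J 0 (store v 0 0 s)" using counter[OF init] by (auto simp: J_def store_apply store_other)
    qed (use B' in auto)
    moreover have "((n - 0 + 1) * bsize ?b + (n - 0) * csize K ?c) * B \<le> csize K (While ?b ?c) * B"
      using n(2) unfolding csize.simps(6) by (intro mult_right_mono add_mono) auto
    ultimately show "\<exists>s' t. runs (While ?b ?c) (store v 0 0 s) (return_pmf (s', t)) \<and>
       t \<le> csize K (While ?b ?c) * B \<and> bounded_state B s' \<and> J n s'"
      by (meson order_trans)
  qed
  then have "wp B K (While ?b ?c) (store v 0 0 s) Q"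
    by (rule wp_mono) (auto simp: J_def intro!: final)
  then show ?thesis unfolding For_def by (intro wp_Seq wp_Assign) auto
qed

section \<open>Polynomially bounded functions\<close>

definition poly_bounded :: "(nat \<Rightarrow> nat) \<Rightarrow> bool" where
  "poly_bounded f \<longleftrightarrow> (\<exists>p :: nat poly. \<forall>x. f x \<le> poly p x)"

lemma poly_bounded_const: "poly_bounded (\<lambda>x. c)"
  unfolding poly_bounded_def by (intro exI[of _ "[:c:]"]) auto

lemma poly_bounded_ident: "poly_bounded (\<lambda>x. x)"
  unfolding poly_bounded_def by (intro exI[of _ "[:0, 1:]"]) auto

lemma poly_bounded_add: "poly_bounded f \<Longrightarrow> poly_bounded g \<Longrightarrow> poly_bounded (\<lambda>x. f x + g x)"
  unfolding poly_bounded_def by (metis add_mono poly_add)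

lemma poly_bounded_mult: "poly_bounded f \<Longrightarrow> poly_bounded g \<Longrightarrow> poly_bounded (\<lambda>x. f x * g x)"
  unfolding poly_bounded_def by (metis mult_mono poly_mult zero_le)

lemma poly_bounded_power: "poly_bounded f \<Longrightarrow> poly_bounded (\<lambda>x. f x ^ e)"
  by (induction e) (auto intro: poly_bounded_mult poly_bounded_const)

text \<open>For a fixed program, the syntactic cost is a polynomial in the loop bound, of degree at
  most the nesting depth of its loops.\<close>

lemma poly_bounded_csize: "poly_bounded g \<Longrightarrow> poly_bounded (\<lambda>x. csize (g x) c)"
  by (induction c)
    (auto intro!: poly_bounded_const poly_bounded_add poly_bounded_mult
       simp del: add_Suc add_Suc_right mult_Suc)

section \<open>Multiplicative weights and local ratio\<close>

text \<open>Convexity of exp puts the function below its chord on [0, 1]. It turns linear price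
  updates into exponentials of loads; the base 2 is why ln 2 enters the final estimate.\<close>

lemma two_powr_le:
  fixes a :: real
  assumes "0 \<le> a" "a \<le> 1"
  shows "2 powr a \<le> 1 + a"
proof -
  have "exp ((1 - a) *\<^sub>R 0 + a *\<^sub>R ln 2) \<le> (1 - a) * exp 0 + a * exp (ln 2 :: real)"
    using assms by (intro convex_onD[OF exp_convex]) auto
  then show ?thesis by (simp add: powr_def)
qed

lemma of_nat_diff_ge: "real a - real b \<le> real (a - b)"
  by linarith

section \<open>Scaled packing rows and the kernel\<close>

locale integer_packing =
  fixes n m :: nat and w c :: "nat \<Rightarrow> nat" and d :: "nat \<Rightarrow> nat \<Rightarrow> nat"
begin

definition fits :: "nat set \<Rightarrow> bool" where
  "fits T \<longleftrightarrow> T \<subseteq> {..<n} \<and> (\<forall>i<m. (\<Sum>j\<in>T. d i j) \<le> c i)"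

text \<open>A common multiple of the positive capacities, so that the quotients in
  \<open>phi\<close> become integers. A plain product is good enough, as only its bit length
  matters.\<close>

definition P :: nat where
  "P = (\<Prod>i<m. if 0 < c i then c i else 1)"

text \<open>An item that does not fit alone keeps its index and loses its weight instead. No
  feasible set contains such an item.\<close>

definition u :: "nat \<Rightarrow> nat" where
  "u j = (if \<exists>i<m. c i < d i j then 0 else w j)"

text \<open>This is \<open>P \<cdot> min 1 (2 d\<^sub>i\<^sub>j / c\<^sub>i)\<close>, the division being exact; for \<open>d\<^sub>i\<^sub>j = c\<^sub>i = 0\<close> it is 0 because
  \<open>0 div 0 = 0\<close>.\<close>

definition phi :: "nat \<Rightarrow> nat \<Rightarrow> nat" where
  "phi i j = (if c i < 2 * d i j then P else 2 * d i j * P div c i)"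

text \<open>Entries are scaled by \<open>2 P\<close>. The rows from \<open>m\<close> on express \<open>x\<^sub>j \<le> 1\<close>.\<close>

definition E :: "nat \<Rightarrow> nat \<Rightarrow> nat" where
  "E i j = (if i < m then phi i j else if i = m + j then 2 * P else 0)"

text \<open>The asymmetry mirrors how items get blocked. A large item can be blocked by one tiny
  item of its row, so every item using the row must count fully. A small item is blocked only when
  half of the row is full, and then the fractions suffice.\<close>

definition ker_term :: "nat \<Rightarrow> nat \<Rightarrow> nat \<Rightarrow> nat" where
  "ker_term i j l = (if 0 < phi i j then
     (if phi i j < P then phi i l else if 0 < phi i l then P else 0) else 0)"

definition ker :: "nat \<Rightarrow> nat \<Rightarrow> nat" where
  "ker j l = (\<Sum>i<m. ker_term i j l)"

lemma P_pos: "0 < P"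
  unfolding P_def by (intro prod_pos) auto

lemma c_dvd_P: "i < m \<Longrightarrow> 0 < c i \<Longrightarrow> c i dvd P"
  unfolding P_def by (rule dvd_trans[OF _ dvd_prodI[of _ i]]) auto

text \<open>The division is exact because c i divides P. If c i = 0, the hypothesis forces d i j = 0
  and both sides vanish.\<close>

lemma phi_mult_c:
  assumes "i < m" "2 * d i j \<le> c i"
  shows "c i * phi i j = 2 * d i j * P"
proof (cases "c i = 0")
  case False
  then have "c i dvd 2 * d i j * P" using c_dvd_P assms(1) by auto
  then show ?thesis using assms by (simp add: phi_def)
qed (use assms in auto)

lemma phi_le: "i < m \<Longrightarrow> phi i j \<le> P"
proof (cases "c i < 2 * d i j")
  case False
  assume "i < m"
  have "2 * d i j * P div c i \<le> c i * P div c i" using False by (intro div_le_mono) auto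
  then show ?thesis using False by (cases "c i = 0") (auto simp: phi_def)
qed (auto simp: phi_def)

lemma phi_pos_iff: "i < m \<Longrightarrow> 0 < phi i j \<longleftrightarrow> 0 < d i j"
proof (cases "c i < 2 * d i j")
  case True
  then show ?thesis using P_pos by (auto simp: phi_def)
next
  case False
  assume "i < m"
  then have "c i * phi i j = 2 * d i j * P" using phi_mult_c False by auto
  then show ?thesis using P_pos False
    by (cases "c i = 0") (auto simp: phi_def, metis mult_is_0 neq0_conv, metis mult_is_0 neq0_conv zero_neq_numeral)
qed

lemma c_mult_phi_le: "i < m \<Longrightarrow> c i * phi i j \<le> 2 * d i j * P"
  using phi_mult_c[of i j] by (cases "2 * d i j \<le> c i") (auto simp: phi_def)

text \<open>This includes the boundary c = 2 d, where \<open>phi\<close> takes its second branch but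
  the quotient is P; positivity of d excludes c = d = 0.\<close>

lemma phi_eq_P:
  assumes "i < m" "c i \<le> 2 * d i j" "0 < d i j"
  shows "phi i j = P"
proof (cases "c i < 2 * d i j")
  case False
  then have "c i * phi i j = c i * P" "0 < c i" using phi_mult_c[of i j] assms by auto
  then show ?thesis by simp
qed (auto simp: phi_def)

lemma fits_sum_phi_le:
  assumes "fits T" "i < m"
  shows "(\<Sum>j\<in>T. phi i j) \<le> 2 * P"
proof -
  have T: "finite T" using assms(1) by (auto simp: fits_def intro: finite_subset)
  have s: "(\<Sum>j\<in>T. d i j) \<le> c i" using assms by (auto simp: fits_def)
  show ?thesis
  proof (cases "c i = 0")
    case True
    then have "\<forall>j\<in>T. d i j = 0" using s T by auto
    then have "\<forall>j\<in>T. phi i j = 0" using phi_pos_iff[OF assms(2)] by (metis neq0_conv)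
    then show ?thesis by simp
  next
    case False
    have "c i * (\<Sum>j\<in>T. phi i j) \<le> (\<Sum>j\<in>T. 2 * d i j * P)"
      unfolding sum_distrib_left using c_mult_phi_le[OF assms(2)] by (intro sum_mono) auto
    also have "\<dots> = 2 * P * (\<Sum>j\<in>T. d i j)" by (simp add: sum_distrib_left mult_ac)
    also have "\<dots> \<le> c i * (2 * P)" using s by simp
    finally show ?thesis using False by simp
  qed
qed

text \<open>All m + n rows get the same right-hand side, which lets one price total serve for all of
  them. A row from m on has a single nonzero entry.\<close>

lemma fits_sum_E_le:
  assumes "fits T"
  shows "(\<Sum>j\<in>T. E i j) \<le> 2 * P"
proof (cases "i < m")
  case True
  then show ?thesis using fits_sum_phi_le[OF assms] by (simp add: E_def)
next
  case False
  have T: "finite T" using assms(1) by (auto simp: fits_def intro: finite_subset)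
  have "(\<Sum>j\<in>T. E i j) = (\<Sum>j\<in>T. if j = i - m then 2 * P else 0)"
    using False by (intro sum.cong) (auto simp: E_def)
  then show ?thesis using T by simp
qed

text \<open>Width 1 after division by 2P: the chord bound for powers of 2 applies to each entry, and
  each update at most doubles a price.\<close>

lemma E_le: "E i j \<le> 2 * P"
  using phi_le[of i j] by (auto simp: E_def)

lemma fits_u_eq:
  assumes "fits T" "j \<in> T"
  shows "u j = w j"
proof -
  have "finite T" using assms(1) by (auto simp: fits_def intro: finite_subset)
  then have "d i j \<le> (\<Sum>j\<in>T. d i j)" for i using assms(2) by (intro member_le_sum) auto
  then have "d i j \<le> c i" if "i < m" for i using assms(1) that by (meson fits_def le_trans)
  then show ?thesis by (fastforce simp: u_def)
qed

text \<open>After \<open>t\<close> rounds the prices \<open>Y\<close> carry the common scaling factor \<open>(2 P) ^ t\<close>. They are exponential in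
  the loads of the rows, and their sum is at most exponential in the weight collected so far.\<close>

definition mw_inv :: "nat \<Rightarrow> (nat \<Rightarrow> nat) \<Rightarrow> (nat \<Rightarrow> nat) \<Rightarrow> bool" where
  "mw_inv t X Y \<longleftrightarrow> (\<Sum>j<n. X j) = t \<and>
     (\<forall>i<m + n. 0 < Y i \<and> Y i \<le> (4 * P) ^ t \<and>
        real (2 * P) ^ t * 2 powr (real (\<Sum>j<n. E i j * X j) / real (2 * P)) \<le> real (Y i)) \<and>
     (\<forall>T. fits T \<longrightarrow> 0 < sum u T \<longrightarrow>
        real (\<Sum>i<m + n. Y i) \<le>
          real (m + n) * real (2 * P) ^ t * exp (real (\<Sum>j<n. X j * u j) / real (sum u T)))"

section \<open>Growth of the prices and the resulting fractional point\<close>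

lemma mw_inv_init: "mw_inv 0 (\<lambda>_. 0) (\<lambda>i. if i < m + n then 1 else 0)"
  by (auto simp: mw_inv_def)

lemma mw_inv_cong:
  assumes "mw_inv t X Y" "\<And>j. j < n \<Longrightarrow> X' j = X j" "\<And>i. i < m + n \<Longrightarrow> Y' i = Y i"
  shows "mw_inv t X' Y'"
proof -
  have "(\<Sum>j<n. X' j) = (\<Sum>j<n. X j)" "(\<Sum>j<n. X' j * u j) = (\<Sum>j<n. X j * u j)"
    "(\<Sum>i<m + n. Y' i) = (\<Sum>i<m + n. Y i)" "\<And>i. (\<Sum>j<n. E i j * X' j) = (\<Sum>j<n. E i j * X j)"
    using assms(2,3) by (auto intro!: sum.cong)
  then show ?thesis using assms(1,3) by (simp add: mw_inv_def)
qed

lemma sum_bump: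
  fixes f :: "nat \<Rightarrow> nat"
  assumes "b < n"
  shows "(\<Sum>j<n. f j * (X(b := Suc (X b))) j) = (\<Sum>j<n. f j * X j) + f b"
proof -
  have "(\<Sum>j<n. f j * (X(b := Suc (X b))) j) = (\<Sum>j<n. f j * X j + (if j = b then f b else 0))"
    by (intro sum.cong) auto
  also have "\<dots> = (\<Sum>j<n. f j * X j) + f b" using assms by (simp add: sum.distrib)
  finally show ?thesis .
qed

text \<open>The chosen item has the least cost per weight. Averaging over a feasible T, which loads
  each row at most once in scaled terms, bounds its cost by the fraction u b / u(T) of the price
  total. Apart from the common factor 2P the total thus grows by at most 1 + u b / u(T) \<le> exp (u
  b / u(T)). This holds for all T at once, so no guess of the optimum is needed.\<close>

lemma mw_inv_step:
  assumes inv: "mw_inv t X Y" and b: "b < n"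
    and best: "\<And>j. j < n \<Longrightarrow> u j * (\<Sum>i<m + n. E i b * Y i) \<le> u b * (\<Sum>i<m + n. E i j * Y i)"
  shows "mw_inv (Suc t) (X(b := Suc (X b))) (\<lambda>i. Y i * (2 * P + E i b))"
proof -
  let ?X = "X(b := Suc (X b))" and ?Q = "real (2 * P)"
  have Q: "0 < ?Q" using P_pos by simp
  have s1: "(\<Sum>j<n. ?X j) = Suc t"
    using sum_bump[OF b, of "\<lambda>_. 1" X] inv by (simp add: mw_inv_def)
  have row: "0 < Y i * (2 * P + E i b) \<and> Y i * (2 * P + E i b) \<le> (4 * P) ^ Suc t \<and>
      ?Q ^ Suc t * 2 powr (real (\<Sum>j<n. E i j * ?X j) / ?Q) \<le> real (Y i * (2 * P + E i b))"
    if i: "i < m + n" for i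
  proof (intro conjI)
    have Y: "0 < Y i" "Y i \<le> (4 * P) ^ t"
      "?Q ^ t * 2 powr (real (\<Sum>j<n. E i j * X j) / ?Q) \<le> real (Y i)"
      using inv i by (auto simp: mw_inv_def)
    show "0 < Y i * (2 * P + E i b)" using Y P_pos by simp
    have "Y i * (2 * P + E i b) \<le> (4 * P) ^ t * (4 * P)"
      using Y(2) E_le[of i b] by (intro mult_mono) auto
    then show "Y i * (2 * P + E i b) \<le> (4 * P) ^ Suc t" by (simp add: mult_ac)
    have "2 powr (real (E i b) / ?Q) \<le> 1 + real (E i b) / ?Q"
      using E_le[of i b] P_pos by (intro two_powr_le) (auto simp: divide_simps of_nat_mono simp flip: of_nat_mult)
    then have "?Q * 2 powr (real (E i b) / ?Q) \<le> ?Q + real (E i b)"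
      using Q by (simp add: field_simps)
    then have "(?Q ^ t * 2 powr (real (\<Sum>j<n. E i j * X j) / ?Q)) * (?Q * 2 powr (real (E i b) / ?Q))
        \<le> real (Y i) * (?Q + real (E i b))"
      using Y(3) by (intro mult_mono) auto
    then show "?Q ^ Suc t * 2 powr (real (\<Sum>j<n. E i j * ?X j) / ?Q) \<le> real (Y i * (2 * P + E i b))"
      unfolding sum_bump[OF b] by (simp add: add_divide_distrib powr_add mult_ac)
  qed
  have pot: "real (\<Sum>i<m + n. Y i * (2 * P + E i b)) \<le>
      real (m + n) * ?Q ^ Suc t * exp (real (\<Sum>j<n. ?X j * u j) / real (sum u T))"
    if T: "fits T" "0 < sum u T" for T
  proof -
    let ?F = "real (\<Sum>i<m + n. Y i)" and ?C = "\<lambda>j. \<Sum>i<m + n. E i j * Y i"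
    have "sum u T * ?C b = (\<Sum>j\<in>T. u j * ?C b)" by (simp add: sum_distrib_right)
    also have "\<dots> \<le> (\<Sum>j\<in>T. u b * ?C j)"
      using T(1) by (intro sum_mono best) (auto simp: fits_def)
    also have "\<dots> = u b * (\<Sum>j\<in>T. ?C j)" by (simp add: sum_distrib_left)
    also have "(\<Sum>j\<in>T. ?C j) = (\<Sum>i<m + n. Y i * (\<Sum>j\<in>T. E i j))"
      by (subst sum.swap) (simp add: sum_distrib_left mult.commute)
    also have "u b * \<dots> \<le> u b * (\<Sum>i<m + n. Y i * (2 * P))"
      using fits_sum_E_le[OF T(1)] by (intro mult_left_mono sum_mono) auto
    finally have "sum u T * ?C b \<le> u b * (2 * P * (\<Sum>i<m + n. Y i))"
      by (simp add: sum_distrib_left mult_ac)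
    then have "real (sum u T * ?C b) \<le> real (u b * (2 * P * (\<Sum>i<m + n. Y i)))"
      by (rule of_nat_mono)
    then have "real (sum u T) * real (?C b) \<le> real (u b) * (?Q * ?F)"
      by (simp only: of_nat_mult)
    then have C: "real (?C b) \<le> ?Q * ?F * (real (u b) / real (sum u T))"
      using T(2) by (simp add: pos_le_divide_eq mult_ac del: of_nat_sum)
    have "real (\<Sum>i<m + n. Y i * (2 * P + E i b)) = ?Q * ?F + real (?C b)"
      by (simp add: sum.distrib sum_distrib_left algebra_simps)
    also have "\<dots> \<le> ?Q * ?F * (1 + real (u b) / real (sum u T))"
      using C by (simp add: algebra_simps)
    also have "\<dots> \<le> ?Q * ?F * exp (real (u b) / real (sum u T))"
      by (intro mult_left_mono exp_ge_add_one_self mult_nonneg_nonneg) (simp_all only: of_nat_0_le_iff)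
    also have "\<dots> \<le> ?Q * (real (m + n) * ?Q ^ t * exp (real (\<Sum>j<n. X j * u j) / real (sum u T)))
        * exp (real (u b) / real (sum u T))"
      using inv T by (intro mult_right_mono mult_left_mono) (auto simp: mw_inv_def)
    also have "\<dots> = real (m + n) * ?Q ^ Suc t *
        exp ((real (\<Sum>j<n. X j * u j) + real (u b)) / real (sum u T))"
      by (simp add: exp_add add_divide_distrib mult_ac)
    also have "real (\<Sum>j<n. X j * u j) + real (u b) = real (\<Sum>j<n. ?X j * u j)"
      using sum_bump[OF b, of u X] by (simp add: mult.commute)
    finally show ?thesis .
  qed
  show ?thesis unfolding mw_inv_def using s1 row pot by blast
qed

text \<open>N is the maximal load, and X / N is the fractional point. The item rows give X j \<le>
  N; as the entries of X sum to 32 n (m + n), averaging gives N \<ge> 32 (m + n), which makes the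
  additive term ln (m + n) a small fraction of N.\<close>

lemma mw_inv_final:
  assumes inv: "mw_inv (32 * n * (m + n)) X Y" and n: "0 < n"
  obtains N :: real where "0 < N" "\<And>j. j < n \<Longrightarrow> real (X j) \<le> N"
    "\<And>i. i < m \<Longrightarrow> real (\<Sum>j<n. phi i j * X j) \<le> 2 * real P * N"
    "\<And>T. fits T \<Longrightarrow> 5 / 8 * N * real (sum u T) \<le> real (\<Sum>j<n. X j * u j)"
proof -
  let ?Q = "real (2 * P)" and ?t = "32 * n * (m + n)"
  have Q: "0 < ?Q" using P_pos by simp
  define load where "load i = real (\<Sum>j<n. E i j * X j) / ?Q" for i
  define N where "N = Max (load ` {..<m + n})"
  have ne: "load ` {..<m + n} \<noteq> {}" using n by auto
  have N_ge: "load i \<le> N" if "i < m + n" for i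
    unfolding N_def using that by (intro Max_ge) auto
  obtain i0 where i0: "i0 < m + n" "load i0 = N"
    using Max_in[OF _ ne] unfolding N_def by auto
  have load_item: "load (m + j) = real (X j)" if "j < n" for j
  proof -
    have "(\<Sum>j'<n. E (m + j) j' * X j') = (\<Sum>j'<n. if j' = j then 2 * P * X j else 0)"
      by (intro sum.cong) (auto simp: E_def)
    then show ?thesis using that Q by (simp add: load_def)
  qed
  have X_le: "real (X j) \<le> N" if "j < n" for j
    using N_ge[of "m + j"] load_item[OF that] that by simp
  have "real ?t = (\<Sum>j<n. real (X j))" using inv by (auto simp: mw_inv_def simp flip: of_nat_sum)
  also have "\<dots> \<le> (\<Sum>j<n. N)" using X_le by (intro sum_mono) auto
  finally have "real n * (32 * real (m + n)) \<le> real n * N" by (simp add: mult_ac)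
  then have N_large: "32 * real (m + n) \<le> N" using n by simp
  then have N_pos: "0 < N" using n by (intro less_le_trans[OF _ N_large]) simp
  have rows: "real (\<Sum>j<n. phi i j * X j) \<le> 2 * real P * N" if "i < m" for i
    using N_ge[of i] that Q by (simp add: load_def E_def field_simps)
  have main: "5 / 8 * N * real (sum u T) \<le> real (\<Sum>j<n. X j * u j)" if T: "fits T" for T
  proof (cases "0 < sum u T")
    case True
    let ?W = "real (\<Sum>j<n. X j * u j) / real (sum u T)"
    have "?Q ^ ?t * 2 powr N \<le> real (Y i0)"
      using inv i0 unfolding mw_inv_def load_def by metis
    also have "\<dots> \<le> real (\<Sum>i<m + n. Y i)"
      unfolding of_nat_le_iff using i0(1) by (intro member_le_sum) auto
    also have "\<dots> \<le> real (m + n) * ?Q ^ ?t * exp ?W"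
      using inv T True unfolding mw_inv_def by blast
    finally have "?Q ^ ?t * 2 powr N \<le> ?Q ^ ?t * (real (m + n) * exp ?W)" by (simp add: mult_ac)
    then have "2 powr N \<le> real (m + n) * exp ?W"
      by (rule mult_left_le_imp_le) (use Q in simp)
    then have "ln (2 powr N) \<le> ln (real (m + n) * exp ?W)"
      using n by (subst ln_le_cancel_iff) auto
    then have 1: "N * ln 2 \<le> ln (real (m + n)) + ?W"
      using n by (simp add: ln_mult ln_powr)
    have 2: "ln (real (m + n)) \<le> real (m + n)"
      using n ln_le_minus_one[of "real (m + n)"] by simp
    have 3: "N * (2 / 3) \<le> N * ln 2"
      using ln2_ge_two_thirds N_pos by (intro mult_left_mono) auto
    \<comment> \<open>Here x is N, y the relative weight collected, a is ln (m + n) and b is m + n.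
      The constant comes from 2/3 - 1/32 = 61/96 \<ge> 5/8.\<close>
    have "5 / 8 * x \<le> y"
      if "x * ln 2 \<le> a + y" "a \<le> b" "x * (2 / 3) \<le> x * ln 2" "32 * b \<le> x" "0 < x" for x y a b :: real
      using that by linarith
    from this[OF 1 2 3 N_large N_pos] have "5 / 8 * N \<le> ?W" .
    then show ?thesis using True by (simp add: pos_le_divide_eq del: of_nat_sum)
  qed (auto simp del: of_nat_sum)
  show ?thesis by (rule that[OF N_pos X_le rows main])
qed

text \<open>Charging the kernel to the larger of its two items makes its bound symmetric, which is what
  the double counting needs.\<close>

definition share :: "nat \<Rightarrow> nat \<Rightarrow> nat" where
  "share j l = (\<Sum>i<m. if 0 < phi i j then phi i l else 0)"

section \<open>Double counting of kernel degrees\<close>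

lemma ker_le_share: "ker j l \<le> share j l + share l j"
  unfolding ker_def share_def ker_term_def sum.distrib[symmetric]
  using phi_le by (intro sum_mono) (auto simp: not_less)

text \<open>A minimum is at most the X-weighted average. In the double sum the two orientations of
  \<open>share\<close> contribute equally, which gives a factor 2; for fixed j, the sum of
  \<open>share\<close> runs over at most k rows, each with load at most 2 P N.\<close>

lemma min_degree_le:
  fixes N :: real
  assumes A: "A \<subseteq> {..<n}" "b \<in> A"
    and sparse: "\<And>j. j < n \<Longrightarrow> card {i. i < m \<and> 0 < d i j} \<le> k"
    and rows: "\<And>i. i < m \<Longrightarrow> real (\<Sum>j<n. phi i j * X j) \<le> 2 * real P * N"
    and min: "\<And>j. j \<in> A \<Longrightarrow> (\<Sum>l\<in>A. X l * ker b l) \<le> (\<Sum>l\<in>A. X l * ker j l)"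
    and N: "0 \<le> N"
  shows "real (\<Sum>l\<in>A. X l * ker b l) \<le> 4 * real k * N * real P"
proof -
  have fin: "finite A" using A(1) finite_subset by auto
  have share_le: "real (\<Sum>l\<in>A. X l * share j l) \<le> 2 * real k * N * real P" if "j \<in> A" for j
  proof -
    let ?R = "{i. i < m \<and> 0 < phi i j}"
    have "?R = {i. i < m \<and> 0 < d i j}" using phi_pos_iff by auto
    then have card: "card ?R \<le> k" using sparse[of j] that A(1) by auto
    have "(\<Sum>l\<in>A. X l * share j l) = (\<Sum>l\<in>A. \<Sum>i\<in>?R. phi i l * X l)"
      unfolding share_def sum_distrib_left
      by (intro sum.cong refl sum.mono_neutral_cong_right) auto
    also have "\<dots> = (\<Sum>i\<in>?R. \<Sum>l\<in>A. phi i l * X l)" by (rule sum.swap)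
    also have "\<dots> \<le> (\<Sum>i\<in>?R. \<Sum>l<n. phi i l * X l)"
      using A(1) by (intro sum_mono sum_mono2) auto
    finally have "real (\<Sum>l\<in>A. X l * share j l) \<le> real (\<Sum>i\<in>?R. \<Sum>l<n. phi i l * X l)"
      by (rule of_nat_mono)
    also have "\<dots> = (\<Sum>i\<in>?R. real (\<Sum>l<n. phi i l * X l))" by (rule of_nat_sum)
    also have "\<dots> \<le> (\<Sum>i\<in>?R. 2 * real P * N)" using rows by (intro sum_mono) auto
    also have "\<dots> = real (card ?R) * (2 * real P * N)" by simp
    also have "\<dots> \<le> real k * (2 * real P * N)" using card N by (intro mult_right_mono) auto
    finally show ?thesis by (simp add: mult_ac)
  qed
  let ?d = "\<lambda>j. \<Sum>l\<in>A. X l * ker j l"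
  show ?thesis
  proof (cases "sum X A = 0")
    \<comment> \<open>There is no weighted average if all weights vanish, but then the degree is
      zero.\<close>
    case True
    then have "?d b = 0" using fin by auto
    then show ?thesis using N by (simp del: of_nat_sum)
  next
    case False
    have "sum X A * ?d b = (\<Sum>j\<in>A. X j * ?d b)" by (simp add: sum_distrib_right)
    also have "\<dots> \<le> (\<Sum>j\<in>A. X j * ?d j)" by (intro sum_mono[of A] mult_left_mono[OF min]) auto
    also have "\<dots> \<le> (\<Sum>j\<in>A. X j * (\<Sum>l\<in>A. X l * (share j l + share l j)))"
      using ker_le_share by (intro sum_mono mult_left_mono) auto
    also have "\<dots> = (\<Sum>j\<in>A. X j * (\<Sum>l\<in>A. X l * share j l)) + (\<Sum>j\<in>A. \<Sum>l\<in>A. X j * (X l * share l j))"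
      by (simp add: distrib_left sum.distrib sum_distrib_left)
    also have "(\<Sum>j\<in>A. \<Sum>l\<in>A. X j * (X l * share l j)) = (\<Sum>j\<in>A. X j * (\<Sum>l\<in>A. X l * share j l))"
      by (subst sum.swap) (simp add: sum_distrib_left mult_ac)
    finally have "sum X A * ?d b \<le> 2 * (\<Sum>j\<in>A. X j * (\<Sum>l\<in>A. X l * share j l))" by simp
    then have "real (sum X A * ?d b) \<le> real (2 * (\<Sum>j\<in>A. X j * (\<Sum>l\<in>A. X l * share j l)))"
      by (rule of_nat_mono)
    then have "real (sum X A) * real (?d b) \<le> 2 * (\<Sum>j\<in>A. real (X j) * real (\<Sum>l\<in>A. X l * share j l))"
      by (simp only: of_nat_mult of_nat_sum[of _ A] of_nat_numeral)
    also have "\<dots> \<le> 2 * (\<Sum>j\<in>A. real (X j) * (2 * real k * N * real P))"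
      using share_le by (intro mult_left_mono sum_mono) auto
    also have "\<dots> = real (sum X A) * (4 * real k * N * real P)"
      by (simp flip: sum_distrib_right)
    finally show ?thesis by (rule mult_left_le_imp_le) (use False in \<open>simp del: of_nat_sum\<close>)
  qed
qed

section \<open>Local ratio decomposition and greedy unwinding\<close>

definition residual :: "(nat \<Rightarrow> nat) \<Rightarrow> (nat \<Rightarrow> nat) \<Rightarrow> nat \<Rightarrow> nat \<Rightarrow> real" where
  "residual q U a l = real (u l) -
     (\<Sum>a'<a. real (U (q a')) / real P ^ a' * (real (ker (q a') l) / real P))"

text \<open>\<open>U l / P ^ a\<close> is the positive part of the residual, the truncation of the subtraction on
  natural numbers being harmless because a vanished residual stays zero.\<close>

definition residual_ok :: "(nat \<Rightarrow> nat) \<Rightarrow> (nat \<Rightarrow> nat) \<Rightarrow> nat \<Rightarrow> nat \<Rightarrow> bool" where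
  "residual_ok q U a l \<longleftrightarrow> residual q U a l \<le> real (U l) / real P ^ a \<and>
     (0 < U l \<longrightarrow> residual q U a l = real (U l) / real P ^ a) \<and> U l \<le> u l * P ^ a"

text \<open>The order q is built from the front. Placing an item freezes its \<open>U\<close> at
  scale P ^ a, whereas pending items are rescaled in every round; hence the two clauses on
  \<open>residual_ok\<close>. The last clause records that each item had minimal degree among those
  pending at its turn.\<close>

definition lr_inv :: "nat \<Rightarrow> (nat \<Rightarrow> nat) \<Rightarrow> (nat \<Rightarrow> nat) \<Rightarrow> (nat \<Rightarrow> nat) \<Rightarrow> bool" where
  "lr_inv p X q U \<longleftrightarrow> inj_on q {..<p} \<and> q ` {..<p} \<subseteq> {..<n} \<and>
     (\<forall>a<p. residual_ok q U a (q a)) \<and>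
     (\<forall>l<n. l \<notin> q ` {..<p} \<longrightarrow> residual_ok q U p l) \<and>
     (\<forall>a<p. \<forall>j\<in>{..<n} - q ` {..<a}.
        (\<Sum>l\<in>{..<n} - q ` {..<a}. X l * ker (q a) l) \<le> (\<Sum>l\<in>{..<n} - q ` {..<a}. X l * ker j l))"

lemma lr_inv_init: "(\<And>j. j < n \<Longrightarrow> U j = u j) \<Longrightarrow> lr_inv 0 X q U"
  by (auto simp: lr_inv_def residual_ok_def residual_def)

lemma residual_cong:
  "(\<And>a'. a' < a \<Longrightarrow> q' a' = q a' \<and> U' (q a') = U (q a')) \<Longrightarrow> residual q' U' a l = residual q U a l"
  by (auto simp: residual_def intro!: sum.cong)

lemma lr_inv_step:
  assumes inv: "lr_inv p X q U" and b: "b < n" "b \<notin> q ` {..<p}"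
    and min: "\<And>j. j \<in> {..<n} - q ` {..<p} \<Longrightarrow>
       (\<Sum>l\<in>{..<n} - q ` {..<p}. X l * ker b l) \<le> (\<Sum>l\<in>{..<n} - q ` {..<p}. X l * ker j l)"
    and q': "\<And>a. a < p \<Longrightarrow> q' a = q a" "q' p = b"
    and U': "\<And>l. l < n \<Longrightarrow> U' l = (if l \<in> q ` {..<p} \<or> l = b then U l else U l * P - U b * ker b l)"
  shows "lr_inv (Suc p) X q' U'"
proof -
  have img: "q' ` {..<a} = q ` {..<a}" if "a \<le> p" for a
    using q' that by (intro image_cong) auto
  have img': "q' ` {..<Suc p} = insert b (q ` {..<p})"
    using img[of p] q'(2) by (simp add: lessThan_Suc)
  have qn: "q a < n" if "a < p" for a using inv that by (auto simp: lr_inv_def)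
  \<comment> \<open>A residual at position a reads \<open>U\<close> only at the items placed before
    a, and these values are frozen.\<close>
  have old: "residual q' U' a l = residual q U a l" if "a \<le> p" for a l
    using that q' U' qn by (intro residual_cong) auto
  have "inj_on q {..<p}" using inv by (simp add: lr_inv_def)
  then have "inj_on q' {..<p}" using q' by (simp add: inj_on_def)
  then have inj: "inj_on q' {..<Suc p}" using img[of p] q' b by (simp add: lessThan_Suc)
  have placed: "residual_ok q' U' a (q' a)" if "a < Suc p" for a
  proof (cases "a = p")
    case True
    then show ?thesis using inv b q' U' old[of p]
      by (simp add: lr_inv_def residual_ok_def)
  next
    case False
    then have "a < p" using that by simp
    then show ?thesis using inv qn q' U' old[of a]
      by (auto simp: lr_inv_def residual_ok_def)
  qed
  have pending: "residual_ok q' U' (Suc p) l" if l: "l < n" "l \<notin> q' ` {..<Suc p}" for l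
  proof -
    have l': "l \<notin> q ` {..<p}" "l \<noteq> b" using l(2) unfolding img' by auto
    then have ok: "residual_ok q U p l" using inv l by (auto simp: lr_inv_def)
    have U: "U' l = U l * P - U b * ker b l" using U' l l' by auto
    have Ub: "U' b = U b" using U' b by simp
    have Pp: "0 < real P ^ p" "0 < real P" using P_pos by auto
    have res: "residual q' U' (Suc p) l = residual q U p l - real (U b) / real P ^ p * (real (ker b l) / real P)"
      using old[of p l] q'(2) Ub by (simp add: residual_def)
    have diff: "real (U l) / real P ^ p - real (U b) / real P ^ p * (real (ker b l) / real P)
        = (real (U l * P) - real (U b * ker b l)) / real P ^ Suc p"
      using Pp by (simp add: field_simps)
    show ?thesis unfolding residual_ok_def
    proof (intro conjI impI)
      have "residual q' U' (Suc p) l \<le> (real (U l * P) - real (U b * ker b l)) / real P ^ Suc p"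
        using ok unfolding res diff[symmetric] by (simp add: residual_ok_def)
      \<comment> \<open>Truncation can only raise the value, so the inequality survives.\<close>
      also have "\<dots> \<le> real (U' l) / real P ^ Suc p"
        unfolding U by (intro divide_right_mono) (rule of_nat_diff_ge, simp)
      finally show "residual q' U' (Suc p) l \<le> real (U' l) / real P ^ Suc p" .
      assume pos: "0 < U' l"
      \<comment> \<open>From U l = 0 the truncated difference would be 0 again. A positive new value
        therefore certifies that the old one was exact, and that this subtraction was not
        truncated.\<close>
      then have "0 < U l" unfolding U by (cases "U l = 0") auto
      then have "residual q' U' (Suc p) l = (real (U l * P) - real (U b * ker b l)) / real P ^ Suc p"
        using ok unfolding res diff[symmetric] by (simp add: residual_ok_def)
      also have "real (U l * P) - real (U b * ker b l) = real (U' l)"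
        using pos unfolding U by (subst of_nat_diff) auto
      finally show "residual q' U' (Suc p) l = real (U' l) / real P ^ Suc p" .
    next
      have "U' l \<le> U l * P" unfolding U by simp
      also have "\<dots> \<le> u l * P ^ p * P" using ok by (simp add: residual_ok_def)
      finally show "U' l \<le> u l * P ^ Suc p" by (simp add: mult_ac)
    qed
  qed
  have deg: "\<forall>j\<in>{..<n} - q' ` {..<a}.
        (\<Sum>l\<in>{..<n} - q' ` {..<a}. X l * ker (q' a) l) \<le> (\<Sum>l\<in>{..<n} - q' ` {..<a}. X l * ker j l)"
    if a: "a < Suc p" for a
  proof (cases "a = p")
    case True
    show ?thesis unfolding True using min unfolding img[OF order.refl] q'(2) by blast
  next
    case False
    then have "a < p" using a by simp
    then show ?thesis using inv img[of a] q'(1)[of a] by (auto simp: lr_inv_def)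
  qed
  show ?thesis unfolding lr_inv_def using inj img' inv b placed pending deg
    by (auto simp: lr_inv_def)
qed

text \<open>Positions are visited from n - 1 downwards. The blocking row is recorded with the part
  of F at positions beyond a, that is, with the load at the time of the visit: the kernel sums of
  the analysis run over exactly these positions.\<close>

definition greedy_inv :: "nat \<Rightarrow> (nat \<Rightarrow> nat) \<Rightarrow> (nat \<Rightarrow> nat) \<Rightarrow> nat set \<Rightarrow> bool" where
  "greedy_inv p q U F \<longleftrightarrow> fits F \<and> F \<subseteq> q ` {n - p..<n} \<and> (\<forall>j\<in>F. 0 < U j) \<and>
     (\<forall>a\<in>{n - p..<n}. 0 < U (q a) \<longrightarrow> q a \<in> F \<or>
        (\<exists>i<m. c i < d i (q a) + (\<Sum>l\<in>F \<inter> q ` {a<..<n}. d i l)))"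

lemma greedy_inv_init: "greedy_inv 0 q U {}"
  by (auto simp: greedy_inv_def fits_def)

lemma greedy_inv_step:
  assumes inv: "greedy_inv p q U F" and q: "inj_on q {..<n}" "q ` {..<n} \<subseteq> {..<n}" and p: "p < n"
    and j: "j = q (n - Suc p)"
    and add: "F' = (if 0 < U j \<and> (\<forall>i<m. d i j + (\<Sum>l\<in>F. d i l) \<le> c i) then insert j F else F)"
  shows "greedy_inv (Suc p) q U F'"
proof -
  let ?a = "n - Suc p"
  have rng: "{n - Suc p..<n} = insert ?a {n - p..<n}" using p by auto
  have jF: "j \<notin> q ` {n - p..<n}"
    using q(1) p unfolding j by (subst inj_on_image_mem_iff[OF q(1)]) auto
  then have jF': "j \<notin> F" using inv by (auto simp: greedy_inv_def)
  have fin: "finite F" using inv by (auto simp: greedy_inv_def fits_def intro: finite_subset)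
  have "?a \<in> {..<n}" using p by auto
  then have jn: "j < n" using q(2) unfolding j by blast
  \<comment> \<open>The new item has the lowest position so far, so no recorded load
    changes.\<close>
  have later: "F' \<inter> q ` {a<..<n} = F \<inter> q ` {a<..<n}" if "a \<in> {?a..<n}" for a
  proof -
    have "{a<..<n} \<subseteq> {n - p..<n}" using that p by auto
    then have "j \<notin> q ` {a<..<n}" using jF by blast
    then show ?thesis unfolding add by auto
  qed
  have F1: "F \<inter> q ` {?a<..<n} = F"
  proof -
    have "{?a<..<n} = {n - p..<n}" using p by auto
    then show ?thesis using inv by (auto simp: greedy_inv_def)
  qed
  have "q a \<in> F' \<or> (\<exists>i<m. c i < d i (q a) + (\<Sum>l\<in>F' \<inter> q ` {a<..<n}. d i l))"
    if a: "a \<in> {?a..<n}" "0 < U (q a)" for a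
  proof (cases "a = ?a")
    case True
    show ?thesis using a(2) unfolding later[OF a(1)] unfolding True F1 j[symmetric] add by (auto simp: not_le)
  next
    case False
    then have "a \<in> {n - p..<n}" using a by auto
    then have "q a \<in> F \<or> (\<exists>i<m. c i < d i (q a) + (\<Sum>l\<in>F \<inter> q ` {a<..<n}. d i l))"
      using inv a by (auto simp: greedy_inv_def)
    then show ?thesis unfolding later[OF a(1)] unfolding add by auto
  qed
  moreover have "fits F'" using inv fin jn jF' unfolding add by (auto simp: greedy_inv_def fits_def)
  moreover have "F' \<subseteq> q ` {?a..<n}" "\<forall>j\<in>F'. 0 < U j"
    using inv unfolding rng add by (auto simp: greedy_inv_def j)
  ultimately show ?thesis by (auto simp: greedy_inv_def)
qed

text \<open>A positive \<open>u j\<close> means that j fits alone. If j is large, some member of G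
  must use the row, and it contributes P. If j is small, G fills more than half of the row: either
  some member of G is large and contributes P, or all fractions are exactly doubled and sum to at
  least P.\<close>

lemma blocked_kernel_ge:
  assumes F: "fits F" "G \<subseteq> F" and j: "0 < u j" and i: "i < m" "c i < d i j + (\<Sum>l\<in>G. d i l)"
  shows "P \<le> (\<Sum>l\<in>G. ker j l)"
proof -
  have finF: "finite F" using F by (auto simp: fits_def intro: finite_subset)
  then have fin: "finite G" using F(2) finite_subset by auto
  have "(\<Sum>l\<in>G. d i l) \<le> (\<Sum>l\<in>F. d i l)" using F(2) finF by (intro sum_mono2) auto
  also have "\<dots> \<le> c i" using F(1) i by (auto simp: fits_def)
  finally have Gc: "(\<Sum>l\<in>G. d i l) \<le> c i" .
  then have dj: "0 < d i j" using i by auto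
  have djc: "d i j \<le> c i" using j i(1) by (cases "c i < d i j") (auto simp: u_def split: if_splits)
  have ker_ge: "ker_term i j l \<le> ker j l" for l
    unfolding ker_def using i(1) by (intro member_le_sum[of i "{..<m}" "\<lambda>i. ker_term i j l"]) auto
  have phij: "0 < phi i j" using dj phi_pos_iff i by auto
  have one: ?thesis if "l \<in> G" "P \<le> ker_term i j l" for l
  proof -
    have "P \<le> ker j l" using that ker_ge[of l] by simp
    also have "\<dots> \<le> (\<Sum>l\<in>G. ker j l)" using that fin by (intro member_le_sum) auto
    finally show ?thesis .
  qed
  show ?thesis
  proof (cases "phi i j < P")
    case False
    have "\<exists>l\<in>G. 0 < d i l"
    proof (rule ccontr)
      assume "\<not> ?thesis"
      then have "(\<Sum>l\<in>G. d i l) = 0" by auto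
      then show False using i djc by simp
    qed
    then obtain l where l: "l \<in> G" "0 < d i l" by blast
    then show ?thesis using one[of l] False phij phi_pos_iff[OF i(1), of l] by (auto simp: ker_term_def)
  next
    case True
    then have small: "2 * d i j < c i" using phi_eq_P[OF i(1) _ dj] by (auto simp: not_less[symmetric])
    have kt: "ker_term i j l = phi i l" for l using True phij by (simp add: ker_term_def)
    show ?thesis
    proof (cases "\<exists>l\<in>G. c i < 2 * d i l")
      case True
      then obtain l where "l \<in> G" "c i < 2 * d i l" by blast
      then show ?thesis using one[of l] by (auto simp: kt phi_def)
    next
      case False
      then have "c i * (\<Sum>l\<in>G. phi i l) = (\<Sum>l\<in>G. 2 * d i l * P)"
        unfolding sum_distrib_left using phi_mult_c[OF i(1)] by (intro sum.cong) (auto simp: not_less)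
      also have "\<dots> = 2 * (\<Sum>l\<in>G. d i l) * P" by (simp add: sum_distrib_left sum_distrib_right)
      also have "\<dots> \<ge> c i * P" using i(2) small by (intro mult_right_mono) auto
      finally have "P \<le> (\<Sum>l\<in>G. phi i l)" using small by simp
      also have "\<dots> \<le> (\<Sum>l\<in>G. ker j l)" using ker_ge by (intro sum_mono) (auto simp: kt)
      finally show ?thesis .
    qed
  qed
qed

lemma permutation_sum:
  fixes f :: "nat \<Rightarrow> 'a::comm_monoid_add"
  assumes "inj_on q {..<n}" "q ` {..<n} = {..<n}" "F \<subseteq> {..<n}"
  shows "(\<Sum>l\<in>F. f l) = (\<Sum>a<n. if q a \<in> F then f (q a) else 0)"
proof -
  have "(\<Sum>l\<in>F. f l) = (\<Sum>l<n. if l \<in> F then f l else 0)"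
    using assms(3) by (subst sum.inter_restrict[symmetric]) (auto simp: Int_absorb1)
  also have "\<dots> = (\<Sum>l\<in>q ` {..<n}. if l \<in> F then f l else 0)" by (simp add: assms(2))
  also have "\<dots> = (\<Sum>a<n. if q a \<in> F then f (q a) else 0)"
    using assms(1) by (subst sum.reindex) auto
  finally show ?thesis .
qed

text \<open>Both weights are compared with the sum of the residuals \<delta>. Minimal degrees bound
  the fractional weight by (4k + 1) N times this sum, and blocking shows that F collects at least
  the sum itself. N cancels against the value of the fractional point.\<close>

lemma local_ratio_bound:
  assumes mw: "mw_inv (32 * n * (m + n)) X Y" and lr: "lr_inv n X q U" and gr: "greedy_inv n q U F"
    and sparse: "\<And>j. j < n \<Longrightarrow> card {i. i < m \<and> 0 < d i j} \<le> k" and k: "1 \<le> k" and T: "fits T"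
  shows "real (sum w T) \<le> 8 * real k * real (sum w F)"
proof (cases "n = 0")
  case True
  have "T \<subseteq> {..<n}" using T by (simp add: fits_def)
  then have "T = {}" using True by simp
  then show ?thesis by (simp add: sum_nonneg)
next
  case False
  from mw_inv_final[OF mw] False obtain N :: real where N: "0 < N" "\<And>j. j < n \<Longrightarrow> real (X j) \<le> N"
    "\<And>i. i < m \<Longrightarrow> real (\<Sum>j<n. phi i j * X j) \<le> 2 * real P * N"
    "\<And>T. fits T \<Longrightarrow> 5 / 8 * N * real (sum u T) \<le> real (\<Sum>j<n. X j * u j)" by blast
  have inj: "inj_on q {..<n}" and qsub: "q ` {..<n} \<subseteq> {..<n}" using lr by (auto simp: lr_inv_def)
  have surj: "q ` {..<n} = {..<n}" using inj qsub by (simp add: endo_inj_surj)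
  have Pp: "0 < real P" using P_pos by simp
  define \<delta> where "\<delta> a = real (U (q a)) / real P ^ a" for a
  define \<kappa> where "\<kappa> a b = real (ker (q a) (q b)) / real P" for a b
  have \<delta>: "0 \<le> \<delta> a" for a by (simp add: \<delta>_def)
  have \<kappa>: "0 \<le> \<kappa> a b" for a b by (simp add: \<kappa>_def)
  have ok: "residual_ok q U a (q a)" if "a < n" for a using lr that by (auto simp: lr_inv_def)
  have res: "residual q U a (q a) = real (u (q a)) - (\<Sum>a'<a. \<delta> a' * \<kappa> a' a)" for a
    by (simp add: residual_def \<delta>_def \<kappa>_def)
  \<comment> \<open>Because of truncation the decomposition is an upper bound in general and an
    equality where \<open>U\<close> stays positive. The bound suffices for the fractional point;
    equality is needed for F, whose members all have positive \<open>U\<close>.\<close>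
  have upper: "real (u (q a)) \<le> \<delta> a + (\<Sum>a'<a. \<delta> a' * \<kappa> a' a)" if "a < n" for a
    using ok[OF that] unfolding residual_ok_def res by (simp add: \<delta>_def)
  have exact: "real (u (q a)) = \<delta> a + (\<Sum>a'<a. \<delta> a' * \<kappa> a' a)" if "a < n" "0 < U (q a)" for a
    using ok[OF that(1)] that(2) unfolding residual_ok_def res by (simp add: \<delta>_def)
  \<comment> \<open>Regroups by the position that subtracts instead of the one subtracted from. It
    is used with z = X for the fractional point and with the indicator of F for the
    solution.\<close>
  have swap: "(\<Sum>a<n. z a * (\<delta> a + (\<Sum>a'<a. \<delta> a' * \<kappa> a' a)))
      = (\<Sum>a<n. \<delta> a * (z a + (\<Sum>b\<in>{a<..<n}. z b * \<kappa> a b)))" for z :: "nat \<Rightarrow> real"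
  proof -
    have "(\<Sum>a<n. \<Sum>a'<a. z a * (\<delta> a' * \<kappa> a' a)) = (\<Sum>a'<n. \<Sum>a\<in>{a'<..<n}. z a * (\<delta> a' * \<kappa> a' a))"
      by (subst sum.Sigma, simp, simp, subst sum.Sigma, simp, simp,
        rule sum.reindex_bij_witness[of _ "\<lambda>(a, b). (b, a)" "\<lambda>(a, b). (b, a)"]) auto
    then show ?thesis
      by (simp add: distrib_left sum.distrib sum_distrib_left mult_ac)
  qed

  have "real (\<Sum>j<n. X j * u j) = (\<Sum>a<n. real (X (q a)) * real (u (q a)))"
    using permutation_sum[OF inj surj order.refl, of "\<lambda>j. real (X j * u j)"] qsub
    by (auto intro!: sum.cong)
  also have "\<dots> \<le> (\<Sum>a<n. real (X (q a)) * (\<delta> a + (\<Sum>a'<a. \<delta> a' * \<kappa> a' a)))"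
    using upper by (intro sum_mono mult_left_mono) auto
  also have "\<dots> = (\<Sum>a<n. \<delta> a * (real (X (q a)) + (\<Sum>b\<in>{a<..<n}. real (X (q b)) * \<kappa> a b)))"
    by (rule swap)
  also have "\<dots> \<le> (\<Sum>a<n. \<delta> a * ((4 * real k + 1) * N))"
  proof (intro sum_mono mult_left_mono \<delta>)
    fix a assume "a \<in> {..<n}"
    then have a: "a < n" by simp
    let ?A = "{..<n} - q ` {..<a}"
    have A: "?A = q ` {a..<n}"
    proof -
      have "{..<n} - q ` {..<a} = q ` ({..<n} - {..<a})"
        using inj a surj by (subst inj_on_image_set_diff[OF inj]) auto
      then show ?thesis by (simp add: lessThan_minus_lessThan)
    qed
    have inja: "inj_on q {a..<n}" using inj by (rule inj_on_subset) auto
    have "real (\<Sum>l\<in>?A. X l * ker (q a) l) \<le> 4 * real k * N * real P"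
    proof (rule min_degree_le[OF _ _ sparse N(3)])
      show "q a \<in> ?A" unfolding A using a by simp
      show "(\<Sum>l\<in>?A. X l * ker (q a) l) \<le> (\<Sum>l\<in>?A. X l * ker j l)" if "j \<in> ?A" for j
        using lr a that unfolding lr_inv_def by blast
    qed (use N in auto)
    moreover have "(\<Sum>b\<in>{a<..<n}. X (q b) * ker (q a) (q b)) \<le> (\<Sum>l\<in>?A. X l * ker (q a) l)"
      unfolding A sum.reindex[OF inja] by (auto intro!: sum_mono2)
    ultimately have "real (\<Sum>b\<in>{a<..<n}. X (q b) * ker (q a) (q b)) \<le> 4 * real k * N * real P"
      by (meson of_nat_le_iff order_trans)
    then have "(\<Sum>b\<in>{a<..<n}. real (X (q b)) * \<kappa> a b) \<le> 4 * real k * N"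
      using Pp by (simp add: \<kappa>_def sum_divide_distrib[symmetric] field_simps)
    \<comment> \<open>The item's own coordinate is the 1 in 4k + 1.\<close>
    moreover have "real (X (q a)) \<le> N" using N(2) qsub a by auto
    ultimately show "real (X (q a)) + (\<Sum>b\<in>{a<..<n}. real (X (q b)) * \<kappa> a b) \<le> (4 * real k + 1) * N"
      by (simp add: algebra_simps)
  qed
  also have "\<dots> = (4 * real k + 1) * N * (\<Sum>a<n. \<delta> a)"
    by (subst mult.commute) (simp add: sum_distrib_right)
  finally have W: "real (\<Sum>j<n. X j * u j) \<le> (4 * real k + 1) * N * (\<Sum>a<n. \<delta> a)" .

  have F: "fits F" "\<And>j. j \<in> F \<Longrightarrow> 0 < U j" using gr by (auto simp: greedy_inv_def)
  have Fn: "F \<subseteq> {..<n}" using F by (auto simp: fits_def)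
  let ?z = "\<lambda>a. of_bool (q a \<in> F) :: real"
  have "(\<Sum>a<n. \<delta> a) \<le> (\<Sum>a<n. \<delta> a * (?z a + (\<Sum>b\<in>{a<..<n}. ?z b * \<kappa> a b)))"
  proof (intro sum_mono)
    fix a assume "a \<in> {..<n}"
    then have a: "a < n" by simp
    have nn: "0 \<le> (\<Sum>b\<in>{a<..<n}. ?z b * \<kappa> a b)" using \<kappa> by (intro sum_nonneg) auto
    have "1 \<le> ?z a + (\<Sum>b\<in>{a<..<n}. ?z b * \<kappa> a b)" if pos: "0 < U (q a)" "q a \<notin> F"
    proof -
      let ?G = "F \<inter> q ` {a<..<n}"
      obtain i where i: "i < m" "c i < d i (q a) + (\<Sum>l\<in>?G. d i l)"
        using gr a pos unfolding greedy_inv_def by (metis atLeastLessThan_iff diff_self_eq_0 le0)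
      \<comment> \<open>Positive residual weight implies positive \<open>u\<close>, so the item fits
        alone, as the kernel bound requires.\<close>
      have "U (q a) \<le> u (q a) * P ^ a" using ok[OF a] by (simp add: residual_ok_def)
      then have "0 < u (q a)" using pos by (cases "u (q a) = 0") auto
      then have "P \<le> (\<Sum>l\<in>?G. ker (q a) l)" using blocked_kernel_ge[OF F(1) _ _ i] by auto
      also have "?G = q ` {b\<in>{a<..<n}. q b \<in> F}" by auto
      also have "(\<Sum>l\<in>q ` {b\<in>{a<..<n}. q b \<in> F}. ker (q a) l)
          = (\<Sum>b\<in>{b\<in>{a<..<n}. q b \<in> F}. ker (q a) (q b))"
        using inj by (subst sum.reindex) (auto intro: inj_on_subset)
      also have "\<dots> = (\<Sum>b\<in>{a<..<n}. if q b \<in> F then ker (q a) (q b) else 0)"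
        by (subst sum.inter_filter) auto
      finally have "real P \<le> real (\<Sum>b\<in>{a<..<n}. if q b \<in> F then ker (q a) (q b) else 0)"
        by (rule of_nat_mono)
      also have "\<dots> = (\<Sum>b\<in>{a<..<n}. real (if q b \<in> F then ker (q a) (q b) else 0))"
        by (rule of_nat_sum)
      also have "\<dots> = (\<Sum>b\<in>{a<..<n}. ?z b * \<kappa> a b) * real P"
        unfolding sum_distrib_right using Pp by (intro sum.cong) (auto simp: \<kappa>_def)
      finally show ?thesis using Pp by simp
    qed
    then have "1 \<le> ?z a + (\<Sum>b\<in>{a<..<n}. ?z b * \<kappa> a b) \<or> \<delta> a = 0"
      using nn by (cases "q a \<in> F") (auto simp: \<delta>_def)
    then show "\<delta> a \<le> \<delta> a * (?z a + (\<Sum>b\<in>{a<..<n}. ?z b * \<kappa> a b))"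
      using mult_left_mono[OF _ \<delta>[of a], of 1] by auto
  qed
  also have "\<dots> = (\<Sum>a<n. ?z a * (\<delta> a + (\<Sum>a'<a. \<delta> a' * \<kappa> a' a)))" by (rule swap[symmetric])
  also have "\<dots> = (\<Sum>a<n. if q a \<in> F then real (u (q a)) else 0)"
    using exact F(2) by (intro sum.cong) auto
  also have "\<dots> = real (sum u F)"
    using permutation_sum[OF inj surj Fn, of "\<lambda>j. real (u j)"] by simp
  finally have S: "(\<Sum>a<n. \<delta> a) \<le> real (sum u F)" .

  have wu: "sum u A = sum w A" if "fits A" for A using fits_u_eq[OF that] by (intro sum.cong) auto
  have "5 / 8 * N * real (sum u T) \<le> (4 * real k + 1) * N * (\<Sum>a<n. \<delta> a)"
    by (rule order_trans[OF N(4)[OF T] W])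
  also have "\<dots> \<le> (4 * real k + 1) * N * real (sum u F)"
    using N(1) S by (intro mult_left_mono) auto
  finally have "5 / 8 * N * real (sum u T) \<le> (4 * real k + 1) * N * real (sum u F)" .
  then have "N * (5 / 8 * real (sum u T)) \<le> N * ((4 * real k + 1) * real (sum u F))"
    by (simp only: mult_ac)
  then have "5 / 8 * real (sum u T) \<le> (4 * real k + 1) * real (sum u F)"
    using N(1) by (simp only: mult_le_cancel_left_pos)
  \<comment> \<open>Here k \<ge> 1 enters; the factor 5k times 8/5 is 8k.\<close>
  also have "\<dots> \<le> (5 * real k) * real (sum u F)" using k by (intro mult_right_mono) (auto simp del: of_nat_sum)
  finally show ?thesis unfolding wu[OF T] wu[OF F(1)] by linarith
qed

end

section \<open>The program\<close>

lemma wp_Seq_frame: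
  assumes "wp B K c s Q'"
    and "\<And>s'. (\<And>x. x \<notin> writes c \<Longrightarrow> s' x = s x) \<Longrightarrow> Q' s' \<Longrightarrow> wp B K d s' Q"
  shows "wp B K (Seq c d) s Q"
  by (rule wp_Seq, rule wp_frame, rule wp_mono, rule assms(1)) (use assms(2) in blast)

text \<open>Matrices are stored row by row in one array; writing one entry must leave all others
  alone.\<close>

lemma matrix_index_eq_iff:
  fixes n :: nat
  assumes "j < n" "j' < n"
  shows "i * n + j = i' * n + j' \<longleftrightarrow> i = i' \<and> j = j'"
proof
  assume *: "i * n + j = i' * n + j'"
  have "(i * n + j) div n = i" "(i' * n + j') div n = i'" using assms by auto
  with * show "i = i' \<and> j = j'" by simp
qed simp

abbreviation Set :: "string \<Rightarrow> aexp \<Rightarrow> com" where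
  "Set x e \<equiv> Assign x (Const 0) e"

abbreviation At :: "aexp \<Rightarrow> aexp \<Rightarrow> aexp" where
  "At i j \<equiv> Add (Mul i (Var ''n'')) j"

abbreviation Cap :: "aexp \<Rightarrow> aexp" where
  "Cap i \<equiv> Cell ''A'' (Add (Var ''n'') i)"

abbreviation Dem :: "aexp \<Rightarrow> aexp \<Rightarrow> aexp" where
  "Dem i j \<equiv> Cell ''A'' (Add (Add (Var ''n'') (Var ''m'')) (At i j))"

definition compute_P :: com where
  "compute_P = Seq (Set ''P'' (Const 1))
     (For ''i'' ''m'' (Cond (Less (Const 0) (Cap (Var ''i'')))
        (Set ''P'' (Mul (Var ''P'') (Cap (Var ''i'')))) Skip))"

definition compute_U :: com where
  "compute_U = For ''j'' ''n'' (Seq (Assign ''U'' (Var ''j'') (Cell ''A'' (Var ''j'')))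
     (For ''i'' ''m'' (Cond (Less (Cap (Var ''i'')) (Dem (Var ''i'') (Var ''j'')))
        (Assign ''U'' (Var ''j'') (Const 0)) Skip)))"

definition compute_phi :: com where
  "compute_phi = For ''i'' ''m'' (For ''j'' ''n''
     (Cond (Less (Cap (Var ''i'')) (Mul (Const 2) (Dem (Var ''i'') (Var ''j''))))
        (Assign ''E'' (At (Var ''i'') (Var ''j'')) (Var ''P''))
        (Assign ''E'' (At (Var ''i'') (Var ''j''))
           (Div (Mul (Mul (Const 2) (Dem (Var ''i'') (Var ''j''))) (Var ''P'')) (Cap (Var ''i''))))))"

definition compute_item_rows :: com where
  "compute_item_rows = For ''j'' ''n''
     (Assign ''E'' (At (Add (Var ''m'') (Var ''j'')) (Var ''j'')) (Mul (Const 2) (Var ''P'')))"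

definition compute_ker :: com where
  "compute_ker = For ''j'' ''n'' (For ''l'' ''n'' (For ''i'' ''m''
     (Cond (Less (Const 0) (Cell ''E'' (At (Var ''i'') (Var ''j''))))
        (Cond (Less (Cell ''E'' (At (Var ''i'') (Var ''j''))) (Var ''P''))
           (Assign ''K'' (At (Var ''j'') (Var ''l''))
              (Add (Cell ''K'' (At (Var ''j'') (Var ''l''))) (Cell ''E'' (At (Var ''i'') (Var ''l'')))))
           (Cond (Less (Const 0) (Cell ''E'' (At (Var ''i'') (Var ''l''))))
              (Assign ''K'' (At (Var ''j'') (Var ''l''))
                 (Add (Cell ''K'' (At (Var ''j'') (Var ''l''))) (Var ''P'')))
              Skip))
        Skip)))"

definition mw_costs :: com where
  "mw_costs = For ''j'' ''n'' (Seq (Assign ''C'' (Var ''j'') (Const 0))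
     (For ''i'' ''M'' (Assign ''C'' (Var ''j'') (Add (Cell ''C'' (Var ''j''))
        (Mul (Cell ''E'' (At (Var ''i'') (Var ''j''))) (Cell ''Y'' (Var ''i'')))))))"

text \<open>A running maximum of U / C, compared by cross multiplication to stay within the natural
  numbers.\<close>

definition mw_best :: com where
  "mw_best = Seq (Set ''b'' (Const 0)) (For ''j'' ''n''
     (Cond (Less (Mul (Cell ''U'' (Var ''b'')) (Cell ''C'' (Var ''j'')))
                 (Mul (Cell ''U'' (Var ''j'')) (Cell ''C'' (Var ''b''))))
        (Set ''b'' (Var ''j'')) Skip))"

definition mw_update :: com where
  "mw_update = Seq (Assign ''X'' (Var ''b'') (Add (Cell ''X'' (Var ''b'')) (Const 1)))
     (For ''i'' ''M'' (Assign ''Y'' (Var ''i'') (Mul (Cell ''Y'' (Var ''i''))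
        (Add (Mul (Const 2) (Var ''P'')) (Cell ''E'' (At (Var ''i'') (Var ''b'')))))))"

definition mw_round :: com where
  "mw_round = Seq mw_costs (Seq mw_best mw_update)"

definition mw :: com where
  "mw = Seq (For ''i'' ''M'' (Assign ''Y'' (Var ''i'') (Const 1)))
     (Seq (Set ''R'' (Mul (Mul (Const 32) (Var ''n'')) (Var ''M'')))
        (For ''t'' ''R'' mw_round))"

definition lr_degrees :: com where
  "lr_degrees = For ''j'' ''n'' (Seq (Assign ''G'' (Var ''j'') (Const 0))
     (For ''l'' ''n'' (Cond (Less (Cell ''Z'' (Var ''l'')) (Const 1))
        (Assign ''G'' (Var ''j'') (Add (Cell ''G'' (Var ''j''))
           (Mul (Cell ''X'' (Var ''l'')) (Cell ''K'' (At (Var ''j'') (Var ''l''))))))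
        Skip)))"

text \<open>The value n in \<open>b\<close> is a sentinel for "no pending item seen so far". In the
  absence of a disjunction, the inner condition spells out: b \<ge> n or G j < G b.\<close>

definition lr_best :: com where
  "lr_best = Seq (Set ''b'' (Var ''n'')) (For ''j'' ''n''
     (Cond (And (Less (Cell ''Z'' (Var ''j'')) (Const 1))
              (Not (And (Less (Var ''b'') (Var ''n''))
                 (Not (Less (Cell ''G'' (Var ''j'')) (Cell ''G'' (Var ''b'')))))))
        (Set ''b'' (Var ''j'')) Skip))"

text \<open>\<open>Z\<close> is set for b before the loop, which thereby skips b and freezes its
  residual weight.\<close>

definition lr_update :: com where
  "lr_update = Seq (Assign ''q'' (Var ''p'') (Var ''b'')) (Seq (Assign ''Z'' (Var ''b'') (Const 1))
     (For ''l'' ''n'' (Cond (Less (Cell ''Z'' (Var ''l'')) (Const 1))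
        (Assign ''U'' (Var ''l'') (Sub (Mul (Cell ''U'' (Var ''l'')) (Var ''P''))
           (Mul (Cell ''U'' (Var ''b'')) (Cell ''K'' (At (Var ''b'') (Var ''l''))))))
        Skip)))"

definition lr :: com where
  "lr = For ''p'' ''n'' (Seq lr_degrees (Seq lr_best lr_update))"

definition greedy_test :: com where
  "greedy_test = Seq (Set ''o'' (Const 1)) (For ''i'' ''m''
     (Cond (Less (Cap (Var ''i'')) (Add (Cell ''L'' (Var ''i'')) (Dem (Var ''i'') (Var ''e''))))
        (Set ''o'' (Const 0)) Skip))"

definition greedy_add :: com where
  "greedy_add = Seq (Assign ''out'' (Var ''e'') (Const 1)) (For ''i'' ''m''
     (Assign ''L'' (Var ''i'') (Add (Cell ''L'' (Var ''i'')) (Dem (Var ''i'') (Var ''e'')))))"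

definition greedy :: com where
  "greedy = For ''p'' ''n''
     (Seq (Set ''e'' (Cell ''q'' (Sub (Var ''n'') (Add (Var ''p'') (Const 1)))))
        (Cond (Less (Const 0) (Cell ''U'' (Var ''e'')))
           (Seq greedy_test (Cond (Less (Const 0) (Var ''o'')) greedy_add Skip))
           Skip))"

definition core :: com where
  "core = Seq compute_P (Seq compute_U (Seq compute_phi (Seq compute_item_rows
     (Seq compute_ker (Seq mw (Seq lr greedy))))))"

text \<open>Transitivity of comparing u / c through cross products, as needed when the running
  maximum is replaced. Only the middle denominator is cancelled.\<close>

lemma best_ratio_trans:
  fixes u1 u2 u3 c1 c2 c3 :: nat
  assumes "u1 * c2 \<le> u2 * c1" "u2 * c3 < u3 * c2" "0 < c2"
  shows "u1 * c3 \<le> u3 * c1"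
proof -
  have "c2 * (u1 * c3) = (u1 * c2) * c3" by (simp add: mult_ac)
  also have "\<dots> \<le> (u2 * c1) * c3" using assms by (intro mult_right_mono) auto
  also have "\<dots> = (u2 * c3) * c1" by (simp add: mult_ac)
  also have "\<dots> \<le> (u3 * c2) * c1" using assms by (intro mult_right_mono) auto
  also have "\<dots> = c2 * (u3 * c1)" by (simp add: mult_ac)
  finally show ?thesis using assms by simp
qed

text \<open>Each assumption on B bounds the largest value that some phase stores: entries of
  \<open>E\<close>, kernel entries, prices, costs, the number of rounds, kernel degrees, and
  residual weights.\<close>

locale bounded_packing = integer_packing +
  fixes B K :: nat
  assumes B_P: "2 * P < 2 ^ B"
    and B_ker: "m * P < 2 ^ B"
    and B_Y: "(4 * P) ^ (32 * n * (m + n)) < 2 ^ B"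
    and B_C: "(m + n) * (2 * P * (4 * P) ^ (32 * n * (m + n))) < 2 ^ B"
    and B_R: "32 * n * (m + n) < 2 ^ B"
    and B_G: "n * (32 * n * (m + n) * (m * P)) < 2 ^ B"
    and B_U: "j < n \<Longrightarrow> w j * P ^ n < 2 ^ B"
    and K: "n \<le> K" "m \<le> K" "m + n \<le> K" "32 * n * (m + n) \<le> K"
begin

section \<open>Verification of the preparatory loops\<close>

definition data :: "state \<Rightarrow> bool" where
  "data s \<longleftrightarrow> s ''n'' 0 = n \<and> s ''m'' 0 = m \<and> s ''M'' 0 = m + n \<and>
     (\<forall>j<n. s ''A'' j = w j) \<and> (\<forall>i<m. s ''A'' (n + i) = c i) \<and>
     (\<forall>i<m. \<forall>j<n. s ''A'' (n + m + (i * n + j)) = d i j)"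

lemma data_cong:
  "s' ''n'' = s ''n'' \<Longrightarrow> s' ''m'' = s ''m'' \<Longrightarrow> s' ''M'' = s ''M'' \<Longrightarrow> s' ''A'' = s ''A'' \<Longrightarrow>
    data s' \<longleftrightarrow> data s"
  by (simp add: data_def)

lemma small_bounds: "1 < (2::nat) ^ B" "P < 2 ^ B" "0 < B"
  using B_P P_pos by (auto intro: gr0I)

lemma partial_prod_le_P:
  assumes "i \<le> m"
  shows "(\<Prod>i'<i. if 0 < c i' then c i' else 1) \<le> P"
  using P_pos assms unfolding P_def by (intro dvd_imp_le prod_dvd_prod_subset) auto

lemma wp_compute_P:
  assumes "data s"
  shows "wp B K compute_P s (\<lambda>s'. s' ''P'' 0 = P)"
  unfolding compute_P_def
proof (intro wp_Seq wp_Assign)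
  let ?I = "\<lambda>i (s'::state). s' ''P'' 0 = (\<Prod>i'<i. if 0 < c i' then c i' else 1)"
  let ?s = "store ''P'' (aval (Const 0) s) (aval (Const 1) s) s"
  show "wp B K (For ''i'' ''m'' (Cond (Less (Const 0) (Cap (Var ''i'')))
        (Set ''P'' (Mul (Var ''P'') (Cap (Var ''i'')))) Skip)) ?s (\<lambda>s'. s' ''P'' 0 = P)"
  proof (rule wp_For[where I = ?I and n = m])
    fix i s' assume *: "i < m" "s' ''i'' 0 = i" "?I i s'"
      and fr: "\<And>x. x \<noteq> ''i'' \<Longrightarrow> x \<notin> writes (Cond (Less (Const 0) (Cap (Var ''i'')))
        (Set ''P'' (Mul (Var ''P'') (Cap (Var ''i'')))) Skip) \<Longrightarrow> s' x = ?s x"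
    have A: "s' ''A'' (n + i) = c i" "s' ''n'' 0 = n"
      using * assms by (simp_all add: fr store_other data_def)
    show "wp B K (Cond (Less (Const 0) (Cap (Var ''i'')))
        (Set ''P'' (Mul (Var ''P'') (Cap (Var ''i'')))) Skip) s' (?I (Suc i))"
      using * A partial_prod_le_P[of "Suc i"] small_bounds
      by (intro wp_Cond wp_Assign wp_Skip) (auto simp: store_apply)
  qed (use assms K in \<open>auto simp: store_apply store_other data_def P_def\<close>)
qed (use small_bounds in auto)

lemma wp_compute_U:
  assumes "data s"
  shows "wp B K compute_U s (\<lambda>s'. \<forall>j<n. s' ''U'' j = u j)"
  unfolding compute_U_def
proof (rule wp_For[where I = "\<lambda>j s'. \<forall>j'<j. s' ''U'' j' = u j'" and n = n])
  let ?inner = "For ''i'' ''m'' (Cond (Less (Cap (Var ''i'')) (Dem (Var ''i'') (Var ''j'')))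
        (Assign ''U'' (Var ''j'') (Const 0)) Skip)"
  let ?body = "Seq (Assign ''U'' (Var ''j'') (Cell ''A'' (Var ''j''))) ?inner"
  fix j s1 assume j: "j < n" "s1 ''j'' 0 = j" "\<forall>j'<j. s1 ''U'' j' = u j'" "bounded_state B s1"
    and fr: "\<And>x. x \<noteq> ''j'' \<Longrightarrow> x \<notin> writes ?body \<Longrightarrow> s1 x = s x"
  have d1: "data s1" using assms by (simp add: fr cong: data_cong)
  define s2 where "s2 = store ''U'' j (s1 ''A'' j) s1"
  have d2: "data s2" using d1 by (simp add: s2_def store_other cong: data_cong)
  let ?I = "\<lambda>i s'. (\<forall>j'<j. s' ''U'' j' = u j') \<and> s' ''U'' j = (if \<exists>i'<i. c i' < d i' j then 0 else w j)"
  have "wp B K ?inner s2 (\<lambda>s'. \<forall>j'<Suc j. s' ''U'' j' = u j')"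
  proof (rule wp_For[where I = ?I and n = m])
    fix i s3 assume *: "i < m" "s3 ''i'' 0 = i" "?I i s3"
      and fr: "\<And>x. x \<noteq> ''i'' \<Longrightarrow> x \<notin> writes (Cond (Less (Cap (Var ''i'')) (Dem (Var ''i'') (Var ''j'')))
        (Assign ''U'' (Var ''j'') (Const 0)) Skip) \<Longrightarrow> s3 x = s2 x"
    have "data s3" using d2 by (simp add: fr cong: data_cong)
    moreover have "s3 ''j'' 0 = j" using j by (simp add: fr s2_def store_other)
    ultimately show "wp B K (Cond (Less (Cap (Var ''i'')) (Dem (Var ''i'') (Var ''j'')))
        (Assign ''U'' (Var ''j'') (Const 0)) Skip) s3 (?I (Suc i))"
      using * j small_bounds
      by (intro wp_Cond wp_Assign wp_Skip) (auto simp: store_apply data_def less_Suc_eq)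
  next
    fix s' assume "?I m s'"
    then show "\<forall>j'<Suc j. s' ''U'' j' = u j'" by (auto simp: u_def less_Suc_eq)
  qed (use d1 d2 j K in \<open>auto simp: store_apply s2_def data_def\<close>)
  then show "wp B K ?body s1 (\<lambda>s'. \<forall>j'<Suc j. s' ''U'' j' = u j')"
    using j by (intro wp_Seq wp_Assign) (auto simp: s2_def bounded_state_def)
qed (use assms K in \<open>auto simp: store_apply data_def\<close>)

text \<open>The rows from m on belong to the postcondition because the next phase writes only their
  nonzero entries and relies on zeros elsewhere.\<close>

lemma wp_compute_phi:
  assumes "data s" "s ''P'' 0 = P" "\<And>i. s ''E'' i = 0"
  shows "wp B K compute_phi s (\<lambda>s'. \<forall>i<m + n. \<forall>j<n. s' ''E'' (i * n + j) = (if i < m then phi i j else 0))"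
  unfolding compute_phi_def
proof (rule wp_For[where n = m and I = "\<lambda>i s'. \<forall>i'<m + n. \<forall>j'<n. s' ''E'' (i' * n + j') =
      (if i' < i then phi i' j' else 0)"])
  let ?c = "Cond (Less (Cap (Var ''i'')) (Mul (Const 2) (Dem (Var ''i'') (Var ''j''))))
        (Assign ''E'' (At (Var ''i'') (Var ''j'')) (Var ''P''))
        (Assign ''E'' (At (Var ''i'') (Var ''j''))
           (Div (Mul (Mul (Const 2) (Dem (Var ''i'') (Var ''j''))) (Var ''P'')) (Cap (Var ''i''))))"
  fix i s1 assume i: "i < m" "s1 ''i'' 0 = i"
    "\<forall>i'<m + n. \<forall>j'<n. s1 ''E'' (i' * n + j') = (if i' < i then phi i' j' else 0)"
    and fr: "\<And>x. x \<noteq> ''i'' \<Longrightarrow> x \<notin> writes (For ''j'' ''n'' ?c) \<Longrightarrow> s1 x = s x"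
  have d1: "data s1" "s1 ''P'' 0 = P" using assms by (simp_all add: fr cong: data_cong)
  let ?I = "\<lambda>j s'. \<forall>i'<m + n. \<forall>j'<n. s' ''E'' (i' * n + j') =
      (if i' < i \<or> i' = i \<and> j' < j then phi i' j' else 0)"
  show "wp B K (For ''j'' ''n'' ?c) s1 (\<lambda>s'. \<forall>i'<m + n. \<forall>j'<n. s' ''E'' (i' * n + j') =
      (if i' < Suc i then phi i' j' else 0))"
  proof (rule wp_For[where I = ?I and n = n])
    fix j s2 assume j: "j < n" "s2 ''j'' 0 = j" "?I j s2"
      and fr: "\<And>x. x \<noteq> ''j'' \<Longrightarrow> x \<notin> writes ?c \<Longrightarrow> s2 x = s1 x"
    have d2: "data s2" "s2 ''P'' 0 = P" "s2 ''i'' 0 = i"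
      using d1 i by (simp_all add: fr cong: data_cong)
    then have v: "s2 ''A'' (n + m + (i * n + j)) = d i j" "s2 ''A'' (n + i) = c i" "s2 ''n'' 0 = n" "s2 ''m'' 0 = m"
      using i j by (auto simp: data_def)
    have "phi i j < 2 ^ B" using phi_le[OF i(1)] small_bounds by (meson le_less_trans)
    then show "wp B K ?c s2 (?I (Suc j))"
      using d2 v i j
      by (intro wp_Cond wp_Assign wp_Skip)
        (auto simp: store_apply matrix_index_eq_iff less_Suc_eq phi_def)
  qed (use d1 i K in \<open>auto simp: store_apply data_def less_Suc_eq\<close>)
qed (use assms K in \<open>auto simp: store_apply data_def\<close>)

lemma wp_compute_item_rows:
  assumes "data s" "s ''P'' 0 = P"
    "\<forall>i<m + n. \<forall>j<n. s ''E'' (i * n + j) = (if i < m then phi i j else 0)"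
  shows "wp B K compute_item_rows s (\<lambda>s'. \<forall>i<m + n. \<forall>j<n. s' ''E'' (i * n + j) = E i j)"
  unfolding compute_item_rows_def
proof (rule wp_For[where n = n and I = "\<lambda>j s'. \<forall>i'<m + n. \<forall>j'<n. s' ''E'' (i' * n + j') =
      (if i' < m \<or> j' < j then E i' j' else 0)"])
  let ?c = "Assign ''E'' (At (Add (Var ''m'') (Var ''j'')) (Var ''j'')) (Mul (Const 2) (Var ''P''))"
  fix j s1 assume j: "j < n" "s1 ''j'' 0 = j" "\<forall>i'<m + n. \<forall>j'<n. s1 ''E'' (i' * n + j') =
      (if i' < m \<or> j' < j then E i' j' else 0)"
    and fr: "\<And>x. x \<noteq> ''j'' \<Longrightarrow> x \<notin> writes ?c \<Longrightarrow> s1 x = s x"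
  have d1: "data s1" "s1 ''P'' 0 = P" using assms by (simp_all add: fr cong: data_cong)
  then have v: "s1 ''n'' 0 = n" "s1 ''m'' 0 = m" by (auto simp: data_def)
  show "wp B K ?c s1 (\<lambda>s'. \<forall>i'<m + n. \<forall>j'<n. s' ''E'' (i' * n + j') =
      (if i' < m \<or> j' < Suc j then E i' j' else 0))"
    using j d1 v B_P
    by (intro wp_Assign) (auto simp: store_apply matrix_index_eq_iff less_Suc_eq E_def)
qed (use assms K in \<open>auto simp: store_apply data_def E_def\<close>)

lemma wp_compute_ker:
  assumes "data s" "s ''P'' 0 = P" "\<forall>i<m + n. \<forall>j<n. s ''E'' (i * n + j) = E i j" "\<And>i. s ''K'' i = 0"
  shows "wp B K compute_ker s (\<lambda>s'. \<forall>j<n. \<forall>l<n. s' ''K'' (j * n + l) = ker j l)"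
  unfolding compute_ker_def
proof (rule wp_For[where n = n and I = "\<lambda>j s'. \<forall>j'<n. \<forall>l'<n. s' ''K'' (j' * n + l') =
      (if j' < j then ker j' l' else 0)"])
  let ?c = "Cond (Less (Const 0) (Cell ''E'' (At (Var ''i'') (Var ''j''))))
        (Cond (Less (Cell ''E'' (At (Var ''i'') (Var ''j''))) (Var ''P''))
           (Assign ''K'' (At (Var ''j'') (Var ''l''))
              (Add (Cell ''K'' (At (Var ''j'') (Var ''l''))) (Cell ''E'' (At (Var ''i'') (Var ''l'')))))
           (Cond (Less (Const 0) (Cell ''E'' (At (Var ''i'') (Var ''l''))))
              (Assign ''K'' (At (Var ''j'') (Var ''l''))
                 (Add (Cell ''K'' (At (Var ''j'') (Var ''l''))) (Var ''P'')))
              Skip))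
        Skip"
  fix j s1 assume j: "j < n" "s1 ''j'' 0 = j"
    "\<forall>j'<n. \<forall>l'<n. s1 ''K'' (j' * n + l') = (if j' < j then ker j' l' else 0)"
    and fr: "\<And>x. x \<noteq> ''j'' \<Longrightarrow> x \<notin> writes (For ''l'' ''n'' (For ''i'' ''m'' ?c)) \<Longrightarrow> s1 x = s x"
  have d1: "data s1" "s1 ''P'' 0 = P" "\<forall>i<m + n. \<forall>j<n. s1 ''E'' (i * n + j) = E i j"
    using assms by (simp_all add: fr cong: data_cong)
  let ?I = "\<lambda>l s'. \<forall>j'<n. \<forall>l'<n. s' ''K'' (j' * n + l') =
      (if j' < j \<or> j' = j \<and> l' < l then ker j' l' else 0)"
  show "wp B K (For ''l'' ''n'' (For ''i'' ''m'' ?c)) s1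
     (\<lambda>s'. \<forall>j'<n. \<forall>l'<n. s' ''K'' (j' * n + l') = (if j' < Suc j then ker j' l' else 0))"
  proof (rule wp_For[where n = n and I = ?I])
    fix l s2 assume l: "l < n" "s2 ''l'' 0 = l" "?I l s2"
      and fr: "\<And>x. x \<noteq> ''l'' \<Longrightarrow> x \<notin> writes (For ''i'' ''m'' ?c) \<Longrightarrow> s2 x = s1 x"
    have d2: "data s2" "s2 ''P'' 0 = P" "\<forall>i<m + n. \<forall>j<n. s2 ''E'' (i * n + j) = E i j" "s2 ''j'' 0 = j"
      using d1 j by (simp_all add: fr cong: data_cong)
    let ?J = "\<lambda>i s'. \<forall>j'<n. \<forall>l'<n. s' ''K'' (j' * n + l') =
        (if j' < j \<or> j' = j \<and> l' < l then ker j' l' else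
         if j' = j \<and> l' = l then (\<Sum>i'<i. ker_term i' j l) else 0)"
    show "wp B K (For ''i'' ''m'' ?c) s2 (?I (Suc l))"
    proof (rule wp_For[where n = m and I = ?J])
      fix i s3 assume i: "i < m" "s3 ''i'' 0 = i" "?J i s3"
        and fr: "\<And>x. x \<noteq> ''i'' \<Longrightarrow> x \<notin> writes ?c \<Longrightarrow> s3 x = s2 x"
      have d3: "data s3" "s3 ''P'' 0 = P" "\<forall>i<m + n. \<forall>j<n. s3 ''E'' (i * n + j) = E i j"
          "s3 ''j'' 0 = j" "s3 ''l'' 0 = l"
        using d2 j l by (simp_all add: fr cong: data_cong)
      then have n: "s3 ''n'' 0 = n" by (simp add: data_def)
      have v: "s3 ''E'' (i * n + j) = phi i j" "s3 ''E'' (i * n + l) = phi i l"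
          "s3 ''K'' (j * n + l) = (\<Sum>i'<i. ker_term i' j l)"
        using d3 i j l by (auto simp: E_def)
      have "(\<Sum>i'<Suc i. ker_term i' j l) \<le> (\<Sum>i'<Suc i. P)"
        using phi_le i by (intro sum_mono) (auto simp: ker_term_def)
      also have "\<dots> = Suc i * P" by simp
      also have "\<dots> \<le> m * P" using i by (intro mult_right_mono) auto
      finally have bd: "(\<Sum>i'<Suc i. ker_term i' j l) < 2 ^ B" using B_ker by simp
      show "wp B K ?c s3 (?J (Suc i))"
        using i j l d3(2,4,5) n v bd
        by (intro wp_Cond wp_Assign wp_Skip)
          (auto simp: store_apply matrix_index_eq_iff ker_term_def)
    next
      fix s' assume "?J m s'"
      then show "?I (Suc l) s'" by (auto simp: less_Suc_eq ker_def)
    qed (use d2 l K in \<open>auto simp: store_apply data_def\<close>)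
  qed (use d1 j K in \<open>auto simp: store_apply data_def less_Suc_eq\<close>)
qed (use assms K in \<open>auto simp: store_apply data_def\<close>)

section \<open>Verification of the multiplicative weights phase\<close>

definition prepared :: "state \<Rightarrow> bool" where
  "prepared s \<longleftrightarrow> data s \<and> s ''P'' 0 = P \<and> (\<forall>i<m + n. \<forall>j<n. s ''E'' (i * n + j) = E i j) \<and>
     (\<forall>j<n. \<forall>l<n. s ''K'' (j * n + l) = ker j l)"

lemma prepared_cong:
  "s' ''n'' = s ''n'' \<Longrightarrow> s' ''m'' = s ''m'' \<Longrightarrow> s' ''M'' = s ''M'' \<Longrightarrow> s' ''A'' = s ''A'' \<Longrightarrow>
   s' ''P'' = s ''P'' \<Longrightarrow> s' ''E'' = s ''E'' \<Longrightarrow> s' ''K'' = s ''K'' \<Longrightarrow> prepared s' \<longleftrightarrow> prepared s"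
  using data_cong[of s' s] by (simp add: prepared_def)

abbreviation rounds :: nat where
  "rounds \<equiv> 32 * n * (m + n)"

lemma wp_mw_costs:
  assumes "prepared s" "\<And>i. i < m + n \<Longrightarrow> s ''Y'' i \<le> (4 * P) ^ rounds"
  shows "wp B K mw_costs s (\<lambda>s'. \<forall>j<n. s' ''C'' j = (\<Sum>i<m + n. E i j * s ''Y'' i))"
  unfolding mw_costs_def
proof (rule wp_For[where n = n and I = "\<lambda>j s'. \<forall>j'<j. s' ''C'' j' = (\<Sum>i<m + n. E i j' * s ''Y'' i)"])
  let ?d = "Assign ''C'' (Var ''j'') (Add (Cell ''C'' (Var ''j''))
        (Mul (Cell ''E'' (At (Var ''i'') (Var ''j''))) (Cell ''Y'' (Var ''i''))))"
  let ?c = "Seq (Assign ''C'' (Var ''j'') (Const 0)) (For ''i'' ''M'' ?d)"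
  fix j s1 assume j: "j < n" "s1 ''j'' 0 = j" "\<forall>j'<j. s1 ''C'' j' = (\<Sum>i<m + n. E i j' * s ''Y'' i)"
    and fr: "\<And>x. x \<noteq> ''j'' \<Longrightarrow> x \<notin> writes ?c \<Longrightarrow> s1 x = s x"
  have d1: "prepared s1" "s1 ''Y'' = s ''Y''" using assms by (simp_all add: fr cong: prepared_cong)
  define s2 where "s2 = store ''C'' j 0 s1"
  have d2: "prepared s2" "s2 ''Y'' = s ''Y''" "s2 ''j'' 0 = j"
    using d1 j by (simp_all add: s2_def store_other cong: prepared_cong)
  let ?I = "\<lambda>i s'. (\<forall>j'<j. s' ''C'' j' = (\<Sum>i<m + n. E i j' * s ''Y'' i)) \<and>
     s' ''C'' j = (\<Sum>i'<i. E i' j * s ''Y'' i')"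
  have "wp B K (For ''i'' ''M'' ?d) s2 (\<lambda>s'. \<forall>j'<Suc j. s' ''C'' j' = (\<Sum>i<m + n. E i j' * s ''Y'' i))"
  proof (rule wp_For[where n = "m + n" and I = ?I])
    fix i s3 assume i: "i < m + n" "s3 ''i'' 0 = i" "?I i s3"
      and fr: "\<And>x. x \<noteq> ''i'' \<Longrightarrow> x \<notin> writes ?d \<Longrightarrow> s3 x = s2 x"
    have d3: "prepared s3" "s3 ''Y'' = s ''Y''" "s3 ''j'' 0 = j"
      using d2 by (simp_all add: fr cong: prepared_cong)
    then have v: "s3 ''E'' (i * n + j) = E i j" "s3 ''n'' 0 = n" using i j by (auto simp: prepared_def data_def)
    have "(\<Sum>i'<Suc i. E i' j * s ''Y'' i') \<le> (\<Sum>i'<Suc i. 2 * P * (4 * P) ^ rounds)"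
      using i E_le assms(2) by (intro sum_mono mult_mono) auto
    also have "\<dots> = Suc i * (2 * P * (4 * P) ^ rounds)" by simp
    also have "\<dots> \<le> (m + n) * (2 * P * (4 * P) ^ rounds)" using i by (intro mult_right_mono) auto
    finally have "(\<Sum>i'<Suc i. E i' j * s ''Y'' i') < 2 ^ B" using B_C by simp
    then show "wp B K ?d s3 (?I (Suc i))"
      using i d3 v j by (intro wp_Assign) (auto simp: store_apply)
  qed (use d2 j K in \<open>auto simp: store_apply prepared_def data_def s2_def less_Suc_eq\<close>)
  then show "wp B K ?c s1 (\<lambda>s'. \<forall>j'<Suc j. s' ''C'' j' = (\<Sum>i<m + n. E i j' * s ''Y'' i))"
    using j small_bounds by (intro wp_Seq wp_Assign) (auto simp: s2_def)
qed (use assms K in \<open>auto simp: store_apply prepared_def data_def\<close>)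

lemma wp_mw_best:
  assumes "prepared s" "0 < n" "\<And>j. j < n \<Longrightarrow> 0 < s ''C'' j"
  shows "wp B K mw_best s (\<lambda>s'. s' ''b'' 0 < n \<and>
     (\<forall>j<n. s ''U'' j * s ''C'' (s' ''b'' 0) \<le> s ''U'' (s' ''b'' 0) * s ''C'' j))"
  unfolding mw_best_def
proof (intro wp_Seq wp_Assign)
  let ?c = "Cond (Less (Mul (Cell ''U'' (Var ''b'')) (Cell ''C'' (Var ''j'')))
                 (Mul (Cell ''U'' (Var ''j'')) (Cell ''C'' (Var ''b''))))
        (Set ''b'' (Var ''j'')) Skip"
  let ?I = "\<lambda>j s'. s' ''b'' 0 < n \<and>
     (\<forall>j'<j. s ''U'' j' * s ''C'' (s' ''b'' 0) \<le> s ''U'' (s' ''b'' 0) * s ''C'' j')"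
  let ?s = "store ''b'' (aval (Const 0) s) (aval (Const 0) s) s"
  show "wp B K (For ''j'' ''n'' ?c) ?s (?I n)"
  proof (rule wp_For[where n = n and I = ?I])
    fix j s1 assume j: "j < n" "s1 ''j'' 0 = j" "?I j s1" "bounded_state B s1"
      and fr: "\<And>x. x \<noteq> ''j'' \<Longrightarrow> x \<notin> writes ?c \<Longrightarrow> s1 x = ?s x"
    have d1: "s1 ''U'' = s ''U''" "s1 ''C'' = s ''C''" by (simp_all add: fr store_other)
    have "j < 2 ^ B" using j by (metis bounded_state_def)
    then show "wp B K ?c s1 (?I (Suc j))"
      using j d1 assms(3)[of "s1 ''b'' 0"]
      by (intro wp_Cond wp_Assign wp_Skip)
        (auto simp: store_apply less_Suc_eq intro: best_ratio_trans)
  qed (use assms K in \<open>auto simp: store_apply store_other prepared_def data_def\<close>)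
qed (use small_bounds in auto)

lemma wp_mw_update:
  assumes "prepared s" "t < rounds" "s ''b'' 0 = b" "b < n"
    "mw_inv (Suc t) ((s ''X'')(b := Suc (s ''X'' b))) (\<lambda>i. s ''Y'' i * (2 * P + E i b))"
  shows "wp B K mw_update s (\<lambda>s'. mw_inv (Suc t) (s' ''X'') (s' ''Y''))"
  unfolding mw_update_def
proof (intro wp_Seq wp_Assign)
  let ?X = "(s ''X'')(b := Suc (s ''X'' b))"
  let ?s = "store ''X'' (aval (Var ''b'') s) (aval (Add (Cell ''X'' (Var ''b'')) (Const 1)) s) s"
  have X: "?s ''X'' = ?X" using assms by (auto simp: store_def)
  have "?X b \<le> (\<Sum>j<n. ?X j)" using assms(4) by (intro member_le_sum) auto
  also have "\<dots> \<le> rounds" using assms(2,5) by (auto simp: mw_inv_def)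
  finally show "aval (Add (Cell ''X'' (Var ''b'')) (Const 1)) s < 2 ^ B"
    using B_R assms(3) by simp
  let ?c = "Assign ''Y'' (Var ''i'') (Mul (Cell ''Y'' (Var ''i''))
        (Add (Mul (Const 2) (Var ''P'')) (Cell ''E'' (At (Var ''i'') (Var ''b'')))))"
  let ?I = "\<lambda>i s'. \<forall>i'<m + n. s' ''Y'' i' = (if i' < i then s ''Y'' i' * (2 * P + E i' b) else s ''Y'' i')"
  show "wp B K (For ''i'' ''M'' ?c) ?s (\<lambda>s'. mw_inv (Suc t) (s' ''X'') (s' ''Y''))"
  proof (rule wp_For[where n = "m + n" and I = ?I])
    fix i s1 assume i: "i < m + n" "s1 ''i'' 0 = i" "?I i s1"
      and fr: "\<And>x. x \<noteq> ''i'' \<Longrightarrow> x \<notin> writes ?c \<Longrightarrow> s1 x = ?s x"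
    have "prepared s1" "s1 ''b'' 0 = b" using assms by (simp_all add: fr store_other cong: prepared_cong)
    then have v: "s1 ''E'' (i * n + b) = E i b" "s1 ''n'' 0 = n" "s1 ''P'' 0 = P" "s1 ''b'' 0 = b"
      using i assms(4) by (auto simp: prepared_def data_def)
    have "s ''Y'' i * (2 * P + E i b) \<le> (4 * P) ^ Suc t" using assms(5) i by (auto simp: mw_inv_def)
    also have "\<dots> \<le> (4 * P) ^ rounds" using assms(2) P_pos by (intro power_increasing) auto
    finally have "s ''Y'' i * (2 * P + E i b) < 2 ^ B" using B_Y by simp
    then show "wp B K ?c s1 (?I (Suc i))"
      using i v by (intro wp_Assign) (auto simp: store_apply)
  next
    fix s' assume *: "?I (m + n) s'" and fr: "\<And>x. x \<noteq> ''i'' \<Longrightarrow> x \<notin> writes ?c \<Longrightarrow> s' x = ?s x"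
    show "mw_inv (Suc t) (s' ''X'') (s' ''Y'')"
      using * X by (intro mw_inv_cong[OF assms(5)]) (auto simp: fr)
  qed (use assms K in \<open>auto simp: store_apply store_other prepared_def data_def\<close>)
qed

lemma wp_mw_round:
  assumes "prepared s" "\<And>j. j < n \<Longrightarrow> s ''U'' j = u j" "0 < n" "t < rounds" "mw_inv t (s ''X'') (s ''Y'')"
  shows "wp B K mw_round s (\<lambda>s'. mw_inv (Suc t) (s' ''X'') (s' ''Y''))"
  unfolding mw_round_def
proof (rule wp_Seq_frame[OF wp_mw_costs])
  have Y: "0 < s ''Y'' i" "s ''Y'' i \<le> (4 * P) ^ t" if "i < m + n" for i
    using assms(5) that by (auto simp: mw_inv_def)
  moreover have "(4 * P) ^ t \<le> (4 * P) ^ rounds" using assms(4) P_pos by (intro power_increasing) auto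
  ultimately show "s ''Y'' i \<le> (4 * P) ^ rounds" if "i < m + n" for i using that order_trans by blast
  fix s1 assume fr: "\<And>x. x \<notin> writes mw_costs \<Longrightarrow> s1 x = s x"
    and C: "\<forall>j<n. s1 ''C'' j = (\<Sum>i<m + n. E i j * s ''Y'' i)"
  have d1: "prepared s1" "s1 ''Y'' = s ''Y''" "s1 ''X'' = s ''X''" "s1 ''U'' = s ''U''"
    using assms(1) by (simp_all add: fr mw_costs_def cong: prepared_cong)
  \<comment> \<open>The item row of j gives a positive cost even to an item that uses no resource.
    Comparing ratios by cross products depends on this.\<close>
  have Cpos: "0 < s1 ''C'' j" if "j < n" for j
  proof -
    have "0 < E (m + j) j * s ''Y'' (m + j)" using Y[of "m + j"] P_pos that by (simp add: E_def)
    also have "\<dots> \<le> (\<Sum>i<m + n. E i j * s ''Y'' i)"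
      using that by (intro member_le_sum[of "m + j" _ "\<lambda>i. E i j * s ''Y'' i"]) auto
    finally show ?thesis using C that by simp
  qed
  show "wp B K (Seq mw_best mw_update) s1 (\<lambda>s'. mw_inv (Suc t) (s' ''X'') (s' ''Y''))"
  proof (rule wp_Seq_frame[OF wp_mw_best[OF d1(1) assms(3) Cpos]])
    fix s2 assume fr: "\<And>x. x \<notin> writes mw_best \<Longrightarrow> s2 x = s1 x"
      and b: "s2 ''b'' 0 < n \<and>
       (\<forall>j<n. s1 ''U'' j * s1 ''C'' (s2 ''b'' 0) \<le> s1 ''U'' (s2 ''b'' 0) * s1 ''C'' j)"
    have d2: "prepared s2" "s2 ''Y'' = s ''Y''" "s2 ''X'' = s ''X''"
      using d1 by (simp_all add: fr mw_best_def cong: prepared_cong)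
    show "wp B K mw_update s2 (\<lambda>s'. mw_inv (Suc t) (s' ''X'') (s' ''Y''))"
    proof (rule wp_mw_update[OF d2(1) assms(4) refl])
      show "mw_inv (Suc t) ((s2 ''X'')(s2 ''b'' 0 := Suc (s2 ''X'' (s2 ''b'' 0))))
         (\<lambda>i. s2 ''Y'' i * (2 * P + E i (s2 ''b'' 0)))"
        unfolding d2 using b C d1 assms(2) by (intro mw_inv_step[OF assms(5)]) auto
    qed (use assms b d2 in auto)
  qed
qed fact

lemma wp_mw:
  assumes "prepared s" "\<And>j. j < n \<Longrightarrow> s ''U'' j = u j" "\<And>j. s ''X'' j = 0"
  shows "wp B K mw s (\<lambda>s'. \<exists>Y. mw_inv rounds (s' ''X'') Y)"
  unfolding mw_def
proof (rule wp_Seq_frame)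
  let ?c = "Assign ''Y'' (Var ''i'') (Const 1)"
  show "wp B K (For ''i'' ''M'' ?c) s (\<lambda>s'. \<forall>i<m + n. s' ''Y'' i = 1)"
  proof (rule wp_For[where n = "m + n" and I = "\<lambda>i s'. \<forall>i'<i. s' ''Y'' i' = 1"])
    fix i s1 assume "i < m + n" "s1 ''i'' 0 = i" "\<forall>i'<i. s1 ''Y'' i' = 1"
    then show "wp B K ?c s1 (\<lambda>s'. \<forall>i'<Suc i. s' ''Y'' i' = 1)"
      using small_bounds by (intro wp_Assign) (auto simp: store_apply)
  qed (use assms K in \<open>auto simp: store_apply prepared_def data_def\<close>)
  fix s1 assume fr: "\<And>x. x \<notin> writes (For ''i'' ''M'' ?c) \<Longrightarrow> s1 x = s x"
    and Y: "\<forall>i<m + n. s1 ''Y'' i = 1"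
  have d1: "prepared s1" "s1 ''X'' = (\<lambda>_. 0)" "s1 ''U'' = s ''U''"
    using assms by (auto simp: fr cong: prepared_cong)
  define s2 where "s2 = store ''R'' 0 rounds s1"
  have d2: "prepared s2" "s2 ''X'' = (\<lambda>_. 0)" "s2 ''U'' = s ''U''" "s2 ''Y'' = s1 ''Y''" "s2 ''R'' 0 = rounds"
    using d1 by (auto simp: s2_def store_other store_apply cong: prepared_cong)
  have "wp B K (For ''t'' ''R'' mw_round) s2 (\<lambda>s'. \<exists>Y. mw_inv rounds (s' ''X'') Y)"
  proof (rule wp_For[where n = rounds and I = "\<lambda>t s'. mw_inv t (s' ''X'') (s' ''Y'')"])
    show "mw_inv 0 (s2 ''X'') (s2 ''Y'')" unfolding d2 using Y by (intro mw_inv_cong[OF mw_inv_init]) auto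
    fix t s3 assume t: "t < rounds" "s3 ''t'' 0 = t" "mw_inv t (s3 ''X'') (s3 ''Y'')"
      and fr: "\<And>x. x \<noteq> ''t'' \<Longrightarrow> x \<notin> writes mw_round \<Longrightarrow> s3 x = s2 x"
    have "prepared s3" "s3 ''U'' = s ''U''"
      using d2 by (simp_all add: fr mw_round_def mw_costs_def mw_best_def mw_update_def cong: prepared_cong)
    \<comment> \<open>\<open>t < rounds\<close> already excludes n = 0, so item 0 exists as the
      starting candidate of the search.\<close>
    then show "wp B K mw_round s3 (\<lambda>s'. mw_inv (Suc t) (s' ''X'') (s' ''Y''))"
      using t assms(2) by (intro wp_mw_round) (auto intro: gr0I)
  qed (use d2 K in \<open>auto simp: store_other mw_round_def mw_costs_def mw_best_def mw_update_def\<close>)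
  then show "wp B K (Seq (Set ''R'' (Mul (Mul (Const 32) (Var ''n'')) (Var ''M'')))
        (For ''t'' ''R'' mw_round)) s1 (\<lambda>s'. \<exists>Y. mw_inv rounds (s' ''X'') Y)"
    using d1(1) B_R by (intro wp_Seq wp_Assign) (auto simp: prepared_def data_def s2_def)
qed

section \<open>Verification of the local ratio phase\<close>

lemma ker_le: "ker j l \<le> m * P"
proof -
  have "ker j l \<le> (\<Sum>i<m. P)"
    unfolding ker_def using phi_le by (intro sum_mono) (auto simp: ker_term_def)
  then show ?thesis by simp
qed

lemma wp_lr_degrees:
  assumes "prepared s" "(\<Sum>j<n. s ''X'' j) = rounds"
  shows "wp B K lr_degrees s (\<lambda>s'. \<forall>j<n. s' ''G'' j = (\<Sum>l\<in>{l. l < n \<and> s ''Z'' l = 0}. s ''X'' l * ker j l))"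
  unfolding lr_degrees_def
proof (rule wp_For[where n = n and I = "\<lambda>j s'. \<forall>j'<j. s' ''G'' j' =
      (\<Sum>l\<in>{l. l < n \<and> s ''Z'' l = 0}. s ''X'' l * ker j' l)"])
  let ?D = "\<lambda>r j. \<Sum>l\<in>{l. l < r \<and> s ''Z'' l = 0}. s ''X'' l * ker j l"
  let ?d = "Cond (Less (Cell ''Z'' (Var ''l'')) (Const 1))
        (Assign ''G'' (Var ''j'') (Add (Cell ''G'' (Var ''j''))
           (Mul (Cell ''X'' (Var ''l'')) (Cell ''K'' (At (Var ''j'') (Var ''l''))))))
        Skip"
  let ?c = "Seq (Assign ''G'' (Var ''j'') (Const 0)) (For ''l'' ''n'' ?d)"
  fix j s1 assume j: "j < n" "s1 ''j'' 0 = j" "\<forall>j'<j. s1 ''G'' j' = ?D n j'"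
    and fr: "\<And>x. x \<noteq> ''j'' \<Longrightarrow> x \<notin> writes ?c \<Longrightarrow> s1 x = s x"
  have d1: "prepared s1" "s1 ''X'' = s ''X''" "s1 ''Z'' = s ''Z''"
    using assms by (simp_all add: fr cong: prepared_cong)
  define s2 where "s2 = store ''G'' j 0 s1"
  have d2: "prepared s2" "s2 ''X'' = s ''X''" "s2 ''Z'' = s ''Z''" "s2 ''j'' 0 = j"
    using d1 j by (simp_all add: s2_def store_other cong: prepared_cong)
  let ?I = "\<lambda>l s'. (\<forall>j'<j. s' ''G'' j' = ?D n j') \<and> s' ''G'' j = ?D l j"
  have "wp B K (For ''l'' ''n'' ?d) s2 (\<lambda>s'. \<forall>j'<Suc j. s' ''G'' j' = ?D n j')"
  proof (rule wp_For[where n = n and I = ?I])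
    fix l s3 assume l: "l < n" "s3 ''l'' 0 = l" "?I l s3"
      and fr: "\<And>x. x \<noteq> ''l'' \<Longrightarrow> x \<notin> writes ?d \<Longrightarrow> s3 x = s2 x"
    have d3: "prepared s3" "s3 ''X'' = s ''X''" "s3 ''Z'' = s ''Z''" "s3 ''j'' 0 = j"
      using d2 by (simp_all add: fr cong: prepared_cong)
    then have v: "s3 ''K'' (j * n + l) = ker j l" "s3 ''n'' 0 = n"
      using l j by (auto simp: prepared_def data_def)
    have "?D (Suc l) j \<le> (\<Sum>l<n. s ''X'' l * ker j l)" using l by (intro sum_mono2) auto
    also have "\<dots> \<le> (\<Sum>l<n. s ''X'' l * (m * P))" using ker_le by (intro sum_mono mult_left_mono) auto
    also have "\<dots> = rounds * (m * P)" using assms(2) by (simp flip: sum_distrib_right)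
    also have "\<dots> \<le> n * (rounds * (m * P))" using l by simp
    finally have bd: "?D (Suc l) j < 2 ^ B" using B_G by simp
    have "{l'. l' < Suc l \<and> s ''Z'' l' = 0} =
        (if s ''Z'' l = 0 then insert l {l'. l' < l \<and> s ''Z'' l' = 0} else {l'. l' < l \<and> s ''Z'' l' = 0})"
      by (auto simp: less_Suc_eq)
    then have step: "?D (Suc l) j = ?D l j + (if s ''Z'' l = 0 then s ''X'' l * ker j l else 0)" by simp
    then show "wp B K ?d s3 (?I (Suc l))"
      using l d3 v j bd by (intro wp_Cond wp_Assign wp_Skip) (auto simp: store_apply)
  qed (use d2 j K in \<open>auto simp: store_apply prepared_def data_def s2_def less_Suc_eq\<close>)
  then show "wp B K ?c s1 (\<lambda>s'. \<forall>j'<Suc j. s' ''G'' j' = ?D n j')"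
    using j small_bounds by (intro wp_Seq wp_Assign) (auto simp: s2_def)
qed (use assms K in \<open>auto simp: store_apply prepared_def data_def\<close>)

lemma wp_lr_best:
  assumes "prepared s" "l < n" "s ''Z'' l = 0"
  shows "wp B K lr_best s (\<lambda>s'. s' ''b'' 0 < n \<and> s ''Z'' (s' ''b'' 0) = 0 \<and>
     (\<forall>j<n. s ''Z'' j = 0 \<longrightarrow> s ''G'' (s' ''b'' 0) \<le> s ''G'' j))"
  unfolding lr_best_def
proof (rule wp_boundedI, intro wp_Seq wp_Assign)
  assume B: "bounded_state B s"
  let ?c = "Cond (And (Less (Cell ''Z'' (Var ''j'')) (Const 1))
              (Not (And (Less (Var ''b'') (Var ''n''))
                 (Not (Less (Cell ''G'' (Var ''j'')) (Cell ''G'' (Var ''b'')))))))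
        (Set ''b'' (Var ''j'')) Skip"
  let ?I = "\<lambda>j s'. (s' ''b'' 0 = n \<and> (\<forall>j'<j. s ''Z'' j' \<noteq> 0)) \<or>
     (s' ''b'' 0 < n \<and> s ''Z'' (s' ''b'' 0) = 0 \<and>
     (\<forall>j'<j. s ''Z'' j' = 0 \<longrightarrow> s ''G'' (s' ''b'' 0) \<le> s ''G'' j'))"
  let ?s = "store ''b'' (aval (Const 0) s) (aval (Var ''n'') s) s"
  have n: "s ''n'' 0 = n" using assms by (simp add: prepared_def data_def)
  then show "aval (Var ''n'') s < 2 ^ B" using B by (auto simp: bounded_state_def)
  show "wp B K (For ''j'' ''n'' ?c) ?s (\<lambda>s'. s' ''b'' 0 < n \<and> s ''Z'' (s' ''b'' 0) = 0 \<and>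
     (\<forall>j<n. s ''Z'' j = 0 \<longrightarrow> s ''G'' (s' ''b'' 0) \<le> s ''G'' j))"
  proof (rule wp_For[where n = n and I = ?I])
    fix j s1 assume j: "j < n" "s1 ''j'' 0 = j" "?I j s1" "bounded_state B s1"
      and fr: "\<And>x. x \<noteq> ''j'' \<Longrightarrow> x \<notin> writes ?c \<Longrightarrow> s1 x = ?s x"
    have d1: "s1 ''Z'' = s ''Z''" "s1 ''G'' = s ''G''" "s1 ''n'' 0 = n"
      using n by (simp_all add: fr store_other)
    have "j < 2 ^ B" using j by (metis bounded_state_def)
    then show "wp B K ?c s1 (?I (Suc j))"
      using j d1 by (intro wp_Cond wp_Assign wp_Skip) (auto simp: store_apply less_Suc_eq not_less)
  next
    fix s' assume "?I n s'"
    then show "s' ''b'' 0 < n \<and> s ''Z'' (s' ''b'' 0) = 0 \<and>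
     (\<forall>j<n. s ''Z'' j = 0 \<longrightarrow> s ''G'' (s' ''b'' 0) \<le> s ''G'' j)" using assms(2,3) by auto
  qed (use assms n K in \<open>auto simp: store_apply store_other\<close>)
qed

lemma wp_lr_update:
  assumes "prepared s" "s ''p'' 0 = p" "s ''b'' 0 = b" "b < n" "p < n"
    and U: "\<And>l. l < n \<Longrightarrow> s ''Z'' l = 0 \<Longrightarrow> s ''U'' l \<le> u l * P ^ p"
  shows "wp B K lr_update s (\<lambda>s'. s' ''q'' = (s ''q'')(p := b) \<and> s' ''Z'' = (s ''Z'')(b := 1) \<and>
     (\<forall>l<n. s' ''U'' l = (if s ''Z'' l = 0 \<and> l \<noteq> b then s ''U'' l * P - s ''U'' b * ker b l else s ''U'' l)))"
  unfolding lr_update_def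
proof (rule wp_boundedI, intro wp_Seq wp_Assign)
  assume B: "bounded_state B s"
  then show "aval (Var ''b'') s < 2 ^ B" by (auto simp: bounded_state_def)
  define s1 where "s1 = store ''q'' (aval (Var ''p'') s) (aval (Var ''b'') s) s"
  define s2 where "s2 = store ''Z'' (aval (Var ''b'') s1) (aval (Const 1) s1) s1"
  have d2: "prepared s2" "s2 ''q'' = (s ''q'')(p := b)" "s2 ''Z'' = (s ''Z'')(b := 1)" "s2 ''U'' = s ''U''"
      "s2 ''b'' 0 = b"
    using assms by (auto simp: s2_def s1_def store_def cong: prepared_cong)
  let ?c = "Cond (Less (Cell ''Z'' (Var ''l'')) (Const 1))
        (Assign ''U'' (Var ''l'') (Sub (Mul (Cell ''U'' (Var ''l'')) (Var ''P''))
           (Mul (Cell ''U'' (Var ''b'')) (Cell ''K'' (At (Var ''b'') (Var ''l''))))))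
        Skip"
  let ?U = "\<lambda>l. if s ''Z'' l = 0 \<and> l \<noteq> b then s ''U'' l * P - s ''U'' b * ker b l else s ''U'' l"
  let ?I = "\<lambda>l s'. \<forall>l'<n. s' ''U'' l' = (if l' < l then ?U l' else s ''U'' l')"
  have "wp B K (For ''l'' ''n'' ?c) s2 (\<lambda>s'. s' ''q'' = (s ''q'')(p := b) \<and>
     s' ''Z'' = (s ''Z'')(b := 1) \<and> (\<forall>l<n. s' ''U'' l = ?U l))"
  proof (rule wp_For[where n = n and I = ?I])
    fix l s3 assume l: "l < n" "s3 ''l'' 0 = l" "?I l s3"
      and fr: "\<And>x. x \<noteq> ''l'' \<Longrightarrow> x \<notin> writes ?c \<Longrightarrow> s3 x = s2 x"
    have d3: "prepared s3" "s3 ''Z'' = (s ''Z'')(b := 1)" "s3 ''b'' 0 = b"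
      using d2 by (simp_all add: fr cong: prepared_cong)
    then have v: "s3 ''K'' (b * n + l) = ker b l" "s3 ''n'' 0 = n" "s3 ''P'' 0 = P"
      using l assms(4) by (auto simp: prepared_def data_def)
    have Ul: "s3 ''U'' l = s ''U'' l" "s3 ''U'' b = s ''U'' b" using l assms(4) by auto
    have bd: "s ''U'' l * P - s ''U'' b * ker b l < 2 ^ B" if "s ''Z'' l = 0"
    proof -
      \<comment> \<open>Residual weights gain one factor P per placed item, hence at most P ^ n
        altogether, and subtraction only lowers them.\<close>
      have "s ''U'' l * P \<le> u l * P ^ p * P" using U[OF l(1) that] by simp
      also have "\<dots> = u l * P ^ Suc p" by (simp add: mult_ac)
      also have "\<dots> \<le> w l * P ^ n"
        using assms(5) P_pos by (intro mult_mono power_increasing) (auto simp: u_def)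
      finally show ?thesis using B_U[OF l(1)] by (meson diff_le_self le_less_trans)
    qed
    show "wp B K ?c s3 (?I (Suc l))"
      using l d3 v bd Ul assms(4)
      by (intro wp_Cond wp_Assign wp_Skip) (auto simp: store_apply less_Suc_eq split: if_splits)
  next
    fix s' assume "?I n s'" and fr: "\<And>x. x \<noteq> ''l'' \<Longrightarrow> x \<notin> writes ?c \<Longrightarrow> s' x = s2 x"
    then show "s' ''q'' = (s ''q'')(p := b) \<and>
     s' ''Z'' = (s ''Z'')(b := 1) \<and> (\<forall>l<n. s' ''U'' l = ?U l)" using d2 by (simp add: fr)
  qed (use d2 K in \<open>auto simp: store_apply prepared_def data_def\<close>)
  then show "wp B K (For ''l'' ''n'' ?c) (store ''Z''
        (aval (Var ''b'') (store ''q'' (aval (Var ''p'') s) (aval (Var ''b'') s) s))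
        (aval (Const 1) (store ''q'' (aval (Var ''p'') s) (aval (Var ''b'') s) s))
        (store ''q'' (aval (Var ''p'') s) (aval (Var ''b'') s) s))
     (\<lambda>s'. s' ''q'' = (s ''q'')(p := b) \<and> s' ''Z'' = (s ''Z'')(b := 1) \<and> (\<forall>l<n. s' ''U'' l = ?U l))"
    unfolding s2_def s1_def .
qed (use small_bounds in auto)

lemma wp_lr:
  assumes "prepared s" "\<And>j. j < n \<Longrightarrow> s ''U'' j = u j" "\<And>j. s ''Z'' j = 0" "(\<Sum>j<n. s ''X'' j) = rounds"
  shows "wp B K lr s (\<lambda>s'. lr_inv n (s ''X'') (s' ''q'') (s' ''U''))"
  unfolding lr_def
proof (rule wp_For[where n = n and I = "\<lambda>p s'. lr_inv p (s ''X'') (s' ''q'') (s' ''U'') \<and>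
    (\<forall>l<n. s' ''Z'' l = 0 \<longleftrightarrow> l \<notin> s' ''q'' ` {..<p})"])
  let ?c = "Seq lr_degrees (Seq lr_best lr_update)"
  let ?I = "\<lambda>p s'. lr_inv p (s ''X'') (s' ''q'') (s' ''U'') \<and>
    (\<forall>l<n. s' ''Z'' l = 0 \<longleftrightarrow> l \<notin> s' ''q'' ` {..<p})"
  fix p s1 assume p: "p < n" "s1 ''p'' 0 = p" "?I p s1"
    and fr: "\<And>x. x \<noteq> ''p'' \<Longrightarrow> x \<notin> writes ?c \<Longrightarrow> s1 x = s x"
  have d1: "prepared s1" "s1 ''X'' = s ''X''"
    using assms(1) by (simp_all add: fr lr_degrees_def lr_best_def lr_update_def cong: prepared_cong)
  define rest where "rest = {..<n} - s1 ''q'' ` {..<p}"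
  have rest: "{l. l < n \<and> s1 ''Z'' l = 0} = rest" using p(3) by (auto simp: rest_def)
  \<comment> \<open>Fewer than n items have been placed, so some item is pending and the search does
    not end with its sentinel.\<close>
  have "card (s1 ''q'' ` {..<p}) < card {..<n}" using card_image_le[of "{..<p}" "s1 ''q''"] p(1) by simp
  then have "rest \<noteq> {}" unfolding rest_def
    by (metis Diff_eq_empty_iff card_mono finite_imageI finite_lessThan not_less)
  then obtain l0 where l0: "l0 < n" "s1 ''Z'' l0 = 0" unfolding rest[symmetric] by auto
  show "wp B K ?c s1 (?I (Suc p))"
  proof (rule wp_Seq_frame[OF wp_lr_degrees])
    fix s2 assume fr: "\<And>x. x \<notin> writes lr_degrees \<Longrightarrow> s2 x = s1 x"
      and G: "\<forall>j<n. s2 ''G'' j = (\<Sum>l\<in>{l. l < n \<and> s1 ''Z'' l = 0}. s1 ''X'' l * ker j l)"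
    have d2: "prepared s2" "s2 ''Z'' = s1 ''Z''" "s2 ''U'' = s1 ''U''" "s2 ''q'' = s1 ''q''" "s2 ''p'' = s1 ''p''"
      using d1 by (simp_all add: fr lr_degrees_def cong: prepared_cong)
    show "wp B K (Seq lr_best lr_update) s2 (?I (Suc p))"
    proof (rule wp_Seq_frame[OF wp_lr_best[OF d2(1) l0(1)]])
      show "s2 ''Z'' l0 = 0" using l0 d2 by simp
      fix s3 assume fr: "\<And>x. x \<notin> writes lr_best \<Longrightarrow> s3 x = s2 x"
        and b: "s3 ''b'' 0 < n \<and> s2 ''Z'' (s3 ''b'' 0) = 0 \<and>
          (\<forall>j<n. s2 ''Z'' j = 0 \<longrightarrow> s2 ''G'' (s3 ''b'' 0) \<le> s2 ''G'' j)"
      have d3: "prepared s3" "s3 ''Z'' = s1 ''Z''" "s3 ''U'' = s1 ''U''" "s3 ''q'' = s1 ''q''" "s3 ''p'' = s1 ''p''"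
        using d2 by (simp_all add: fr lr_best_def cong: prepared_cong)
      let ?b = "s3 ''b'' 0"
      have b': "?b < n" "?b \<notin> s1 ''q'' ` {..<p}" using b p(3) d2(2) by auto
      have min: "(\<Sum>l\<in>rest. s ''X'' l * ker ?b l) \<le> (\<Sum>l\<in>rest. s ''X'' l * ker j l)" if "j \<in> rest" for j
      proof -
        have "j < n" "s2 ''Z'' j = 0" using that unfolding rest[symmetric] d2 by auto
        then show ?thesis using b G unfolding rest d1 by auto
      qed
      show "wp B K lr_update s3 (?I (Suc p))"
      proof (rule wp_mono[OF wp_lr_update[OF d3(1) _ refl b'(1) p(1)]])
        show "s3 ''p'' 0 = p" using d3 p by simp
        show "s3 ''U'' l \<le> u l * P ^ p" if "l < n" "s3 ''Z'' l = 0" for l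
          using p(3) that unfolding d3 by (auto simp: lr_inv_def residual_ok_def)
        fix s' assume s': "s' ''q'' = (s3 ''q'')(p := ?b) \<and> s' ''Z'' = (s3 ''Z'')(?b := 1) \<and>
          (\<forall>l<n. s' ''U'' l = (if s3 ''Z'' l = 0 \<and> l \<noteq> ?b then s3 ''U'' l * P - s3 ''U'' ?b * ker ?b l
             else s3 ''U'' l))"
        have "lr_inv (Suc p) (s ''X'') (s' ''q'') (s' ''U'')"
        proof (rule lr_inv_step[OF _ b'])
          show "lr_inv p (s ''X'') (s1 ''q'') (s1 ''U'')" using p by simp
          show "s' ''U'' l = (if l \<in> s1 ''q'' ` {..<p} \<or> l = ?b then s1 ''U'' l
              else s1 ''U'' l * P - s1 ''U'' ?b * ker ?b l)" if "l < n" for l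
            using s' that p(3) unfolding d3 by auto
        qed (use min s' d3 in \<open>auto simp: rest_def\<close>)
        moreover have "s' ''Z'' l = 0 \<longleftrightarrow> l \<notin> s' ''q'' ` {..<Suc p}" if "l < n" for l
        proof -
          have "s' ''q'' ` {..<Suc p} = insert ?b (s1 ''q'' ` {..<p})"
            using s' d3 by (auto simp: lessThan_Suc)
          then show ?thesis using s' d3 p(3) that by auto
        qed
        ultimately show "?I (Suc p) s'" by blast
      qed
    qed
  qed (use d1 assms(4) in auto)
next
  show "lr_inv 0 (s ''X'') (s ''q'') (s ''U'') \<and> (\<forall>l<n. s ''Z'' l = 0 \<longleftrightarrow> l \<notin> s ''q'' ` {..<0})"
    using assms(2,3) lr_inv_init by simp
qed (use assms K in \<open>simp_all add: store_other prepared_def data_def lr_degrees_def lr_best_def lr_update_def\<close>)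

section \<open>Verification of the greedy phase\<close>

lemma wp_greedy_test:
  assumes "data s" "s ''e'' 0 = j" "j < n"
  shows "wp B K greedy_test s (\<lambda>s'. 0 < s' ''o'' 0 \<longleftrightarrow> (\<forall>i<m. d i j + s ''L'' i \<le> c i))"
  unfolding greedy_test_def
proof (intro wp_Seq wp_Assign)
  let ?c = "Cond (Less (Cap (Var ''i'')) (Add (Cell ''L'' (Var ''i'')) (Dem (Var ''i'') (Var ''e''))))
        (Set ''o'' (Const 0)) Skip"
  let ?s = "store ''o'' (aval (Const 0) s) (aval (Const 1) s) s"
  let ?I = "\<lambda>i s'. 0 < s' ''o'' 0 \<longleftrightarrow> (\<forall>i'<i. d i' j + s ''L'' i' \<le> c i')"
  show "wp B K (For ''i'' ''m'' ?c) ?s (?I m)"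
  proof (rule wp_For[where n = m and I = ?I])
    fix i s1 assume i: "i < m" "s1 ''i'' 0 = i" "?I i s1"
      and fr: "\<And>x. x \<noteq> ''i'' \<Longrightarrow> x \<notin> writes ?c \<Longrightarrow> s1 x = ?s x"
    have "data s1" "s1 ''e'' 0 = j" "s1 ''L'' = s ''L''"
      using assms by (simp_all add: fr store_other cong: data_cong)
    then have v: "s1 ''A'' (n + m + (i * n + j)) = d i j" "s1 ''A'' (n + i) = c i" "s1 ''n'' 0 = n"
       "s1 ''m'' 0 = m" "s1 ''e'' 0 = j" "s1 ''L'' = s ''L''"
      using i assms(3) by (auto simp: data_def)
    show "wp B K ?c s1 (?I (Suc i))"
      using i v small_bounds
      by (intro wp_Cond wp_Assign wp_Skip) (auto simp: store_apply less_Suc_eq add.commute)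
  qed (use assms K in \<open>auto simp: store_apply store_other data_def\<close>)
qed (use small_bounds in auto)

lemma wp_greedy_add:
  assumes "data s" "s ''e'' 0 = j" "j < n" "\<And>i. i < m \<Longrightarrow> d i j + s ''L'' i \<le> c i"
  shows "wp B K greedy_add s (\<lambda>s'. s' ''out'' = (s ''out'')(j := 1) \<and>
     (\<forall>i<m. s' ''L'' i = d i j + s ''L'' i))"
  unfolding greedy_add_def
proof (intro wp_Seq wp_Assign)
  let ?c = "Assign ''L'' (Var ''i'') (Add (Cell ''L'' (Var ''i'')) (Dem (Var ''i'') (Var ''e'')))"
  let ?s = "store ''out'' (aval (Var ''e'') s) (aval (Const 1) s) s"
  let ?I = "\<lambda>i s'. \<forall>i'<m. s' ''L'' i' = (if i' < i then d i' j else 0) + s ''L'' i'"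
  show "wp B K (For ''i'' ''m'' ?c) ?s (\<lambda>s'. s' ''out'' = (s ''out'')(j := 1) \<and>
     (\<forall>i<m. s' ''L'' i = d i j + s ''L'' i))"
  proof (rule wp_For[where n = m and I = ?I])
    fix i s1 assume i: "i < m" "s1 ''i'' 0 = i" "?I i s1" "bounded_state B s1"
      and fr: "\<And>x. x \<noteq> ''i'' \<Longrightarrow> x \<notin> writes ?c \<Longrightarrow> s1 x = ?s x"
    have "data s1" "s1 ''e'' 0 = j"
      using assms by (simp_all add: fr store_other cong: data_cong)
    then have v: "s1 ''A'' (n + m + (i * n + j)) = d i j" "s1 ''A'' (n + i) = c i" "s1 ''n'' 0 = n"
       "s1 ''m'' 0 = m" "s1 ''e'' 0 = j"
      using i assms(3) by (auto simp: data_def)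
    \<comment> \<open>An item is added only after it passed the test, so loads stay below
      capacities, and these are already stored in cells.\<close>
    have "c i < 2 ^ B" using v(2) i(4) by (metis bounded_state_def)
    then have "d i j + s ''L'' i < 2 ^ B" using assms(4)[OF i(1)] by simp
    then show "wp B K ?c s1 (?I (Suc i))"
      using i v by (intro wp_Assign) (auto simp: store_apply less_Suc_eq add.commute)
  next
    fix s' assume "?I m s'" and fr: "\<And>x. x \<noteq> ''i'' \<Longrightarrow> x \<notin> writes ?c \<Longrightarrow> s' x = ?s x"
    then show "s' ''out'' = (s ''out'')(j := 1) \<and> (\<forall>i<m. s' ''L'' i = d i j + s ''L'' i)"
      using assms(2) by (auto simp: fr store_def)
  qed (use assms K in \<open>auto simp: store_apply store_other data_def\<close>)
qed (use small_bounds in auto)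

definition chosen :: "state \<Rightarrow> nat set" where
  "chosen s = {j. j < n \<and> s ''out'' j = 1}"

lemma wp_greedy:
  assumes "data s" "inj_on (s ''q'') {..<n}" "s ''q'' ` {..<n} \<subseteq> {..<n}"
    "\<And>j. s ''out'' j = 0" "\<And>i. s ''L'' i = 0"
  shows "wp B K greedy s (\<lambda>s'. greedy_inv n (s ''q'') (s ''U'') (chosen s') \<and> (\<forall>j. s' ''out'' j \<in> {0, 1}))"
  unfolding greedy_def
proof (rule wp_For[where n = n and I = "\<lambda>p s'. greedy_inv p (s ''q'') (s ''U'') (chosen s') \<and>
    (\<forall>j. s' ''out'' j \<in> {0, 1}) \<and> (\<forall>i<m. s' ''L'' i = (\<Sum>l\<in>chosen s'. d i l))"])
  let ?I = "\<lambda>p s'. greedy_inv p (s ''q'') (s ''U'') (chosen s') \<and>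
    (\<forall>j. s' ''out'' j \<in> {0, 1}) \<and> (\<forall>i<m. s' ''L'' i = (\<Sum>l\<in>chosen s'. d i l))"
  let ?d = "Seq greedy_test (Cond (Less (Const 0) (Var ''o'')) greedy_add Skip)"
  let ?c = "Seq (Set ''e'' (Cell ''q'' (Sub (Var ''n'') (Add (Var ''p'') (Const 1)))))
        (Cond (Less (Const 0) (Cell ''U'' (Var ''e''))) ?d Skip)"
  fix p s1 assume p: "p < n" "s1 ''p'' 0 = p" "?I p s1" and bd: "bounded_state B s1"
    and fr: "\<And>x. x \<noteq> ''p'' \<Longrightarrow> x \<notin> writes ?c \<Longrightarrow> s1 x = s x"
  have d1: "data s1" "s1 ''q'' = s ''q''" "s1 ''U'' = s ''U''"
    using assms(1) by (simp_all add: fr greedy_test_def greedy_add_def cong: data_cong)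
  have n: "s1 ''n'' 0 = n" using d1 by (simp add: data_def)
  let ?j = "s ''q'' (n - Suc p)"
  have "n - Suc p \<in> {..<n}" using p by auto
  then have j: "?j < n" using assms(3) by blast
  have inv: "greedy_inv p (s ''q'') (s ''U'') (chosen s1)" using p by blast
  note step = greedy_inv_step[OF inv assms(2,3) p(1) refl refl]
  define s2 where "s2 = store ''e'' 0 ?j s1"
  have d2: "data s2" "s2 ''U'' = s ''U''" "s2 ''e'' 0 = ?j" "s2 ''out'' = s1 ''out''" "s2 ''L'' = s1 ''L''"
    using d1 by (simp_all add: s2_def store_other store_apply cong: data_cong)
  have fin: "finite (chosen s1)" by (simp add: chosen_def)
  \<comment> \<open>By injectivity of q the item was not visited before, so the load sums gain
    exactly one new term.\<close>
  have jF: "?j \<notin> chosen s1"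
  proof -
    have "?j \<notin> s ''q'' ` {n - p..<n}" using p by (subst inj_on_image_mem_iff[OF assms(2)]) auto
    then show ?thesis using inv by (auto simp: greedy_inv_def)
  qed
  have "wp B K (Cond (Less (Const 0) (Cell ''U'' (Var ''e''))) ?d Skip) s2 (?I (Suc p))"
  proof (rule wp_Cond)
    assume "\<not> bval (Less (Const 0) (Cell ''U'' (Var ''e''))) s2"
    then show "wp B K Skip s2 (?I (Suc p))"
      using step p(3) d2 by (intro wp_Skip) (auto simp: chosen_def)
  next
    assume "bval (Less (Const 0) (Cell ''U'' (Var ''e''))) s2"
    then have Uj: "0 < s ''U'' ?j" using d2 by simp
    show "wp B K ?d s2 (?I (Suc p))"
    proof (rule wp_Seq_frame[OF wp_greedy_test[OF d2(1,3) j]])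
      fix s3 assume fr: "\<And>x. x \<notin> writes greedy_test \<Longrightarrow> s3 x = s2 x"
        and o: "0 < s3 ''o'' 0 \<longleftrightarrow> (\<forall>i<m. d i ?j + s2 ''L'' i \<le> c i)"
      have d3: "data s3" "s3 ''e'' 0 = ?j" "s3 ''out'' = s1 ''out''" "s3 ''L'' = s1 ''L''"
        using d2 by (simp_all add: fr greedy_test_def cong: data_cong)
      have o': "0 < s3 ''o'' 0 \<longleftrightarrow> (\<forall>i<m. d i ?j + (\<Sum>l\<in>chosen s1. d i l) \<le> c i)"
        using o p(3) d2 by auto
      show "wp B K (Cond (Less (Const 0) (Var ''o'')) greedy_add Skip) s3 (?I (Suc p))"
      proof (rule wp_Cond)
        assume "\<not> bval (Less (Const 0) (Var ''o'')) s3"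
        then have no: "(\<forall>i<m. d i ?j + (\<Sum>l\<in>chosen s1. d i l) \<le> c i) = False" using o' by simp
        have "chosen s3 = chosen s1" using d3 by (simp add: chosen_def)
        moreover have "greedy_inv (Suc p) (s ''q'') (s ''U'') (chosen s1)"
          using step by (simp only: no simp_thms if_False)
        ultimately show "wp B K Skip s3 (?I (Suc p))"
          using p(3) d3 by (intro wp_Skip) simp
      next
        assume "bval (Less (Const 0) (Var ''o'')) s3"
        then have yes: "\<forall>i<m. d i ?j + (\<Sum>l\<in>chosen s1. d i l) \<le> c i" using o' by simp
        show "wp B K greedy_add s3 (?I (Suc p))"
        proof (rule wp_mono[OF wp_greedy_add[OF d3(1,2) j]])
          show "d i ?j + s3 ''L'' i \<le> c i" if "i < m" for i using yes that p(3) d3 by auto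
          fix s' assume s': "s' ''out'' = (s3 ''out'')(?j := 1) \<and> (\<forall>i<m. s' ''L'' i = d i ?j + s3 ''L'' i)"
          then have ch: "chosen s' = insert ?j (chosen s1)" using j d3 by (auto simp: chosen_def)
          have "greedy_inv (Suc p) (s ''q'') (s ''U'') (chosen s')"
            using step yes Uj unfolding ch by simp
          moreover have "\<forall>i<m. s' ''L'' i = (\<Sum>l\<in>chosen s'. d i l)"
            using s' d3 p(3) fin jF unfolding ch by auto
          moreover have "\<forall>j. s' ''out'' j \<in> {0, 1}" using s' d3 p(3) by auto
          ultimately show "?I (Suc p) s'" by blast
        qed
      qed
    qed
  qed
  moreover have "?j < 2 ^ B" using bd d1(2) by (metis bounded_state_def)
  ultimately show "wp B K ?c s1 (?I (Suc p))"
    using p n d1 by (intro wp_Seq wp_Assign) (auto simp: s2_def)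
next
  show "greedy_inv 0 (s ''q'') (s ''U'') (chosen s) \<and> (\<forall>j. s ''out'' j \<in> {0, 1}) \<and>
     (\<forall>i<m. s ''L'' i = (\<Sum>l\<in>chosen s. d i l))"
    using assms(4,5) greedy_inv_init by (simp add: chosen_def)
qed (use assms K in \<open>auto simp: store_other data_def greedy_test_def greedy_add_def chosen_def\<close>)

text \<open>The listed arrays are read or accumulated before all their cells are written, so they
  have to start at zero.\<close>

lemma wp_core:
  assumes "data s"
    "\<And>x i. x \<in> {''E'', ''K'', ''X'', ''Z'', ''out'', ''L''} \<Longrightarrow> s x i = 0"
  shows "wp B K core s (\<lambda>s'. (\<exists>X Y q U. mw_inv rounds X Y \<and> lr_inv n X q U \<and>
     greedy_inv n q U (chosen s')) \<and> (\<forall>j. s' ''out'' j \<in> {0, 1}))"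
  unfolding core_def
proof (rule wp_Seq_frame[OF wp_compute_P[OF assms(1)]])
  fix s1 assume fr: "\<And>x. x \<notin> writes compute_P \<Longrightarrow> s1 x = s x" and P1: "s1 ''P'' 0 = P"
  have z1: "s1 x = (\<lambda>_. 0)" if "x \<in> {''E'', ''K'', ''X'', ''Z'', ''out'', ''L''}" for x
    using assms(2)[OF that] that by (auto simp: fr compute_P_def)
  have d1: "data s1" using assms(1) by (simp add: fr compute_P_def cong: data_cong)
  show "wp B K (Seq compute_U (Seq compute_phi (Seq compute_item_rows
     (Seq compute_ker (Seq mw (Seq lr greedy)))))) s1 (\<lambda>s'. (\<exists>X Y q U. mw_inv rounds X Y \<and> lr_inv n X q U \<and>
     greedy_inv n q U (chosen s')) \<and> (\<forall>j. s' ''out'' j \<in> {0, 1}))"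
  proof (rule wp_Seq_frame[OF wp_compute_U[OF d1]])
    fix s2 assume fr: "\<And>x. x \<notin> writes compute_U \<Longrightarrow> s2 x = s1 x" and U2: "\<forall>j<n. s2 ''U'' j = u j"
    have z2: "s2 x = (\<lambda>_. 0)" if "x \<in> {''E'', ''K'', ''X'', ''Z'', ''out'', ''L''}" for x
      using z1[OF that] that by (auto simp: fr compute_U_def)
    have d2: "data s2" "s2 ''P'' 0 = P" using d1 P1 by (simp_all add: fr compute_U_def cong: data_cong)
    show "wp B K (Seq compute_phi (Seq compute_item_rows
       (Seq compute_ker (Seq mw (Seq lr greedy))))) s2 (\<lambda>s'. (\<exists>X Y q U. mw_inv rounds X Y \<and> lr_inv n X q U \<and>
       greedy_inv n q U (chosen s')) \<and> (\<forall>j. s' ''out'' j \<in> {0, 1}))"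
    proof (rule wp_Seq_frame[OF wp_compute_phi[OF d2]])
      show "s2 ''E'' i = 0" for i using z2 by simp
      fix s3 assume fr: "\<And>x. x \<notin> writes compute_phi \<Longrightarrow> s3 x = s2 x"
        and E3: "\<forall>i<m + n. \<forall>j<n. s3 ''E'' (i * n + j) = (if i < m then phi i j else 0)"
      have z3: "s3 x = (\<lambda>_. 0)" if "x \<in> {''K'', ''X'', ''Z'', ''out'', ''L''}" for x
        using z2[of x] that by (auto simp: fr compute_phi_def)
      have d3: "data s3" "s3 ''P'' 0 = P" "s3 ''U'' = s2 ''U''"
        using d2 by (simp_all add: fr compute_phi_def cong: data_cong)
      show "wp B K (Seq compute_item_rows (Seq compute_ker (Seq mw (Seq lr greedy)))) s3
         (\<lambda>s'. (\<exists>X Y q U. mw_inv rounds X Y \<and> lr_inv n X q U \<and>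
         greedy_inv n q U (chosen s')) \<and> (\<forall>j. s' ''out'' j \<in> {0, 1}))"
      proof (rule wp_Seq_frame[OF wp_compute_item_rows[OF d3(1,2) E3]])
        fix s4 assume fr: "\<And>x. x \<notin> writes compute_item_rows \<Longrightarrow> s4 x = s3 x"
          and E4: "\<forall>i<m + n. \<forall>j<n. s4 ''E'' (i * n + j) = E i j"
        have z4: "s4 x = (\<lambda>_. 0)" if "x \<in> {''K'', ''X'', ''Z'', ''out'', ''L''}" for x
          using z3[of x] that by (auto simp: fr compute_item_rows_def)
        have d4: "data s4" "s4 ''P'' 0 = P" "s4 ''U'' = s2 ''U''"
          using d3 by (simp_all add: fr compute_item_rows_def cong: data_cong)
        show "wp B K (Seq compute_ker (Seq mw (Seq lr greedy))) s4
           (\<lambda>s'. (\<exists>X Y q U. mw_inv rounds X Y \<and> lr_inv n X q U \<and>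
           greedy_inv n q U (chosen s')) \<and> (\<forall>j. s' ''out'' j \<in> {0, 1}))"
        proof (rule wp_Seq_frame[OF wp_compute_ker[OF d4(1,2) E4]])
          show "s4 ''K'' i = 0" for i using z4 by simp
          fix s5 assume fr: "\<And>x. x \<notin> writes compute_ker \<Longrightarrow> s5 x = s4 x"
            and K5: "\<forall>j<n. \<forall>l<n. s5 ''K'' (j * n + l) = ker j l"
          have z5: "s5 x = (\<lambda>_. 0)" if "x \<in> {''X'', ''Z'', ''out'', ''L''}" for x
            using z4[of x] that by (auto simp: fr compute_ker_def)
          have "data s5" "s5 ''P'' 0 = P" "s5 ''E'' = s4 ''E''"
            using d4 by (simp_all add: fr compute_ker_def cong: data_cong)
          then have d5: "prepared s5" using E4 K5 by (simp add: prepared_def)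
          have U5: "s5 ''U'' j = u j" if "j < n" for j using d4 U2 that by (simp add: fr compute_ker_def)
          show "wp B K (Seq mw (Seq lr greedy)) s5
             (\<lambda>s'. (\<exists>X Y q U. mw_inv rounds X Y \<and> lr_inv n X q U \<and>
             greedy_inv n q U (chosen s')) \<and> (\<forall>j. s' ''out'' j \<in> {0, 1}))"
          proof (rule wp_Seq_frame[OF wp_mw[OF d5 U5]])
            show "s5 ''X'' j = 0" for j using z5 by simp
            fix s6 assume fr: "\<And>x. x \<notin> writes mw \<Longrightarrow> s6 x = s5 x"
              and "\<exists>Y. mw_inv rounds (s6 ''X'') Y"
            then obtain Y where Y: "mw_inv rounds (s6 ''X'') Y" by blast
            note mw_defs = mw_def mw_round_def mw_costs_def mw_best_def mw_update_def
            have z6: "s6 x = (\<lambda>_. 0)" if "x \<in> {''Z'', ''out'', ''L''}" for x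
              using z5[of x] that by (auto simp: fr mw_defs)
            have d6: "prepared s6" using d5 by (simp add: fr mw_defs cong: prepared_cong)
            have U6: "s6 ''U'' j = u j" if "j < n" for j using U5 that by (simp add: fr mw_defs)
            show "wp B K (Seq lr greedy) s6
               (\<lambda>s'. (\<exists>X Y q U. mw_inv rounds X Y \<and> lr_inv n X q U \<and>
               greedy_inv n q U (chosen s')) \<and> (\<forall>j. s' ''out'' j \<in> {0, 1}))"
            proof (rule wp_Seq_frame[OF wp_lr[OF d6 U6]])
              show "s6 ''Z'' j = 0" for j using z6 by simp
              show "(\<Sum>j<n. s6 ''X'' j) = rounds" using Y by (simp add: mw_inv_def)
              fix s7 assume fr: "\<And>x. x \<notin> writes lr \<Longrightarrow> s7 x = s6 x"
                and lr: "lr_inv n (s6 ''X'') (s7 ''q'') (s7 ''U'')"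
              note lr_defs = lr_def lr_degrees_def lr_best_def lr_update_def
              have z7: "s7 x = (\<lambda>_. 0)" if "x \<in> {''out'', ''L''}" for x
                using z6[of x] that by (auto simp: fr lr_defs)
              have "prepared s7" using d6 by (simp add: fr lr_defs cong: prepared_cong)
              then have d7: "data s7" by (simp add: prepared_def)
              show "wp B K greedy s7
                 (\<lambda>s'. (\<exists>X Y q U. mw_inv rounds X Y \<and> lr_inv n X q U \<and>
                 greedy_inv n q U (chosen s')) \<and> (\<forall>j. s' ''out'' j \<in> {0, 1}))"
                using lr z7 Y by (intro wp_mono[OF wp_greedy[OF d7]]) (auto simp: lr_inv_def)
            qed
          qed
        qed
      qed
    qed
  qed
qed

end

section \<open>Instances with rational data\<close>

text \<open>The data is multiplied by the product D of all denominators, which affects neither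
  feasibility nor ratios of weights. Behind the two dimensions, number t occupies the input cells 2t
  + 2 and 2t + 3.\<close>

definition load :: com where
  "load = Seq (Set ''n'' (Cell ''in'' (Const 0))) (Seq (Set ''m'' (Cell ''in'' (Const 1)))
     (Seq (Set ''M'' (Add (Var ''m'') (Var ''n'')))
     (Seq (Set ''T'' (Add (Var ''M'') (Mul (Var ''m'') (Var ''n'')))) (Seq (Set ''D'' (Const 1))
     (Seq (For ''t'' ''T'' (Set ''D''
        (Mul (Var ''D'') (Cell ''in'' (Add (Mul (Const 2) (Var ''t'')) (Const 3))))))
     (For ''t'' ''T'' (Assign ''A'' (Var ''t'')
        (Mul (Cell ''in'' (Add (Mul (Const 2) (Var ''t'')) (Const 2)))
           (Div (Var ''D'') (Cell ''in'' (Add (Mul (Const 2) (Var ''t'')) (Const 3))))))))))))"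

lemma wp_Seq_Assign:
  "aval e s < 2 ^ B \<Longrightarrow> wp B K c (store x (aval a s) (aval e s) s) Q \<Longrightarrow> wp B K (Seq (Assign x a e) c) s Q"
  by (intro wp_Seq wp_Assign)

lemma wp_load:
  fixes n m B K :: nat and s :: state
  defines "T \<equiv> m + n + m * n"
  defines "D \<equiv> (\<Prod>t<T. s ''in'' (2 * t + 3))"
  assumes nm: "s ''in'' 0 = n" "s ''in'' 1 = m" and T: "T \<le> K" "T < 2 ^ B"
    and D: "D < 2 ^ B" "0 < D" and A: "\<And>t. t < T \<Longrightarrow> s ''in'' (2 * t + 2) * (D div s ''in'' (2 * t + 3)) < 2 ^ B"
  shows "wp B K load s (\<lambda>s'. s' ''n'' 0 = n \<and> s' ''m'' 0 = m \<and> s' ''M'' 0 = m + n \<and>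
     (\<forall>t<T. s' ''A'' t = s ''in'' (2 * t + 2) * (D div s ''in'' (2 * t + 3))))"
proof -
  let ?c = "Set ''D'' (Mul (Var ''D'') (Cell ''in'' (Add (Mul (Const 2) (Var ''t'')) (Const 3))))"
  let ?d = "Assign ''A'' (Var ''t'')
        (Mul (Cell ''in'' (Add (Mul (Const 2) (Var ''t'')) (Const 2)))
           (Div (Var ''D'') (Cell ''in'' (Add (Mul (Const 2) (Var ''t'')) (Const 3)))))"
  let ?Q = "\<lambda>s'. s' ''n'' 0 = n \<and> s' ''m'' 0 = m \<and> s' ''M'' 0 = m + n \<and>
     (\<forall>t<T. s' ''A'' t = s ''in'' (2 * t + 2) * (D div s ''in'' (2 * t + 3)))"
  have nmT: "n < 2 ^ B" "m < 2 ^ B" "m + n < 2 ^ B" "m + n + m * n < 2 ^ B"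
    using T(2) by (auto simp: T_def)
  have one: "1 < (2::nat) ^ B" using D by (cases B) auto
  define s1 where "s1 = store ''D'' 0 1 (store ''T'' 0 T (store ''M'' 0 (m + n) (store ''m'' 0 m (store ''n'' 0 n s))))"
  have "wp B K (Seq (For ''t'' ''T'' ?c) (For ''t'' ''T'' ?d)) s1 ?Q"
  proof (rule wp_Seq_frame)
    show "wp B K (For ''t'' ''T'' ?c) s1 (\<lambda>s'. s' ''D'' 0 = D)"
    proof (rule wp_For[where n = T and I = "\<lambda>t s'. s' ''D'' 0 = (\<Prod>t'<t. s ''in'' (2 * t' + 3))"])
      fix t s2 assume t: "t < T" "s2 ''t'' 0 = t" "s2 ''D'' 0 = (\<Prod>t'<t. s ''in'' (2 * t' + 3))"
        and fr: "\<And>x. x \<noteq> ''t'' \<Longrightarrow> x \<notin> writes ?c \<Longrightarrow> s2 x = s1 x"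
      have v: "s2 ''in'' = s ''in''" by (simp add: fr s1_def store_other)
      have "(\<Prod>t'<Suc t. s ''in'' (2 * t' + 3)) \<le> D"
        using t D(2) unfolding D_def by (intro dvd_imp_le prod_dvd_prod_subset) auto
      then have "(\<Prod>t'<Suc t. s ''in'' (2 * t' + 3)) < 2 ^ B" using D(1) by simp
      then show "wp B K ?c s2 (\<lambda>s'. s' ''D'' 0 = (\<Prod>t'<Suc t. s ''in'' (2 * t' + 3)))"
        using t v by (intro wp_Assign) (auto simp: store_apply)
    qed (use T in \<open>auto simp: s1_def store_apply store_other D_def\<close>)
    fix s2 assume fr: "\<And>x. x \<notin> writes (For ''t'' ''T'' ?c) \<Longrightarrow> s2 x = s1 x" and D2: "s2 ''D'' 0 = D"
    have v2: "s2 ''in'' = s ''in''" "s2 ''T'' 0 = T" "s2 ''n'' 0 = n" "s2 ''m'' 0 = m" "s2 ''M'' 0 = m + n"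
      by (simp_all add: fr s1_def store_other store_apply)
    show "wp B K (For ''t'' ''T'' ?d) s2 ?Q"
    proof (rule wp_For[where n = T and I = "\<lambda>t s'. \<forall>t'<t. s' ''A'' t' =
         s ''in'' (2 * t' + 2) * (D div s ''in'' (2 * t' + 3))"])
      fix t s3 assume t: "t < T" "s3 ''t'' 0 = t"
          "\<forall>t'<t. s3 ''A'' t' = s ''in'' (2 * t' + 2) * (D div s ''in'' (2 * t' + 3))"
        and fr: "\<And>x. x \<noteq> ''t'' \<Longrightarrow> x \<notin> writes ?d \<Longrightarrow> s3 x = s2 x"
      have v: "s3 ''in'' = s ''in''" "s3 ''D'' 0 = D" using v2 D2 by (simp_all add: fr)
      show "wp B K ?d s3 (\<lambda>s'. \<forall>t'<Suc t. s' ''A'' t' = s ''in'' (2 * t' + 2) * (D div s ''in'' (2 * t' + 3)))"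
        using t v A[OF t(1)] by (intro wp_Assign) (auto simp: store_apply less_Suc_eq)
    next
      fix s' assume fr: "\<And>x. x \<noteq> ''t'' \<Longrightarrow> x \<notin> writes ?d \<Longrightarrow> s' x = s2 x"
        and "\<forall>t'<T. s' ''A'' t' = s ''in'' (2 * t' + 2) * (D div s ''in'' (2 * t' + 3))"
      then show "?Q s'" using v2 by (simp add: fr)
    qed (use v2 T in \<open>auto simp: store_other\<close>)
  qed
  then show ?thesis unfolding load_def using nm nmT one
    by (intro wp_Seq_Assign) (simp_all add: s1_def store_apply T_def)
qed

definition algorithm :: com where
  "algorithm = Seq load core"

section \<open>Layout of the encoded input\<close>

lemma length_encode_number [simp]: "length (encode_number r) = 2"
  by (simp add: encode_number_def split: prod.split)

lemma encode_number_rational: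
  assumes "r \<in> \<rat>" "0 \<le> r"
  shows "0 < encode_number r ! 1" "r = real (encode_number r ! 0) / real (encode_number r ! 1)"
proof -
  obtain x where x: "r = real_of_rat x" using assms(1) by (auto elim: Rats_cases)
  obtain a b where ab: "quotient_of x = (a, b)" by (cases "quotient_of x")
  have "inv real_of_rat r = x" unfolding x by (intro inv_f_f injI) simp
  then have e: "encode_number r = [nat a, nat b]" by (simp add: encode_number_def ab)
  have b: "0 < b" using ab by (rule quotient_of_denom_pos)
  have "x = of_int a / of_int b" using ab by (rule quotient_of_div)
  then have r: "r = of_int a / of_int b" unfolding x by (simp add: of_rat_divide)
  \<comment> \<open>Nonnegativity ensures that \<open>nat\<close> in the encoding does not lose the
    numerator.\<close>
  then have "0 \<le> a" using assms(2) b by (simp add: zero_le_divide_iff)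
  then show "0 < encode_number r ! 1" "r = real (encode_number r ! 0) / real (encode_number r ! 1)"
    unfolding e using b r by simp_all
qed

lemma nth_concat_encode:
  "t < length rs \<Longrightarrow> e < 2 \<Longrightarrow> concat (map encode_number rs) ! (2 * t + e) = encode_number (rs ! t) ! e"
proof (induction rs arbitrary: t)
  case (Cons r rs)
  then show ?case by (cases t) (auto simp: nth_append)
qed simp

lemma length_concat_encode: "length (concat (map encode_number rs)) = 2 * length rs"
  by (induction rs) auto

lemma length_concat_rows: "length (concat (map (\<lambda>i. map (f i) [0..<n]) [0..<m])) = m * n"
  by (induction m) auto

lemma nth_concat_rows:
  assumes "i < m" "j < n"
  shows "concat (map (\<lambda>i. map (f i) [0..<n]) [0..<m]) ! (i * n + j) = f i j"
  using assms(1)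
proof (induction m)
  case (Suc m)
  show ?case
  proof (cases "i = m")
    case True
    then show ?thesis using assms(2) by (simp add: nth_append length_concat_rows)
  next
    case False
    then have "i < m" using Suc.prems by simp
    then have "i * n + j < m * n" using assms(2)
      by (metis add.commute add_less_cancel_right mult_Suc mult_le_mono1 order_less_le_trans Suc_leI)
    then show ?thesis using Suc.IH[OF \<open>i < m\<close>] by (simp add: nth_append length_concat_rows)
  qed
qed simp

definition numbers :: "pip \<Rightarrow> real list" where
  "numbers I = map (weight I) [0..<items I] @ map (capacity I) [0..<rows I] @
     concat (map (\<lambda>i. map (demand I i) [0..<items I]) [0..<rows I])"

lemma length_numbers: "length (numbers I) = rows I + items I + rows I * items I"
  by (simp add: numbers_def length_concat_rows del: length_concat)

lemma nth_numbers:
  "j < items I \<Longrightarrow> numbers I ! j = weight I j"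
  "i < rows I \<Longrightarrow> numbers I ! (items I + i) = capacity I i"
  "i < rows I \<Longrightarrow> j < items I \<Longrightarrow> numbers I ! (items I + rows I + (i * items I + j)) = demand I i j"
  by (simp_all add: numbers_def nth_append nth_concat_rows add.assoc)

lemma numbers_rational:
  assumes "k_CS_PIP k I" "rational_data I" "r \<in> set (numbers I)"
  shows "r \<in> \<rat>" "0 \<le> r"
  using assms by (auto simp: numbers_def k_CS_PIP_def rational_data_def)

lemma encode_eq: "encode I = items I # rows I # concat (map encode_number (numbers I))"
  by (simp add: encode_def numbers_def)

lemma nth_encode:
  assumes "t < length (numbers I)"
  shows "encode I ! (2 * t + 2) = encode_number (numbers I ! t) ! 0"
    "encode I ! (2 * t + 3) = encode_number (numbers I ! t) ! 1"
  using nth_concat_encode[OF assms, of 0] nth_concat_encode[OF assms, of 1]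
  by (simp_all add: encode_eq numeral_3_eq_3)

lemma length_encode: "length (encode I) = 2 + 2 * length (numbers I)"
  using length_concat_encode[of "numbers I"] by (simp add: encode_eq)

section \<open>Bit lengths of the scaled data\<close>

lemma length_le_input_size: "length xs \<le> input_size xs"
proof (induction xs)
  case (Cons x xs)
  have "1 \<le> bit_length x" by (simp add: bit_length_def)
  then show ?case using Cons by (simp add: input_size_def)
qed (simp add: input_size_def)

lemma nth_less_input_size: "i < length xs \<Longrightarrow> xs ! i < 2 ^ input_size xs"
proof -
  assume "i < length xs"
  then have "bit_length (xs ! i) \<le> input_size xs"
    unfolding input_size_def by (intro member_le_sum_list) auto
  then have "(2::nat) ^ bit_length (xs ! i) \<le> 2 ^ input_size xs" by (intro power_increasing) auto
  then show ?thesis using less_power_bit_length[of "xs ! i"] by linarith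
qed

text \<open>Bit lengths bound logarithms and therefore add up under products. \<open>max 1\<close>
  keeps zero entries from annihilating the product.\<close>

lemma prod_list_le_input_size: "prod_list (map (max 1) xs) \<le> 2 ^ input_size xs"
proof (induction xs)
  case (Cons x xs)
  have "max 1 x \<le> 2 ^ bit_length x" using less_power_bit_length[of x] by (simp add: Suc_leI)
  then have "max 1 x * prod_list (map (max 1) xs) \<le> 2 ^ bit_length x * 2 ^ input_size xs"
    using Cons by (intro mult_mono) auto
  then show ?case by (simp add: input_size_def power_add)
qed (simp add: input_size_def)

text \<open>The denominators are some of the input entries, so their product divides the product
  over all entries once zeros are replaced by 1.\<close>

lemma denominators_le:
  assumes "k_CS_PIP k I" "rational_data I"
  shows "(\<Prod>t<length (numbers I). encode I ! (2 * t + 3)) \<le> 2 ^ input_size (encode I)"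
proof -
  let ?xs = "encode I" and ?T = "length (numbers I)"
  have pos: "0 < ?xs ! (2 * t + 3)" if "t < ?T" for t
    using numbers_rational[OF assms nth_mem[OF that]] nth_encode[OF that] encode_number_rational by simp
  have "(\<Prod>t<?T. ?xs ! (2 * t + 3)) = (\<Prod>t<?T. max 1 (?xs ! (2 * t + 3)))"
    using pos by (intro prod.cong) (auto simp: max_def Suc_le_eq)
  also have "\<dots> = (\<Prod>i\<in>(\<lambda>t. 2 * t + 3) ` {..<?T}. max 1 (?xs ! i))"
    by (subst prod.reindex) (auto simp: inj_on_def)
  also have "\<dots> \<le> (\<Prod>i<length ?xs. max 1 (?xs ! i))"
    by (intro dvd_imp_le prod_dvd_prod_subset prod_pos) (auto simp: length_encode)
  also have "\<dots> = prod_list (map (max 1) ?xs)"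
    by (simp add: prod.list_conv_set_nth atLeast0LessThan)
  also have "\<dots> \<le> 2 ^ input_size ?xs" by (rule prod_list_le_input_size)
  finally show ?thesis .
qed

text \<open>With 2 L^2 + 2 bits for 4P, the product term covers prices and costs; 34 L^2 covers
  kernel degrees (32 L^2 for the rounds, 2 L^2 for P), 2 L^3 covers P ^ n, and the linear term
  covers scaled weights and the dimensions.\<close>

definition bit_bound :: "nat \<Rightarrow> nat" where
  "bit_bound L = 4 * L + (2 * L ^ 2 + 2) * (32 * L ^ 2 + 1) + 34 * L ^ 2 + 2 * L ^ 3 + 2"

text \<open>The quadratic term bounds the number of rounds, the linear one all loops over parts of
  the input.\<close>

definition loop_bound :: "nat \<Rightarrow> nat" where
  "loop_bound L = 32 * L ^ 2 + L"

lemma less_two_power: "a \<le> b \<Longrightarrow> a < 2 ^ (b::nat)"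
  by (rule le_less_trans[OF _ less_exp])

lemma power_two_less: "(a::nat) < 2 ^ e \<Longrightarrow> e \<le> e' \<Longrightarrow> a < 2 ^ e'"
  by (meson less_le_trans one_le_numeral power_increasing)

lemma mult_less_power_two:
  fixes x y :: nat
  shows "x < 2 ^ a \<Longrightarrow> y \<le> 2 ^ b \<Longrightarrow> x * y < 2 ^ (a + b)"
proof -
  assume *: "x < 2 ^ a" "y \<le> 2 ^ b"
  have "x * y \<le> x * 2 ^ b" using * by simp
  also have "\<dots> < 2 ^ a * 2 ^ b" using * by simp
  finally show ?thesis by (simp add: power_add)
qed

lemma bounded_packingI:
  fixes n m L :: nat
  assumes L: "m + n \<le> L" and w: "\<And>j. j < n \<Longrightarrow> w j < 2 ^ (2 * L)" and c: "\<And>i. i < m \<Longrightarrow> c i < 2 ^ (2 * L)"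
  shows "bounded_packing n m w c (bit_bound L) (loop_bound L)"
proof -
  interpret integer_packing n m w c d for d .
  define L2 e r where "L2 = L ^ 2" and "e = 2 * L2 + 2" and "r = 32 * n * (m + n)"
  have bb: "bit_bound L = 4 * L + e * (32 * L2 + 1) + 34 * L2 + 2 * L ^ 3 + 2"
    by (simp add: bit_bound_def L2_def e_def)
  have "e * 1 \<le> e * (32 * L2 + 1)" by (intro mult_left_mono) auto
  then have e_le: "e \<le> e * (32 * L2 + 1)" by simp
  have e_less: "e * (32 * L2) \<le> e * (32 * L2 + 1)" by (intro mult_left_mono) auto
  have L: "n \<le> L" "m \<le> L" "m + n \<le> L" using L by auto
  have "n * (m + n) \<le> L * L" by (intro mult_mono L) auto
  then have R: "r \<le> 32 * L2" by (simp add: r_def L2_def power2_eq_square mult.assoc)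
  \<comment> \<open>At most L capacities with at most 2L bits each.\<close>
  have P: "P \<le> 2 ^ (2 * L2)"
  proof -
    have "P \<le> (\<Prod>i<m. 2 ^ (2 * L))"
      unfolding P_def using c by (intro prod_mono) (auto intro: less_imp_le)
    also have "\<dots> = 2 ^ (2 * L * m)" by (simp add: power_mult)
    also have "\<dots> \<le> 2 ^ (2 * L2)"
      using L(2) by (intro power_increasing) (auto simp: L2_def power2_eq_square)
    finally show ?thesis .
  qed
  have P4: "4 * P \<le> 2 ^ e" using P by (simp add: e_def power_add)
  have Y: "(4 * P) ^ r \<le> 2 ^ (e * (32 * L2))"
  proof -
    have "(4 * P) ^ r \<le> (2 ^ e) ^ r" using P4 by (intro power_mono) auto
    also have "\<dots> = 2 ^ (e * r)" by (rule power_mult[symmetric])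
    also have "\<dots> \<le> 2 ^ (e * (32 * L2))" using R by (intro power_increasing mult_left_mono) auto
    finally show ?thesis .
  qed
  have PY: "2 * P * (4 * P) ^ r \<le> 2 ^ (e * (32 * L2 + 1))"
  proof -
    have "2 * P * (4 * P) ^ r \<le> 2 ^ e * 2 ^ (e * (32 * L2))"
      using P4 Y by (intro mult_mono) auto
    also have "\<dots> = 2 ^ (e + e * (32 * L2))" by (rule power_add[symmetric])
    also have "e + e * (32 * L2) = e * (32 * L2 + 1)" by simp
    finally show ?thesis .
  qed
  have n: "n < 2 ^ L" "m < 2 ^ L" "m + n < 2 ^ L" using L by (auto intro: less_two_power)
  have mP: "m * P < 2 ^ (L + 2 * L2)" by (rule mult_less_power_two[OF n(2) P])
  have RmP: "r * (m * P) < 2 ^ (32 * L2 + (L + 2 * L2))"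
    by (rule mult_less_power_two[OF less_two_power[OF R] less_imp_le[OF mP]])
  show ?thesis
  proof (unfold_locales, fold r_def)
    have "2 * P < 2 ^ e" using P4 P_pos by linarith
    then show "2 * P < 2 ^ bit_bound L"
      by (rule power_two_less) (use e_le in \<open>simp add: bb\<close>)
    show "m * P < 2 ^ bit_bound L"
      by (rule power_two_less[OF mP]) (simp add: bb)
    show "(4 * P) ^ r < 2 ^ bit_bound L"
    proof (rule le_less_trans[OF Y])
      show "(2::nat) ^ (e * (32 * L2)) < 2 ^ bit_bound L"
        by (rule power_strict_increasing) (use e_less in \<open>simp_all add: bb\<close>)
    qed
    show "(m + n) * (2 * P * (4 * P) ^ r) < 2 ^ bit_bound L"
      by (rule power_two_less[OF mult_less_power_two[OF n(3) PY]]) (simp add: bb)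
    show "r < 2 ^ bit_bound L"
      using R by (intro less_two_power) (simp add: bb)
    show "n * (r * (m * P)) < 2 ^ bit_bound L"
      by (rule power_two_less[OF mult_less_power_two[OF n(1) less_imp_le[OF RmP]]]) (simp add: bb)
    show "w j * P ^ n < 2 ^ bit_bound L" if "j < n" for j
    proof -
      have "P ^ n \<le> (2 ^ (2 * L2)) ^ n" using P by (intro power_mono) auto
      also have "\<dots> = 2 ^ (2 * L2 * n)" by (rule power_mult[symmetric])
      also have "\<dots> \<le> 2 ^ (2 * L ^ 3)"
        using L(1) by (intro power_increasing) (auto simp: L2_def power2_eq_square power3_eq_cube)
      finally have "w j * P ^ n < 2 ^ (2 * L + 2 * L ^ 3)"
        by (rule mult_less_power_two[OF w[OF that]])
      then show ?thesis by (rule power_two_less) (simp add: bb)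
    qed
    show "n \<le> loop_bound L" "m \<le> loop_bound L" "m + n \<le> loop_bound L" "r \<le> loop_bound L"
      using L R by (auto simp: loop_bound_def L2_def)
  qed
qed

text \<open>Feasible x are functions on all naturals and hence infinitely many, but their weights
  depend only on the set of items with x j = 1. So \<open>Max\<close> is taken over a finite set,
  which is nonempty by the zero vector.\<close>

lemma OPT_le:
  assumes "k_CS_PIP k I" "\<And>x. feasible I x \<Longrightarrow> total_weight I x \<le> b"
  shows "OPT I \<le> b"
  unfolding OPT_def
proof (rule Max.boundedI)
  show "finite {total_weight I x |x. feasible I x}"
  proof (rule finite_subset)
    show "{total_weight I x |x. feasible I x} \<subseteq> (\<lambda>T. \<Sum>j\<in>T. weight I j) ` Pow {..<items I}"
    proof safe
      fix x assume x: "feasible I x"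
      have "total_weight I x = (\<Sum>j<items I. if x j = 1 then weight I j else 0)"
        unfolding total_weight_def using x by (intro sum.cong) (auto simp: feasible_def)
      also have "\<dots> = (\<Sum>j\<in>{j\<in>{..<items I}. x j = 1}. weight I j)" by (rule sum.inter_filter[symmetric]) simp
      finally show "total_weight I x \<in> (\<lambda>T. \<Sum>j\<in>T. weight I j) ` Pow {..<items I}" by blast
    qed
  qed simp
  have "feasible I (\<lambda>_. 0)" using assms(1) by (simp add: feasible_def k_CS_PIP_def)
  then show "{total_weight I x |x. feasible I x} \<noteq> {}" by blast
qed (use assms(2) in auto)

section \<open>Correctness on encoded rational instances\<close>

lemma algorithm_correct:
  assumes k: "1 \<le> k" and I: "k_CS_PIP k I" and rat: "rational_data I"
  shows "\<exists>s t. runs algorithm (input_state (encode I)) (return_pmf (s, t)) \<and>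
     t \<le> csize (loop_bound (input_size (encode I))) algorithm * bit_bound (input_size (encode I)) \<and>
     feasible I (solution s) \<and> OPT I / (8 * real k) \<le> total_weight I (solution s)"
proof -
  let ?xs = "encode I"
  define n m T L where "n = items I" and "m = rows I" and "T = m + n + m * n" and "L = input_size (encode I)"
  define den num where "den t = ?xs ! (2 * t + 3)" and "num t = ?xs ! (2 * t + 2)" for t
  define D where "D = (\<Prod>t<T. den t)"
  define a where "a t = num t * (D div den t)" for t
  define w c d where "w j = a j" and "c i = a (n + i)" and "d i j = a (n + m + (i * n + j))" for i j
  have lenT: "length (numbers I) = T" by (simp add: length_numbers T_def n_def m_def)
  have len: "length ?xs = 2 + 2 * T" by (simp add: length_encode lenT)
  have lenL: "2 + 2 * T \<le> L" using length_le_input_size[of ?xs] by (simp add: len L_def)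
  have frac: "0 < den t" "numbers I ! t = real (num t) / real (den t)" if "t < T" for t
    using numbers_rational[OF I rat nth_mem[of t]] nth_encode[of t I] encode_number_rational that lenT
    by (simp_all add: den_def num_def)
  have D_pos: "0 < D" unfolding D_def using frac by (intro prod_pos) auto
  have D_le: "D \<le> 2 ^ L" using denominators_le[OF I rat] by (simp add: D_def den_def lenT L_def)
  have a_eq: "real (a t) = real D * numbers I ! t" if "t < T" for t
  proof -
    have "den t dvd D" unfolding D_def using that by (intro dvd_prodI) auto
    then show ?thesis using frac[OF that] by (simp add: a_def real_of_nat_div)
  qed
  \<comment> \<open>L bits come from the numerator and L bits from D.\<close>
  have a_less: "a t < 2 ^ (2 * L)" if "t < T" for t
  proof -
    have "num t < 2 ^ L" unfolding num_def L_def using that len by (intro nth_less_input_size) auto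
    moreover have "D div den t \<le> 2 ^ L" using D_le by (meson div_le_dividend order_trans)
    ultimately show ?thesis using mult_less_power_two[of "num t" L "D div den t" L] by (simp add: a_def mult_2)
  qed
  have idx: "n + m + (i * n + j) < T" if "i < m" "j < n" for i j
  proof -
    have "i * n + j < Suc i * n" using that by simp
    also have "\<dots> \<le> m * n" using that by (intro mult_right_mono) auto
    finally show ?thesis by (simp add: T_def)
  qed
  have w_eq: "real (w j) = real D * weight I j" if "j < n" for j
    using a_eq[of j] nth_numbers(1)[of j I] that by (simp add: w_def T_def n_def)
  have c_eq: "real (c i) = real D * capacity I i" if "i < m" for i
    using a_eq[of "n + i"] nth_numbers(2)[of i I] that by (simp add: c_def T_def n_def m_def)
  have d_eq: "real (d i j) = real D * demand I i j" if "i < m" "j < n" for i j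
    using a_eq[OF idx[OF that]] nth_numbers(3)[of i I j] that by (simp add: d_def n_def m_def)
  interpret bounded_packing n m w c d "bit_bound L" "loop_bound L"
  proof (rule bounded_packingI)
    show "m + n \<le> L" using lenL by (simp add: T_def)
    show "w j < 2 ^ (2 * L)" if "j < n" for j using a_less that by (simp add: w_def T_def)
    show "c i < 2 ^ (2 * L)" if "i < m" for i using a_less that by (simp add: c_def T_def)
  qed
  let ?s = "input_state ?xs"
  have in_eq: "?s ''in'' i = ?xs ! i" if "i < 2 + 2 * T" for i
    using that len by (simp add: input_state_def)
  have prod_eq: "(\<Prod>t<T. ?s ''in'' (2 * t + 3)) = D"
    unfolding D_def by (intro prod.cong) (auto simp: in_eq den_def)
  have Lb: "2 * L \<le> bit_bound L" by (simp add: bit_bound_def)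
  have "wp (bit_bound L) (loop_bound L) load ?s (\<lambda>s'. s' ''n'' 0 = n \<and> s' ''m'' 0 = m \<and> s' ''M'' 0 = m + n \<and>
     (\<forall>t<m + n + m * n. s' ''A'' t =
        ?s ''in'' (2 * t + 2) * ((\<Prod>t<m + n + m * n. ?s ''in'' (2 * t + 3)) div ?s ''in'' (2 * t + 3))))"
  proof (rule wp_load, unfold prod_eq T_def[symmetric])
    show "?s ''in'' 0 = n" "?s ''in'' 1 = m"
      using in_eq[of 0] in_eq[of 1] by (simp_all add: encode_eq n_def m_def)
    show "T \<le> loop_bound L" using lenL by (simp add: loop_bound_def)
    show "T < 2 ^ bit_bound L" using lenL Lb by (intro less_two_power) simp
    show "D < 2 ^ bit_bound L"
      using D_le power_strict_increasing[of L "bit_bound L" "2::nat"] by (simp add: bit_bound_def)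
    show "0 < D" by (rule D_pos)
    show "?s ''in'' (2 * t + 2) * (D div ?s ''in'' (2 * t + 3)) < 2 ^ bit_bound L" if "t < T" for t
      using power_two_less[OF a_less[OF that] Lb] that by (simp add: in_eq a_def num_def den_def)
  qed
  then have "wp (bit_bound L) (loop_bound L) algorithm ?s (\<lambda>s'. (\<exists>X Y q U. mw_inv rounds X Y \<and> lr_inv n X q U \<and>
     greedy_inv n q U (chosen s')) \<and> (\<forall>j. s' ''out'' j \<in> {0, 1}))"
    unfolding algorithm_def
  proof (rule wp_Seq_frame)
    fix s1 assume fr: "\<And>x. x \<notin> writes load \<Longrightarrow> s1 x = ?s x"
      and s1: "s1 ''n'' 0 = n \<and> s1 ''m'' 0 = m \<and> s1 ''M'' 0 = m + n \<and>
       (\<forall>t<m + n + m * n. s1 ''A'' t =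
        ?s ''in'' (2 * t + 2) * ((\<Prod>t<m + n + m * n. ?s ''in'' (2 * t + 3)) div ?s ''in'' (2 * t + 3)))"
    have A: "s1 ''A'' t = a t" if "t < T" for t
      using s1 that unfolding prod_eq T_def[symmetric] by (simp add: in_eq a_def num_def den_def)
    have "data s1"
      using s1 A idx by (auto simp: data_def w_def c_def d_def T_def)
    then show "wp (bit_bound L) (loop_bound L) core s1 (\<lambda>s'. (\<exists>X Y q U. mw_inv rounds X Y \<and>
       lr_inv n X q U \<and> greedy_inv n q U (chosen s')) \<and> (\<forall>j. s' ''out'' j \<in> {0, 1}))"
      by (rule wp_core) (auto simp: fr load_def input_state_def)
  qed
  moreover have "bounded_state (bit_bound L) ?s"
    unfolding bounded_state_def
  proof (intro allI)
    fix x i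
    have "?xs ! i < 2 ^ bit_bound L" if "i < length ?xs"
      using nth_less_input_size[OF that] by (rule power_two_less) (simp add: L_def[symmetric] bit_bound_def)
    then show "?s x i < 2 ^ bit_bound L" by (simp add: input_state_def)
  qed
  ultimately obtain s t X Y q U where run: "runs algorithm ?s (return_pmf (s, t))"
      "t \<le> csize (loop_bound L) algorithm * bit_bound L"
    and inv: "mw_inv rounds X Y" "lr_inv n X q U" "greedy_inv n q U (chosen s)"
    and out: "\<And>j. s ''out'' j \<in> {0, 1}"
    using small_bounds(3) unfolding wp_def by blast
  have fits: "fits (chosen s)" using inv(3) by (simp add: greedy_inv_def)
  have sum_sol: "(\<Sum>j<n. f j * real (x j)) = (\<Sum>j\<in>{j. j < n \<and> x j = 1}. f j)"
    if "\<And>j. j < n \<Longrightarrow> x j \<in> {0, 1}" for f and x :: "nat \<Rightarrow> nat"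
  proof -
    have "(\<Sum>j<n. f j * real (x j)) = (\<Sum>j<n. if x j = 1 then f j else 0)"
      using that by (intro sum.cong) fastforce+
    also have "\<dots> = (\<Sum>j\<in>{j\<in>{..<n}. x j = 1}. f j)" by (rule sum.inter_filter[symmetric]) simp
    finally show ?thesis by simp
  qed
  have scaled_d: "real (\<Sum>j\<in>S. d i j) = real D * (\<Sum>j\<in>S. demand I i j)" if "i < m" "S \<subseteq> {..<n}" for i S
    using that d_eq by (auto simp: sum_distrib_left intro!: sum.cong)
  have scaled_w: "real (\<Sum>j\<in>S. w j) = real D * (\<Sum>j\<in>S. weight I j)" if "S \<subseteq> {..<n}" for S
    using that w_eq by (auto simp: sum_distrib_left intro!: sum.cong)
  \<comment> \<open>Both sides of each row are scaled by the same D > 0.\<close>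
  have fits_iff: "fits {j. j < n \<and> x j = 1} \<longleftrightarrow> feasible I x" if x: "\<And>j. j < n \<Longrightarrow> x j \<in> {0, 1}" for x
  proof -
    have "(\<Sum>j\<in>{j. j < n \<and> x j = 1}. d i j) \<le> c i \<longleftrightarrow>
        (\<Sum>j<n. demand I i j * real (x j)) \<le> capacity I i" if i: "i < m" for i
    proof -
      let ?S = "{j. j < n \<and> x j = 1}"
      have "(\<Sum>j\<in>?S. d i j) \<le> c i \<longleftrightarrow> real (\<Sum>j\<in>?S. d i j) \<le> real (c i)"
        by (simp only: of_nat_le_iff)
      also have "\<dots> \<longleftrightarrow> real D * (\<Sum>j\<in>?S. demand I i j) \<le> real D * capacity I i"
        using scaled_d[OF i, of ?S] c_eq[OF i] by (simp add: subset_iff del: of_nat_sum)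
      finally show ?thesis using D_pos sum_sol[OF x] by simp
    qed
    then show ?thesis using x unfolding fits_def feasible_def n_def[symmetric] m_def[symmetric] by auto
  qed
  have sol: "chosen s = {j. j < n \<and> solution s j = 1}" by (simp add: chosen_def solution_def)
  have feas: "feasible I (solution s)" using fits fits_iff[of "solution s"] out unfolding sol by (simp add: solution_def)
  have weight_eq: "real (sum w {j. j < n \<and> x j = 1}) = real D * total_weight I x" if "feasible I x" for x
    using scaled_w[of "{j. j < n \<and> x j = 1}"] sum_sol[of x "weight I"] that
    by (auto simp: total_weight_def feasible_def n_def)
  have sparse: "card {i. i < m \<and> 0 < d i j} \<le> k" if "j < n" for j
  proof -
    have "{i. i < m \<and> 0 < d i j} = {i. i < rows I \<and> demand I i j \<noteq> 0}"
    proof (intro Collect_cong conj_cong refl)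
      show "i < m \<longleftrightarrow> i < rows I" for i by (simp add: m_def)
      fix i assume "i < rows I"
      then have "real (d i j) = real D * demand I i j" using d_eq that by (simp add: m_def)
      then show "0 < d i j \<longleftrightarrow> demand I i j \<noteq> 0" using D_pos by (cases "d i j = 0") auto
    qed
    then show ?thesis using I that by (simp add: k_CS_PIP_def n_def)
  qed
  have "OPT I \<le> 8 * real k * total_weight I (solution s)"
  proof (rule OPT_le[OF I])
    fix x assume x: "feasible I x"
    then have "fits {j. j < n \<and> x j = 1}" using fits_iff[of x] by (simp add: feasible_def n_def)
    from local_ratio_bound[OF inv sparse k this]
    have "real D * total_weight I x \<le> 8 * real k * (real D * total_weight I (solution s))"
      unfolding weight_eq[OF x] sol weight_eq[OF feas] .
    then have "real D * total_weight I x \<le> real D * (8 * real k * total_weight I (solution s))"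
      by (simp only: mult_ac)
    then show "total_weight I x \<le> 8 * real k * total_weight I (solution s)"
      using D_pos by simp
  qed
  then have "OPT I / (8 * real k) \<le> total_weight I (solution s)"
    using k by (simp add: field_simps)
  with run feas show ?thesis unfolding L_def by blast
qed

theorem theorem2:
  "\<exists>A :: com.
     randomized_poly_time_on A {encode I | I k. k \<ge> 1 \<and> k_CS_PIP k I \<and> rational_data I} \<and>
     (\<forall>k I D. k \<ge> 1 \<longrightarrow> k_CS_PIP k I \<longrightarrow> rational_data I \<longrightarrow>
        runs A (input_state (encode I)) D \<longrightarrow>
          (\<forall>(s, t)\<in>set_pmf D. feasible I (solution s)) \<and>
          measure_pmf.expectation D (\<lambda>(s, t). total_weight I (solution s)) \<ge> OPT I / (8 * real k))"
proof (intro exI[of _ algorithm] conjI allI impI)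
  have "poly_bounded (\<lambda>L. csize (loop_bound L) algorithm * bit_bound L)"
    unfolding bit_bound_def loop_bound_def
    by (intro poly_bounded_mult poly_bounded_csize poly_bounded_add poly_bounded_const
        poly_bounded_power poly_bounded_ident)
  then obtain p :: "nat poly" where p: "\<And>L. csize (loop_bound L) algorithm * bit_bound L \<le> poly p L"
    by (auto simp: poly_bounded_def)
  show "randomized_poly_time_on algorithm {encode I | I k. k \<ge> 1 \<and> k_CS_PIP k I \<and> rational_data I}"
    unfolding randomized_poly_time_on_def
  proof (intro exI[of _ p] ballI)
    fix xs assume "xs \<in> {encode I | I k. k \<ge> 1 \<and> k_CS_PIP k I \<and> rational_data I}"
    then obtain I k where xs: "xs = encode I" and I: "1 \<le> k" "k_CS_PIP k I" "rational_data I" by blast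
    obtain s t where "runs algorithm (input_state xs) (return_pmf (s, t))"
      "t \<le> csize (loop_bound (input_size xs)) algorithm * bit_bound (input_size xs)"
      using algorithm_correct[OF I] xs by blast
    then show "\<exists>D. runs algorithm (input_state xs) D \<and> (\<forall>(s, t)\<in>set_pmf D. t \<le> poly p (input_size xs))"
      using p[of "input_size xs"] by (intro exI[of _ "return_pmf (s, t)"]) auto
  qed
next
  fix k I D
  assume I: "1 \<le> k" "k_CS_PIP k I" "rational_data I" and D: "runs algorithm (input_state (encode I)) D"
  obtain s t where st: "runs algorithm (input_state (encode I)) (return_pmf (s, t))"
    "feasible I (solution s)" "OPT I / (8 * real k) \<le> total_weight I (solution s)"
    using algorithm_correct[OF I] by blast
  \<comment> \<open>Determinism of \<open>runs\<close> identifies an arbitrary outcome distribution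
    with the point mass already found, so the expectation is its single value.\<close>
  have "D = return_pmf (s, t)" by (rule runs_deterministic[OF D st(1)])
  then show "\<forall>(s, t)\<in>set_pmf D. feasible I (solution s)"
    and "OPT I / (8 * real k) \<le> measure_pmf.expectation D (\<lambda>(s, t). total_weight I (solution s))"
    using st by simp_all
qed

end
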